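(* There exist absolute constants $C_1,C_2,C_3,c_1,c_2,c_3>0$ such that the following holds. Let $\epsilon\in(0,1/2)$ and $\delta>0$ with $\epsilon/\delta\ge C_1$, let $p\ge C_2(\epsilon^2/\delta^2)^{C_3}$, and let $k<p^{c_1}$. Consider the testing problem $H_0:P=\mathbb{P}_0$ versus $H_1:P=\mathbb{P}_v$ with $v\sim H$, where $\mathbb{P}_0$ and $\mathbb{P}_v$ are the distributions on $\mathbb{R}^p\times\mathbb{R}$ constructed in the context. Then there exists a probability distribution $H$ on the unit sphere $\mathcal{S}^{p-1}$ such that if some polynomial is an $n$-sample degree-$k$ $\tau$-distinguisher with $\tau\ge1$, then $$n\ge c_2\,p^{c_3\epsilon^2/\delta^2}.$$
   Context: Notation: $\phi$ is the standard normal density on $\mathbb{R}$; $\phi(x;\mu,s^2)$ is the density of $\mathcal{N}(\mu,s^2)$ at $x$; $\mathrm{he}_i(x)=\frac{1}{\sqrt{i!}}(-1)^ie^{x^2/2}\frac{d^i}{dx^i}e^{-x^2/2}$ are the normalized probabilist's Hermite polynomials; $[m]=\{1,\dots,m\}$, $[0:m]=\{0,\dots,m\}$. Construction of $\mathbb{P}_0,\mathbb{P}_v$: there is an absolute constant $C>0$ such that for every $m\in\mathbb{N}$ there exist measurable $g_1,\dots,g_m:\mathbb{R}\to\mathbb{R}$ with $\int\mathrm{he}_j(x)g_i(x)dx=\mathbf{1}\{i=j\}$ for $i\in[m],j\in[0:m]$, and $\sup_x|g_i(x)|/\phi(x)\le(Cm)^{i/2}$ for $i\in[m]$. Take $m=\lfloor\epsilon^2/(4C\delta^2)\rfloor$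 and such functions $g_i$. Put $a_i(y)=-\frac{(1-\epsilon)\delta^i\mathrm{he}_i(y)}{\epsilon}$, $$\kappa=\sum_{i=1}^m\sup_x\frac{|g_i(x)|}{\phi(x)}\int\phi(y)|a_i(y)|dy,\qquad D(y)=(1-\kappa)\phi(y)+\sum_{i=1}^m\phi(y)|a_i(y)|\sup_x\frac{|g_i(x)|}{\phi(x)},$$ $$f_y(x)=\frac{\phi(y)}{D(y)}\sum_{i=1}^ma_i(y)g_i(x),\qquad D_y(x)=\phi(x)+f_y(x),\qquad E_x(y)=\frac{D(y)D_y(x)}{\phi(x)}.$$ Here $D$ is a probability density, and for each $x$, $E_x(\cdot)$ is a probability density on $\mathbb{R}$. Let $R$ be the distribution with density $(1-\epsilon)\phi+\epsilon D$, let $\mathbb{P}_0=\mathcal{N}(0,I_p)\otimes R$, and for a unit vector $v$ let $\mathbb{P}_v$ be the law of $(X,y)$ with $X\sim\mathcal{N}(0,I_p)$ and $y\mid X\sim(1-\epsilon)\mathcal{N}(\delta v^\top X,1-\delta^2)+\epsilon E_{v^\top X}$. Distinguisher: an $n$-sample degree-$k$ polynomial is a polynomial $h:\mathbb{R}^{(p+1)\times n}\to\mathbb{R}$ of degree at most $k$ in the entries of the $n$ samples. A polynomial $h$ with $\mathrm{Var}_{Z\sim\mathbb{P}_0^{\otimes n}}[h(Z)]>0$ is a $\tau$-distinguisher if $$\left|\mathbb{E}_{Z\sim\mathbb{P}_0^{\otimes n}}[h(Z)]-\mathbb{E}_{v\sim H}\left[\mathbb{E}_{Z\sim\mathbb{P}_v^{\otimes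 n}}[h(Z)]\right]\right|\ge\tau\sqrt{\mathrm{Var}_{Z\sim\mathbb{P}_0^{\otimes n}}[h(Z)]}.$$ *)

theory Defs
  imports "HOL-Probability.Probability"
begin

text \<open>
  The dimension \<open>p\<close> is quantified after the absolute constants, so vectors of dimension \<open>p\<close> are
  (extensional) functions on \<open>{..<p}\<close>. A sample is a pair \<open>(x, y)\<close> and a data set of size \<open>n\<close> is
  a function on \<open>{..<n}\<close> with such pairs as values.
\<close>

type_synonym sample = "(nat \<Rightarrow> real) \<times> real"

definition hermite :: "nat \<Rightarrow> real \<Rightarrow> real" where
  "hermite i x = 1 / sqrt (fact i) * (-1) ^ i * exp (x\<^sup>2 / 2) * (deriv ^^ i) (\<lambda>t. exp (- t\<^sup>2 / 2)) x"

definition sup_ratio :: "(nat \<Rightarrow> real \<Rightarrow> real) \<Rightarrow> nat \<Rightarrow> real" where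
  "sup_ratio g i = (SUP x. \<bar>g i x\<bar> / std_normal_density x)"

text \<open>The boundedness requirement makes the real-valued supremum in \<open>sup_ratio\<close> meaningful.\<close>

definition dual_family :: "real \<Rightarrow> nat \<Rightarrow> (nat \<Rightarrow> real \<Rightarrow> real) \<Rightarrow> bool" where
  "dual_family C m g \<longleftrightarrow>
     (\<forall>i\<in>{1..m}. g i \<in> borel_measurable borel \<and>
        (\<forall>j\<in>{0..m}. integrable lborel (\<lambda>x. hermite j x * g i x) \<and>
           (\<integral>x. hermite j x * g i x \<partial>lborel) = (if i = j then 1 else 0)) \<and>
        bdd_above (range (\<lambda>x. \<bar>g i x\<bar> / std_normal_density x)) \<and>
        sup_ratio g i \<le> (C * real m) powr (real i / 2))"

definition dual_constant :: "real \<Rightarrow> bool" where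
  "dual_constant C \<longleftrightarrow> C > 0 \<and> (\<forall>m. \<exists>g. dual_family C m g)"

definition num_moments :: "real \<Rightarrow> real \<Rightarrow> real \<Rightarrow> nat" where
  "num_moments C \<epsilon> \<delta> = nat \<lfloor>\<epsilon>\<^sup>2 / (4 * C * \<delta>\<^sup>2)\<rfloor>"

definition coeff_a :: "real \<Rightarrow> real \<Rightarrow> nat \<Rightarrow> real \<Rightarrow> real" where
  "coeff_a \<epsilon> \<delta> i y = - ((1 - \<epsilon>) * \<delta> ^ i * hermite i y / \<epsilon>)"

definition kappa :: "real \<Rightarrow> real \<Rightarrow> nat \<Rightarrow> (nat \<Rightarrow> real \<Rightarrow> real) \<Rightarrow> real" where
  "kappa \<epsilon> \<delta> m g =
     (\<Sum>i=1..m. sup_ratio g i * (\<integral>y. std_normal_density y * \<bar>coeff_a \<epsilon> \<delta> i y\<bar> \<partial>lborel))"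

definition dens_D :: "real \<Rightarrow> real \<Rightarrow> nat \<Rightarrow> (nat \<Rightarrow> real \<Rightarrow> real) \<Rightarrow> real \<Rightarrow> real" where
  "dens_D \<epsilon> \<delta> m g y =
     (1 - kappa \<epsilon> \<delta> m g) * std_normal_density y +
     (\<Sum>i=1..m. std_normal_density y * \<bar>coeff_a \<epsilon> \<delta> i y\<bar> * sup_ratio g i)"

definition pert_f :: "real \<Rightarrow> real \<Rightarrow> nat \<Rightarrow> (nat \<Rightarrow> real \<Rightarrow> real) \<Rightarrow> real \<Rightarrow> real \<Rightarrow> real" where
  "pert_f \<epsilon> \<delta> m g y x =
     std_normal_density y / dens_D \<epsilon> \<delta> m g y * (\<Sum>i=1..m. coeff_a \<epsilon> \<delta> i y * g i x)"

definition cond_D :: "real \<Rightarrow> real \<Rightarrow> nat \<Rightarrow> (nat \<Rightarrow> real \<Rightarrow> real) \<Rightarrow> real \<Rightarrow> real \<Rightarrow> real" where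
  "cond_D \<epsilon> \<delta> m g y x = std_normal_density x + pert_f \<epsilon> \<delta> m g y x"

definition dens_E :: "real \<Rightarrow> real \<Rightarrow> nat \<Rightarrow> (nat \<Rightarrow> real \<Rightarrow> real) \<Rightarrow> real \<Rightarrow> real \<Rightarrow> real" where
  "dens_E \<epsilon> \<delta> m g x y = dens_D \<epsilon> \<delta> m g y * cond_D \<epsilon> \<delta> m g y x / std_normal_density x"

definition std_gaussian :: "nat \<Rightarrow> (nat \<Rightarrow> real) measure" where
  "std_gaussian p = (\<Pi>\<^sub>M i\<in>{..<p}. density lborel std_normal_density)"

definition law_R :: "real \<Rightarrow> real \<Rightarrow> nat \<Rightarrow> (nat \<Rightarrow> real \<Rightarrow> real) \<Rightarrow> real measure" where
  "law_R \<epsilon> \<delta> m g =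
     density lborel (\<lambda>y. ennreal ((1 - \<epsilon>) * std_normal_density y + \<epsilon> * dens_D \<epsilon> \<delta> m g y))"

definition law_null :: "real \<Rightarrow> real \<Rightarrow> nat \<Rightarrow> (nat \<Rightarrow> real \<Rightarrow> real) \<Rightarrow> nat \<Rightarrow> sample measure" where
  "law_null \<epsilon> \<delta> m g p = std_gaussian p \<Otimes>\<^sub>M law_R \<epsilon> \<delta> m g"

text \<open>
  The law of \<open>(X, y)\<close>: relative to (Gaussian law of \<open>X\<close>) \<open>\<times>\<close> Lebesgue, the joint density is the
  conditional density of \<open>y\<close> given \<open>X = x\<close>. The third argument of \<open>normal_density\<close> is the point
  and its second argument the standard deviation, not the variance.
\<close>

definition law_alt ::
  "real \<Rightarrow> real \<Rightarrow> nat \<Rightarrow> (nat \<Rightarrow> real \<Rightarrow> real) \<Rightarrow> nat \<Rightarrow> (nat \<Rightarrow> real) \<Rightarrow> sample measure" where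
  "law_alt \<epsilon> \<delta> m g p v =
     density (std_gaussian p \<Otimes>\<^sub>M lborel)
       (\<lambda>(x, y). let t = \<Sum>i<p. v i * x i in
          ennreal ((1 - \<epsilon>) * normal_density (\<delta> * t) (sqrt (1 - \<delta>\<^sup>2)) y + \<epsilon> * dens_E \<epsilon> \<delta> m g t y))"

definition samples :: "nat \<Rightarrow> sample measure \<Rightarrow> (nat \<Rightarrow> sample) measure" where
  "samples n P = (\<Pi>\<^sub>M j\<in>{..<n}. P)"

definition unit_sphere :: "nat \<Rightarrow> (nat \<Rightarrow> real) set" where
  "unit_sphere p = {v \<in> {..<p} \<rightarrow>\<^sub>E UNIV. (\<Sum>i<p. (v i)\<^sup>2) = 1}"

definition sphere_distribution :: "nat \<Rightarrow> (nat \<Rightarrow> real) measure \<Rightarrow> bool" where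
  "sphere_distribution p H \<longleftrightarrow>
     prob_space H \<and> sets H = sets (restrict_space (\<Pi>\<^sub>M i\<in>{..<p}. borel) (unit_sphere p))"

text \<open>
  The \<open>(p + 1) n\<close> scalar entries of a data set are indexed by \<open>{..<n} \<times> {..p}\<close>; the last entry
  of each sample is the response \<open>y\<close>.
\<close>

definition entry :: "nat \<Rightarrow> (nat \<Rightarrow> sample) \<Rightarrow> nat \<times> nat \<Rightarrow> real" where
  "entry p Z = (\<lambda>(j, i). if i < p then fst (Z j) i else snd (Z j))"

text \<open>
  Multi-indices \<open>\<alpha>\<close> of total degree at most \<open>k\<close>; that each single exponent lies in \<open>{..k}\<close> is no
  extra restriction and only serves to make the index set visibly finite.
\<close>

definition multi_indices :: "nat \<Rightarrow> nat \<Rightarrow> nat \<Rightarrow> (nat \<times> nat \<Rightarrow> nat) set" where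
  "multi_indices n p k =
     {\<alpha> \<in> ({..<n} \<times> {..p}) \<rightarrow>\<^sub>E {..k}. (\<Sum>e\<in>{..<n} \<times> {..p}. \<alpha> e) \<le> k}"

definition sample_poly :: "nat \<Rightarrow> nat \<Rightarrow> nat \<Rightarrow> ((nat \<Rightarrow> sample) \<Rightarrow> real) \<Rightarrow> bool" where
  "sample_poly n p k h \<longleftrightarrow>
     (\<exists>c. \<forall>Z. h Z = (\<Sum>\<alpha>\<in>multi_indices n p k. c \<alpha> * (\<Prod>e\<in>{..<n} \<times> {..p}. entry p Z e ^ \<alpha> e)))"

definition mean :: "'a measure \<Rightarrow> ('a \<Rightarrow> real) \<Rightarrow> real" where
  "mean M h = (\<integral>z. h z \<partial>M)"

definition var :: "'a measure \<Rightarrow> ('a \<Rightarrow> real) \<Rightarrow> real" where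
  "var M h = mean M (\<lambda>z. (h z - mean M h)\<^sup>2)"

definition distinguisher ::
  "nat \<Rightarrow> sample measure \<Rightarrow> ((nat \<Rightarrow> real) \<Rightarrow> sample measure) \<Rightarrow> (nat \<Rightarrow> real) measure \<Rightarrow>
   real \<Rightarrow> ((nat \<Rightarrow> sample) \<Rightarrow> real) \<Rightarrow> bool" where
  "distinguisher n P0 P H \<tau> h \<longleftrightarrow>
     var (samples n P0) h > 0 \<and>
     \<bar>mean (samples n P0) h - mean H (\<lambda>v. mean (samples n (P v)) h)\<bar>
       \<ge> \<tau> * sqrt (var (samples n P0) h)"

end

theory Submission
  imports Defs "HOL-Complex_Analysis.Complex_Analysis" "HOL-Library.Real_Mod" "HOL-Real_Asymp.Real_Asymp"
begin

text \<open>
  Write \<open>t = v \<bullet> X\<close>. The likelihood ratio of \<open>\<P>\<^sub>v\<close> against \<open>\<P>\<^sub>0\<close> is a function \<open>\<ll>(t, y)\<close> with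
  second moment at most \<open>8\<close>, and by the duality of the \<open>g\<^sub>i\<close> its Hermite coefficients in \<open>t\<close> of
  orders \<open>1, \<dots>, m\<close> vanish for every \<open>y\<close>. Against a polynomial of degree \<open>k\<close> in the samples, the averaged
  likelihood ratio of \<open>n\<close> samples may be replaced by the sum of those products of one-sample Hermite
  components whose total order is at most \<open>k\<close>. Since \<open>E[he\<^sub>i(v \<bullet> X) he\<^sub>j(w \<bullet> X)] = 1{i = j} (v \<bullet> w)\<^sup>j\<close>,
  the squared norm of its centred part is at most \<open>(1 + 8 \<Sum>\<^sub>j\<^sub>>\<^sub>m \<eta>\<^sup>j)\<^sup>n - 1\<close> once
  \<open>E|v \<bullet> w|\<^sup>d \<le> \<eta>\<^sup>d\<close> for \<open>1 \<le> d \<le> k\<close>. For \<open>v, w\<close> uniform on \<open>{\<plusminus>p\<^sup>-\<^sup>1\<^sup>/\<^sup>2}\<^sup>p\<close> one may take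
  \<open>\<eta> = p\<^sup>-\<^sup>1\<^sup>/\<^sup>4\<close>, and the norm is below \<open>1\<close> unless \<open>n\<close> is at least of order \<open>p\<^sup>(\<^sup>m\<^sup>+\<^sup>1\<^sup>)\<^sup>/\<^sup>4\<close>.

  The functions \<open>g\<^sub>i\<close> are \<open>\<phi>\<close> times combinations of \<open>exp(\<i> m\<^sup>1\<^sup>/\<^sup>2 sin(\<theta>) x)\<close>. With the weight
  \<open>exp(m sin(\<theta>)\<^sup>2 / 2) cos(\<theta>)\<^sup>m\<close>, of modulus at most \<open>1\<close>, the \<open>j\<close>-th Hermite moment becomes a multiple of
  the trigonometric polynomial \<open>sin(\<theta>)\<^sup>j cos(\<theta>)\<^sup>m\<close>, so one needs a measure on the circle that extracts
  the coefficient of \<open>sin(\<theta>)\<^sup>i\<close>. It is obtained from Cauchy's formula on a circle of radius \<open>i / (2 m)\<close>,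
  the values there being interpolated from the values at roots of unity.
\<close>

subsection \<open>Normalized Hermite polynomials\<close>

text \<open>The functions \<phi> he_i are dual to the Hermite polynomials, but their ratio to \<phi>
  is unbounded; hence the bounded exponentials. The size \<open>(C m)^(i/2)\<close> decides
  everything about them. Extracting the coefficient of sin^i on a circle of radius \<rho> costs
  about \<rho>^(-i), and leaving the real axis costs exp(O(m \<rho>)), as trigonometric polynomials
  of degree O(m) are involved. Taking \<rho> of order i/m balances both and leaves C^i (m/i)^i; the
  frequency scale sqrt m then contributes m^(-i/2). In the lower bound, the restriction to total
  order at most k is essential: v = w has positive probability, so moments of v . w of very high
  order are not of size \<eta>^d. For d at most k < p^(1/4) the moments of random signs give (2 e
  sqrt(d/p))^d, and \<eta> = p^(-1/4) leaves room for the constant 2 e. With m + 1 at least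
  \<epsilon>^2/(4 C \<delta>^2), the power \<eta>^(m+1) produces the exponent \<epsilon>^2/(16 C
  \<delta>^2).\<close>

abbreviation gauss :: "real measure" where
  "gauss \<equiv> density lborel std_normal_density"

lemma prob_space_gauss: "prob_space gauss"
  by (rule prob_space_normal_density) simp

lemma measurable_gauss [simp, measurable_cong]: "sets gauss = sets borel"
  by simp

lemma integrable_gauss_iff:
  fixes f :: "real \<Rightarrow> real"
  assumes "f \<in> borel_measurable borel"
  shows "integrable gauss f \<longleftrightarrow> integrable lborel (\<lambda>x. std_normal_density x * f x)"
  using assms by (subst integrable_density) auto

lemma integral_gauss:
  fixes f :: "real \<Rightarrow> real"
  assumes "f \<in> borel_measurable borel"
  shows "integral\<^sup>L gauss f = (\<integral>x. std_normal_density x * f x \<partial>lborel)"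
  using assms by (subst integral_density) auto

lemma borel_measurable_poly [measurable]:
  fixes q :: "real poly"
  shows "poly q \<in> borel_measurable borel"
  by (intro borel_measurable_continuous_onI continuous_intros)

lemma integrable_gauss_power: "integrable gauss (\<lambda>x. x ^ n)"
proof -
  have "integrable lborel (\<lambda>x. std_normal_density x * (x - 0) ^ n)"
    by (rule integrable_normal_moment) simp
  then show ?thesis by (subst integrable_gauss_iff) auto
qed

lemma integrable_gauss_poly [simp]: "integrable gauss (poly q)"
proof -
  have "integrable gauss (\<lambda>x. \<Sum>i\<le>degree q. coeff q i * x ^ i)"
    by (intro Bochner_Integration.integrable_sum integrable_mult_right integrable_gauss_power)
  then show ?thesis by (simp add: poly_altdef[abs_def])
qed

text \<open>Read off from the closed form of the even moments; for odd orders both sides vanish.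
  This is Stein's identity for monomials.\<close>

lemma gauss_moment_Suc: "(\<integral>x. x ^ Suc (Suc n) \<partial>gauss) = real (Suc n) * (\<integral>x. x ^ n \<partial>gauss)"
proof (cases "even n")
  case True
  then obtain k where k: "n = 2 * k" by (elim evenE)
  have *: "(\<integral>x. std_normal_density x * x ^ (2 * k) \<partial>lborel) = fact (2 * k) / (2 ^ k * fact k)" for k
    using integral_std_normal_moment_even .
  have "(\<integral>x. x ^ (2 * Suc k) \<partial>gauss) = fact (2 * Suc k) / (2 ^ Suc k * fact (Suc k))"
    by (subst integral_gauss) (auto simp only: *, measurable)
  also have "\<dots> = ((2 * real k + 2) * (real (Suc n) * fact (2 * k))) / ((2 * real k + 2) * (2 ^ k * fact k))"
    by (simp add: k algebra_simps)
  also have "\<dots> = real (Suc n) * (fact (2 * k) / (2 ^ k * fact k))"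
    by (subst mult_divide_mult_cancel_left) auto
  also have "fact (2 * k) / (2 ^ k * fact k) = (\<integral>x. x ^ n \<partial>gauss)"
    unfolding k by (subst integral_gauss) (auto simp only: *, measurable)
  finally show ?thesis by (simp add: k)
next
  case False
  then obtain k where k: "n = 2 * k + 1" by (elim oddE)
  have *: "(\<integral>x. x ^ (2 * k + 1) \<partial>gauss) = 0" for k
    using integral_std_normal_moment_odd[of k] by (subst integral_gauss) auto
  show ?thesis using *[of k] *[of "Suc k"] by (simp add: k)
qed

lemma pderiv_sum: "pderiv (\<Sum>i\<in>A. f i) = (\<Sum>i\<in>A. pderiv (f i))"
  by (induction A rule: infinite_finite_induct) (auto simp: pderiv_add)

text \<open>Integration by parts against the Gaussian density. Both sides are linear in
  \<open>q\<close>, so the moment recurrence suffices and no boundary terms arise.\<close>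

lemma gauss_stein: "(\<integral>x. x * poly q x \<partial>gauss) = (\<integral>x. poly (pderiv q) x \<partial>gauss)"
proof -
  have mono: "(\<integral>x. x * (c * x ^ n) \<partial>gauss) = (\<integral>x. poly (pderiv (monom c n)) x \<partial>gauss)" for c and n :: nat
  proof (cases n)
    case 0
    have "(\<integral>x. x ^ (2 * 0 + 1) \<partial>gauss) = 0"
      using integral_std_normal_moment_odd[of 0] by (subst integral_gauss) auto
    then have "(\<integral>x. c * x \<partial>gauss) = 0" by simp
    then show ?thesis by (simp add: 0 monom_0 mult.commute)
  next
    case (Suc k)
    have "(\<integral>x. x * (c * x ^ n) \<partial>gauss) = (\<integral>x. c * x ^ Suc (Suc k) \<partial>gauss)"
      by (simp add: Suc algebra_simps)
    also have "\<dots> = c * (real (Suc k) * (\<integral>x. x ^ k \<partial>gauss))"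
      unfolding integral_mult_right_zero gauss_moment_Suc ..
    also have "\<dots> = (\<integral>x. poly (pderiv (monom c n)) x \<partial>gauss)"
      by (simp add: Suc pderiv_monom poly_monom)
    finally show ?thesis .
  qed
  have int: "integrable gauss (\<lambda>x. x * (c * x ^ n))" for c n
    using integrable_mult_right[OF integrable_gauss_power[of "Suc n"], of c] by (simp add: algebra_simps)
  have "(\<integral>x. x * poly q x \<partial>gauss) = (\<integral>x. (\<Sum>i\<le>degree q. x * (coeff q i * x ^ i)) \<partial>gauss)"
    by (simp add: poly_altdef sum_distrib_left)
  also have "\<dots> = (\<Sum>i\<le>degree q. \<integral>x. poly (pderiv (monom (coeff q i) i)) x \<partial>gauss)"
    by (subst Bochner_Integration.integral_sum) (auto simp only: int mono)
  also have "\<dots> = (\<integral>x. poly (pderiv (\<Sum>i\<le>degree q. monom (coeff q i) i)) x \<partial>gauss)"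
    by (simp add: pderiv_sum poly_sum Bochner_Integration.integral_sum)
  finally show ?thesis by (simp add: poly_as_sum_of_monoms)
qed

text \<open>The operator x - d/dx raises the order by one, and 1/sqrt(j+1) keeps the norm under the
  Gaussian law equal to 1. Working in \<open>real poly\<close> gives access to degrees, coefficients
  and composition, which the derivative formula of \<open>hermite\<close> hides.\<close>

fun hp :: "nat \<Rightarrow> real poly" where
  "hp 0 = 1"
| "hp (Suc j) = smult (1 / sqrt (Suc j)) ([:0, 1:] * hp j - pderiv (hp j))"

text \<open>Differentiating the recursion gives \<open>hp (Suc j)\<close> once from the factor x; by
  the induction hypothesis the remaining terms form the raising operator again and give it j + 1
  more times.\<close>

lemma pderiv_hp_Suc: "pderiv (hp (Suc j)) = smult (sqrt (Suc j)) (hp j)"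
proof (induction j)
  case 0
  show ?case by (simp add: pderiv_smult pderiv_pCons)
next
  case (Suc j)
  have 1: "smult (sqrt (Suc j)) ([:0, 1:] * hp j - pderiv (hp j)) = smult (Suc j) (hp (Suc j))"
    by (simp add: real_div_sqrt del: of_nat_Suc)
  have "pderiv (hp (Suc (Suc j))) = smult (1 / sqrt (Suc (Suc j)))
      (hp (Suc j) + ([:0, 1:] * pderiv (hp (Suc j)) - pderiv (pderiv (hp (Suc j)))))"
    by (subst hp.simps(2)[of "Suc j"])
      (simp add: pderiv_smult pderiv_diff pderiv_mult pderiv_pCons add_diff_eq del: hp.simps)
  also have "[:0, 1:] * pderiv (hp (Suc j)) - pderiv (pderiv (hp (Suc j))) =
     smult (sqrt (Suc j)) ([:0, 1:] * hp j - pderiv (hp j))"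
    unfolding Suc.IH by (simp add: pderiv_smult smult_diff_right del: of_nat_Suc hp.simps)
  finally have "pderiv (hp (Suc (Suc j))) = smult (1 / sqrt (Suc (Suc j)))
      (hp (Suc j) + smult (Suc j) (hp (Suc j)))"
    unfolding 1 .
  also have "\<dots> = smult (1 / sqrt (Suc (Suc j)) * real (Suc (Suc j))) (hp (Suc j))"
  proof -
    have "hp (Suc j) + smult (Suc j) (hp (Suc j)) = smult (Suc (Suc j)) (hp (Suc j))"
      using smult_add_left[of 1 "real (Suc j)" "hp (Suc j)"] by (simp del: hp.simps)
    then show ?thesis by (simp only: smult_smult)
  qed
  also have "1 / sqrt (Suc (Suc j)) * real (Suc (Suc j)) = sqrt (Suc (Suc j))"
    by (simp add: field_simps real_sqrt_mult_self del: of_nat_Suc)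
  finally show ?case .
qed

lemma hp_rec: "smult (sqrt (Suc (Suc j))) (hp (Suc (Suc j))) =
    [:0, 1:] * hp (Suc j) - smult (sqrt (Suc j)) (hp j)"
  by (subst hp.simps(2)[of "Suc j"]) (simp add: pderiv_hp_Suc del: of_nat_Suc hp.simps)

lemma degree_coeff_hp: "degree (hp j) \<le> j \<and> coeff (hp j) j = 1 / sqrt (fact j)"
proof (induction j)
  case 0
  show ?case by simp
next
  case (Suc j)
  have d: "degree (pderiv (hp j)) \<le> j"
    using Suc by (auto simp: degree_pderiv)
  have "degree ([:0, 1:] * hp j - pderiv (hp j)) \<le> Suc j"
    using d Suc by (intro degree_diff_le) (auto intro: order.trans[OF degree_pCons_le])
  moreover have "coeff (pderiv (hp j)) (Suc j) = 0"
    using d by (intro coeff_eq_0) simp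
  ultimately show ?case
    using Suc by (simp add: real_sqrt_mult del: of_nat_Suc)
qed

lemma degree_hp_le: "degree (hp j) \<le> j" and coeff_hp_top: "coeff (hp j) j = 1 / sqrt (fact j)"
  using degree_coeff_hp by auto

lemma hermite_deriv:
  "(deriv ^^ j) (\<lambda>t::real. exp (- t\<^sup>2 / 2)) = (\<lambda>x. (-1) ^ j * sqrt (fact j) * poly (hp j) x * exp (- x\<^sup>2 / 2))"
proof (induction j)
  case 0
  show ?case by simp
next
  case (Suc j)
  show ?case
  proof
    fix x :: real
    have "((\<lambda>x. (-1) ^ j * sqrt (fact j) * poly (hp j) x * exp (- x\<^sup>2 / 2)) has_field_derivative
      (-1) ^ j * sqrt (fact j) * (poly (pderiv (hp j)) x * exp (- x\<^sup>2 / 2) +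
        poly (hp j) x * (exp (- x\<^sup>2 / 2) * (- x)))) (at x)"
      by (auto intro!: derivative_eq_intros simp: algebra_simps)
    then have "deriv (\<lambda>x. (-1) ^ j * sqrt (fact j) * poly (hp j) x * exp (- x\<^sup>2 / 2)) x =
       (-1) ^ j * sqrt (fact j) * (poly (pderiv (hp j)) x * exp (- x\<^sup>2 / 2) +
        poly (hp j) x * (exp (- x\<^sup>2 / 2) * (- x)))"
      by (rule DERIV_imp_deriv)
    also have "\<dots> = (-1) ^ Suc j * sqrt (fact (Suc j)) * poly (hp (Suc j)) x * exp (- x\<^sup>2 / 2)"
      by (simp add: real_sqrt_mult field_simps del: of_nat_Suc)
    finally show "(deriv ^^ Suc j) (\<lambda>t::real. exp (- t\<^sup>2 / 2)) x = (-1) ^ Suc j * sqrt (fact (Suc j)) * poly (hp (Suc j)) x * exp (- x\<^sup>2 / 2)"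
      unfolding Suc.IH funpow.simps comp_def .
  qed
qed

lemma hermite_eq_poly: "hermite j x = poly (hp j) x"
proof -
  have "hermite j x = ((-1) ^ j * (-1) ^ j) * (exp (x\<^sup>2 / 2) * exp (- x\<^sup>2 / 2)) * poly (hp j) x"
    unfolding hermite_def hermite_deriv by simp
  then show ?thesis
    by (simp add: exp_add[symmetric] power_add[symmetric] flip: mult_2)
qed

text \<open>By Stein's identity the raising operator x - d/dx is the adjoint of d/dx under the
  Gaussian law.\<close>

lemma gauss_hp_Suc:
  "sqrt (Suc j) * (\<integral>x. poly (hp (Suc j) * q) x \<partial>gauss) = (\<integral>x. poly (hp j * pderiv q) x \<partial>gauss)"
proof -
  have "sqrt (Suc j) * (\<integral>x. poly (hp (Suc j) * q) x \<partial>gauss) =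
     (\<integral>x. poly (smult (sqrt (Suc j)) (hp (Suc j)) * q) x \<partial>gauss)"
    by (simp only: poly_smult mult_smult_left integral_mult_right_zero)
  also have "smult (sqrt (Suc j)) (hp (Suc j)) * q = [:0, 1:] * (hp j * q) - pderiv (hp j) * q"
    by (simp add: algebra_simps del: of_nat_Suc)
  also have "(\<integral>x. poly ([:0, 1:] * (hp j * q) - pderiv (hp j) * q) x \<partial>gauss) =
     (\<integral>x. poly ([:0, 1:] * (hp j * q)) x \<partial>gauss) - (\<integral>x. poly (pderiv (hp j) * q) x \<partial>gauss)"
    by (simp only: poly_diff Bochner_Integration.integral_diff integrable_gauss_poly)
  also have "(\<integral>x. poly ([:0, 1:] * (hp j * q)) x \<partial>gauss) = (\<integral>x. poly (pderiv (hp j * q)) x \<partial>gauss)"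
    using gauss_stein[of "hp j * q"] by simp
  also have "\<dots> = (\<integral>x. poly (hp j * pderiv q) x \<partial>gauss) + (\<integral>x. poly (pderiv (hp j) * q) x \<partial>gauss)"
    by (simp only: pderiv_mult poly_add Bochner_Integration.integral_add integrable_gauss_poly mult.commute[of q])
  finally show ?thesis by simp
qed

lemma gauss_hp_poly:
  "sqrt (fact j) * (\<integral>x. poly (hp j * q) x \<partial>gauss) = (\<integral>x. poly ((pderiv ^^ j) q) x \<partial>gauss)"
proof (induction j arbitrary: q)
  case (Suc j)
  show ?case
    using gauss_hp_Suc[of j q] Suc.IH[of "pderiv q"]
    by (simp add: real_sqrt_mult funpow_swap1 mult.assoc mult.left_commute[of "sqrt (1 + real j)"] del: hp.simps)
qed simp

text \<open>Moving j derivatives onto \<open>q\<close> leaves the constant j!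
  \<open>coeff q j\<close>. Orthogonality to lower degrees and the normalization are both instances
  of this.\<close>

lemma gauss_hp_top:
  assumes "degree q \<le> j"
  shows "(\<integral>x. poly (hp j) x * poly q x \<partial>gauss) = sqrt (fact j) * coeff q j"
proof -
  interpret prob_space gauss by (rule prob_space_gauss)
  have "degree ((pderiv ^^ j) q) = 0"
    using assms by (simp add: degree_higher_pderiv)
  then obtain c where c: "(pderiv ^^ j) q = [:c:]"
    by (meson degree_eq_zeroE)
  have "coeff ((pderiv ^^ j) q) 0 = fact j * coeff q j"
    by (simp add: coeff_higher_pderiv pochhammer_fact)
  then have "sqrt (fact j) * (\<integral>x. poly (hp j * q) x \<partial>gauss) = fact j * coeff q j"
    unfolding gauss_hp_poly c using prob_space by (simp add: poly_pCons[abs_def])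
  also have "\<dots> = sqrt (fact j) * (sqrt (fact j) * coeff q j)" by simp
  finally show ?thesis by simp
qed

lemma gauss_hp_orthonormal:
  "(\<integral>x. poly (hp i) x * poly (hp j) x \<partial>gauss) = (if i = j then 1 else 0)"
proof -
  have *: "(\<integral>x. poly (hp j) x * poly (hp i) x \<partial>gauss) = (if i = j then 1 else 0)" if "i \<le> j" for i j
  proof -
    have "coeff (hp i) j = (if i = j then 1 / sqrt (fact j) else 0)"
      using that degree_hp_le[of i] by (auto simp: coeff_hp_top intro!: coeff_eq_0)
    then show ?thesis
      using gauss_hp_top[of "hp i" j] degree_hp_le[of i] that by auto
  qed
  show ?thesis
    using *[of i j] *[of j i] by (cases "i \<le> j") (auto simp: mult.commute)
qed

text \<open>Hermite polynomials are eigenfunctions of the Ornstein-Uhlenbeck semigroup. The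
  three-term recurrence is evaluated at \<rho> y + s u; Stein's identity in u turns the summand with
  the factor s u into s^2 times a lower-order term, and 1 - s^2 = \<rho>^2 restores the recurrence
  at y.\<close>

lemma gauss_ornstein_uhlenbeck:
  assumes "\<rho>\<^sup>2 + s\<^sup>2 = 1"
  shows "(\<integral>u. poly (hp j) (\<rho> * y + s * u) \<partial>gauss) = \<rho> ^ j * poly (hp j) y"
proof (induction j rule: less_induct)
  case (less j)
  interpret prob_space gauss by (rule prob_space_gauss)
  consider "j = 0" | "j = 1" | i where "j = Suc (Suc i)"
    by (metis One_nat_def not0_implies_Suc)
  then show ?case
  proof cases
    case 1 then show ?thesis using prob_space by simp
  next
    case 2
    have "(\<integral>u. u \<partial>gauss) = 0" using gauss_stein[of 1] by simp
    moreover have "integrable gauss (\<lambda>u. u)" using integrable_gauss_power[of 1] by simp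
    ultimately show ?thesis using 2 prob_space by simp
  next
    case 3
    define Q where "Q k = (\<integral>u. poly (hp k) (\<rho> * y + s * u) \<partial>gauss)" for k
    have P: "poly (hp k) (\<rho> * y + s * u) = poly (pcompose (hp k) [:\<rho> * y, s:]) u" for k u
      by (simp add: poly_pcompose mult.commute)
    have intP: "integrable gauss (\<lambda>u. poly (hp k) (\<rho> * y + s * u))" for k
      unfolding P by simp
    have intuP: "integrable gauss (\<lambda>u. u * poly (hp k) (\<rho> * y + s * u))" for k
      using integrable_gauss_poly[of "[:0, 1:] * pcompose (hp k) [:\<rho> * y, s:]"] unfolding P poly_mult by simp
    have S: "(\<integral>u. u * poly (hp (Suc i)) (\<rho> * y + s * u) \<partial>gauss) = s * sqrt (Suc i) * Q i"
      unfolding P gauss_stein pderiv_pcompose pderiv_hp_Suc Q_def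
      by (simp add: pderiv_pCons pcompose_smult mult_ac poly_smult[abs_def] del: hp.simps)
    have "sqrt (Suc (Suc i)) * Q j = (\<integral>u. poly (smult (sqrt (Suc (Suc i))) (hp (Suc (Suc i)))) (\<rho> * y + s * u) \<partial>gauss)"
      by (simp add: Q_def 3 del: hp.simps)
    also have "\<dots> = (\<integral>u. (\<rho> * y) * poly (hp (Suc i)) (\<rho> * y + s * u) + s * (u * poly (hp (Suc i)) (\<rho> * y + s * u))
         - sqrt (Suc i) * poly (hp i) (\<rho> * y + s * u) \<partial>gauss)"
      unfolding hp_rec by (intro Bochner_Integration.integral_cong) (auto simp: algebra_simps simp del: hp.simps)
    also have "\<dots> = \<rho> * y * Q (Suc i) + s * (s * sqrt (Suc i) * Q i) - sqrt (Suc i) * Q i"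
      using intP[of "Suc i"] intuP[of "Suc i"] intP[of i]
      by (simp add: S Q_def del: hp.simps)
    also have "\<dots> = \<rho> * y * Q (Suc i) - (1 - s\<^sup>2) * sqrt (Suc i) * Q i"
      by (simp add: algebra_simps power2_eq_square)
    also have "1 - s\<^sup>2 = \<rho>\<^sup>2" using assms by simp
    also have "Q (Suc i) = \<rho> ^ Suc i * poly (hp (Suc i)) y"
      unfolding Q_def by (rule less) (simp add: 3)
    also have "Q i = \<rho> ^ i * poly (hp i) y"
      unfolding Q_def by (rule less) (simp add: 3)
    also have "\<rho> * y * (\<rho> ^ Suc i * poly (hp (Suc i)) y) - \<rho>\<^sup>2 * sqrt (Suc i) * (\<rho> ^ i * poly (hp i) y) =
        \<rho> ^ j * poly ([:0, 1:] * hp (Suc i) - smult (sqrt (Suc i)) (hp i)) y"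
      by (simp add: 3 algebra_simps power2_eq_square del: hp.simps)
    also have "\<dots> = sqrt (Suc (Suc i)) * (\<rho> ^ j * poly (hp j) y)"
      unfolding hp_rec[symmetric] by (simp add: 3 del: hp.simps)
    finally show ?thesis by (simp add: Q_def)
  qed
qed

subsection \<open>Dual functions for Hermite polynomials\<close>

lemma std_normal_density_power_tendsto_0:
  "((\<lambda>x. std_normal_density x * x ^ n) \<longlongrightarrow> 0) at_top"
  unfolding std_normal_density_def by real_asymp

lemma std_normal_density_poly_tendsto_0:
  "((\<lambda>x. std_normal_density x * poly q x) \<longlongrightarrow> 0) at_top"
proof -
  have "((\<lambda>x. \<Sum>i\<le>degree q. coeff q i * (std_normal_density x * x ^ i)) \<longlongrightarrow> (\<Sum>i\<le>degree q. coeff q i * 0)) at_top"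
    by (intro tendsto_sum tendsto_mult tendsto_const std_normal_density_power_tendsto_0)
  then show ?thesis by (simp add: poly_altdef sum_distrib_left mult_ac)
qed

lemma std_normal_density_poly_tendsto_0':
  "((\<lambda>x. std_normal_density x * poly q x) \<longlongrightarrow> 0) at_bot"
proof -
  have "std_normal_density (- x) * poly q (- x) = std_normal_density x * poly (pcompose q [:0, -1:]) x" for x
    by (simp add: std_normal_density_def poly_pcompose)
  then show ?thesis
    unfolding filterlim_at_bot_mirror using std_normal_density_poly_tendsto_0 by simp
qed

lemma integral_derivative_real_line:
  fixes F f :: "real \<Rightarrow> complex"
  assumes "\<And>x. (F has_vector_derivative f x) (at x)" "continuous_on UNIV f" "integrable lborel f"
    and "(F \<longlongrightarrow> 0) at_top" "(F \<longlongrightarrow> 0) at_bot"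
  shows "(\<integral>x. f x \<partial>lborel) = 0"
proof -
  have "(LBINT x=-\<infinity>..\<infinity>. f x) = 0 - 0"
    using assms
    by (intro interval_integral_FTC_integrable[where F = F])
      (auto simp: set_integrable_def einterval_eq_UNIV ereal_tendsto_simps continuous_on_eq_continuous_at)
  then show ?thesis
    by (simp add: interval_lebesgue_integral_def einterval_eq_UNIV set_lebesgue_integral_def)
qed

definition gauss_char :: "real poly \<Rightarrow> real \<Rightarrow> complex" where
  "gauss_char q t = (\<integral>x. complex_of_real (poly q x) * iexp (t * x) \<partial>gauss)"

lemma gauss_char_integrable: "integrable gauss (\<lambda>x. complex_of_real (poly q x) * iexp (t * x))"
proof (rule Bochner_Integration.integrable_bound)
  show "integrable gauss (\<lambda>x. poly q x)" by simp
  show "AE x in gauss. norm (complex_of_real (poly q x) * iexp (t * x)) \<le> norm (poly q x)"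
    by (auto simp: norm_mult)
qed measurable

text \<open>The derivative of \<phi> q exp(i t x) is \<phi> (i t q - (x q - q')) exp(i t x) and
  integrates to 0 over the line. So the raising operator becomes multiplication by i t.\<close>

lemma gauss_char_stein:
  "gauss_char ([:0, 1:] * q - pderiv q) t = \<i> * t * gauss_char q t"
proof -
  define F where "F x = complex_of_real (std_normal_density x * poly q x) * iexp (t * x)" for x
  define s where "s = [:0, 1:] * q - pderiv q"
  define f where "f x = complex_of_real (std_normal_density x) * (\<i> * t * (complex_of_real (poly q x) * iexp (t * x)) - complex_of_real (poly s x) * iexp (t * x))" for x
  have dphi: "(std_normal_density has_real_derivative - x * std_normal_density x) (at x)" for x
  proof -
    have "((\<lambda>x. 1 / sqrt (2 * pi) * exp (- x\<^sup>2 / 2)) has_real_derivative 1 / sqrt (2 * pi) * (exp (- x\<^sup>2 / 2) * - x)) (at x)"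
      by (rule DERIV_cmult) (auto intro!: derivative_eq_intros)
    then show ?thesis
      unfolding std_normal_density_def[abs_def] by (simp add: mult_ac)
  qed
  have F': "(F has_vector_derivative f x) (at x)" for x
  proof -
    have "((\<lambda>x. std_normal_density x * poly q x) has_real_derivative - (std_normal_density x * poly s x)) (at x)"
      by (auto intro!: derivative_eq_intros dphi simp: s_def algebra_simps)
    then have 1: "((\<lambda>x. complex_of_real (std_normal_density x * poly q x)) has_vector_derivative
      complex_of_real (- (std_normal_density x * poly s x))) (at x)"
      by (intro has_vector_derivative_of_real) (simp add: has_real_derivative_iff_has_vector_derivative)
    have 2: "((\<lambda>x. iexp (t * x)) has_vector_derivative (\<i> * t * iexp (t * x))) (at x)"
    proof -
      have "((\<lambda>z. exp (\<i> * (complex_of_real t * z))) has_field_derivative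
          \<i> * t * exp (\<i> * (complex_of_real t * of_real x))) (at (of_real x))"
        by (auto intro!: derivative_eq_intros)
      from has_vector_derivative_real_field[OF this] show ?thesis by simp
    qed
    show ?thesis
      unfolding F_def[abs_def] f_def
      using has_vector_derivative_mult[OF 1 2] by (simp add: algebra_simps)
  qed
  have F_norm: "norm (F x) = \<bar>std_normal_density x * poly q x\<bar>" for x
    by (simp add: F_def norm_mult abs_mult del: of_real_mult)
  have lim: "(F \<longlongrightarrow> 0) at_top" "(F \<longlongrightarrow> 0) at_bot"
    unfolding tendsto_norm_zero_iff[of F, symmetric] F_norm
    by (rule tendsto_rabs_zero std_normal_density_poly_tendsto_0 std_normal_density_poly_tendsto_0')+
  have int: "integrable gauss (\<lambda>x. \<i> * t * (complex_of_real (poly q x) * iexp (t * x)) - complex_of_real (poly s x) * iexp (t * x))"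
    by (intro Bochner_Integration.integrable_diff integrable_mult_right gauss_char_integrable)
  have "(\<integral>x. f x \<partial>lborel) = 0"
  proof (rule integral_derivative_real_line[OF F' _ _ lim])
    show "continuous_on UNIV f"
      unfolding f_def std_normal_density_def by (intro continuous_intros) auto
    show "integrable lborel f"
      using int by (subst (asm) integrable_density) (auto simp: f_def[abs_def] scaleR_conv_of_real)
  qed
  also have "(\<integral>x. f x \<partial>lborel) = (\<integral>x. \<i> * t * (complex_of_real (poly q x) * iexp (t * x)) - complex_of_real (poly s x) * iexp (t * x) \<partial>gauss)"
    by (subst integral_density) (auto simp: f_def[abs_def] scaleR_conv_of_real)
  also have "\<dots> = \<i> * t * gauss_char q t - gauss_char s t"
    unfolding gauss_char_def
    by (simp only: Bochner_Integration.integral_diff integral_mult_right_zero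
      integrable_mult_right gauss_char_integrable)
  finally show ?thesis by (simp add: s_def)
qed

lemma gauss_char_smult: "gauss_char (smult c q) t = c * gauss_char q t"
  by (simp add: gauss_char_def mult.assoc)

text \<open>Each raising step contributes the factor i t / sqrt(j+1). Up to the factor exp(-t^2/2),
  which the weights of the dual functions are built to cancel, the j-th Hermite moment of an
  exponential is thus a monomial in its frequency.\<close>

lemma gauss_char_hp: "gauss_char (hp j) t = (\<i> * t) ^ j / sqrt (fact j) * complex_of_real (exp (- (t\<^sup>2 / 2)))"
proof (induction j)
  case 0
  have "gauss_char 1 t = char gauss t" by (simp add: gauss_char_def char_def)
  then show ?case by (simp add: char_std_normal_distribution)
next
  case (Suc j)
  have "gauss_char (hp (Suc j)) t = (1 / sqrt (Suc j)) * (\<i> * t * gauss_char (hp j) t)"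
    unfolding hp.simps(2) gauss_char_smult gauss_char_stein ..
  then show ?case
    unfolding Suc.IH by (simp add: real_sqrt_mult field_simps del: of_nat_Suc)
qed

section \<open>Interpolation from roots of unity\<close>

definition root_of_unity :: "nat \<Rightarrow> nat \<Rightarrow> complex" where
  "root_of_unity L s = cis (2 * pi * s / L)"

lemma norm_root_of_unity [simp]: "norm (root_of_unity L s) = 1"
  by (simp add: root_of_unity_def)

text \<open>A geometric sum whose ratio has L-th power 1 and differs from 1, because 0 < |a - b| <
  L.\<close>

lemma root_of_unity_orthogonal:
  assumes "a < L" "b < L"
  shows "(\<Sum>s<L. root_of_unity L s ^ a * cnj (root_of_unity L s) ^ b) = (if a = b then of_nat L else 0)"
proof -
  define \<zeta> where "\<zeta> = cis (2 * pi * (real a - real b) / L)"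
  have L: "L > 0" using assms by simp
  have tm: "root_of_unity L s ^ a * cnj (root_of_unity L s) ^ b = \<zeta> ^ s" for s
  proof -
    have "root_of_unity L s ^ a * cnj (root_of_unity L s) ^ b =
        cis (real a * (2 * pi * s / L) + real b * - (2 * pi * s / L))"
      by (simp only: root_of_unity_def cis_cnj Complex.DeMoivre cis_mult)
    also have "real a * (2 * pi * s / L) + real b * - (2 * pi * s / L) = real s * (2 * pi * (real a - real b) / L)"
      using L by (simp add: field_simps)
    finally show ?thesis by (simp only: \<zeta>_def Complex.DeMoivre)
  qed
  show ?thesis
  proof (cases "a = b")
    case True
    then show ?thesis unfolding tm by (simp add: \<zeta>_def)
  next
    case False
    have "\<zeta> \<noteq> 1"
    proof
      assume "\<zeta> = 1"
      then obtain n where "2 * pi * (real a - real b) / L = of_int n * (2 * pi)"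
        unfolding \<zeta>_def cis_eq_1_iff by blast
      then have "(2 * pi) * (real a - real b) = (2 * pi) * (of_int n * real L)"
        using L by (simp add: field_simps)
      then have "real a - real b = of_int n * real L"
        by (subst (asm) mult_left_cancel) auto
      then have n: "int a - int b = n * int L"
        by (metis of_int_diff of_int_eq_iff of_int_mult of_int_of_nat_eq)
      then have "n \<noteq> 0" using False by auto
      then have "1 * int L \<le> \<bar>n\<bar> * int L" by (intro mult_right_mono) auto
      then have "int L \<le> \<bar>n * int L\<bar>" by (simp add: abs_mult)
      then show False using n assms by linarith
    qed
    moreover have "\<zeta> ^ L = 1"
    proof -
      have "\<zeta> ^ L = cis (2 * pi * (real a - real b))"
        unfolding \<zeta>_def Complex.DeMoivre using L by simp
      also have "\<dots> = 1" by (rule cis_multiple_2pi) auto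
      finally show ?thesis .
    qed
    ultimately show ?thesis
      unfolding tm using False by (simp add: geometric_sum)
  qed
qed

lemma root_of_unity_parseval:
  "(\<Sum>s<L. (norm (\<Sum>a<L. c a * root_of_unity L s ^ a))\<^sup>2) = L * (\<Sum>a<L. (norm (c a))\<^sup>2)"
proof -
  have "complex_of_real (\<Sum>s<L. (norm (\<Sum>a<L. c a * root_of_unity L s ^ a))\<^sup>2) =
    (\<Sum>s<L. (\<Sum>a<L. c a * root_of_unity L s ^ a) * cnj (\<Sum>a<L. c a * root_of_unity L s ^ a))"
    by (simp only: of_real_sum complex_norm_square)
  also have "\<dots> = (\<Sum>s<L. \<Sum>a<L. \<Sum>b<L. (c a * cnj (c b)) * (root_of_unity L s ^ a * cnj (root_of_unity L s) ^ b))"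
    by (simp add: sum_product mult_ac)
  also have "\<dots> = (\<Sum>a<L. \<Sum>b<L. \<Sum>s<L. (c a * cnj (c b)) * (root_of_unity L s ^ a * cnj (root_of_unity L s) ^ b))"
    by (subst sum.swap) (rule sum.cong[OF refl], rule sum.swap)
  also have "\<dots> = (\<Sum>a<L. \<Sum>b<L. if a = b then L * (c a * cnj (c a)) else 0)"
    by (intro sum.cong refl) (auto simp: root_of_unity_orthogonal simp flip: sum_distrib_left)
  also have "\<dots> = complex_of_real (L * (\<Sum>a<L. (norm (c a))\<^sup>2))"
    by (simp add: sum_distrib_left flip: complex_norm_square)
  finally show ?thesis by (rule of_real_eq_iff[THEN iffD1])
qed


text \<open>
  The product of two Dirichlet kernels is exact on degree at most \<open>2 d\<close>, and by the Cauchy-Schwarz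
  inequality and Parseval's identity its \<open>\<ell>\<^sup>1\<close> norm is bounded uniformly in \<open>d\<close> on the unit circle.
\<close>

definition interp_kernel :: "nat \<Rightarrow> nat \<Rightarrow> complex \<Rightarrow> complex" where
  "interp_kernel d s w =
     (\<Sum>a<4 * d + 1. (w * cnj (root_of_unity (4 * d + 1) s)) ^ a) *
     (\<Sum>b\<le>2 * d. (root_of_unity (4 * d + 1) s / w) ^ b) / (2 * d + 1)"

text \<open>Orthogonality keeps only the pairs with a = b + l, and each of the 2 d + 1 values of b
  then yields w^l. With 4 d + 1 nodes there is no aliasing, as b + l is at most 4 d.\<close>

lemma interp_kernel_reproducing:
  assumes l: "l \<le> 2 * d" and w: "w \<noteq> 0"
  shows "(\<Sum>s<4 * d + 1. interp_kernel d s w * root_of_unity (4 * d + 1) s ^ l) = of_nat (4 * d + 1) * w ^ l"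
proof -
  define L where "L = 4 * d + 1"
  let ?\<omega> = "root_of_unity L"
  have "(\<Sum>s<L. interp_kernel d s w * ?\<omega> s ^ l) =
    (\<Sum>s<L. \<Sum>a<L. \<Sum>b\<le>2 * d. w ^ a / w ^ b / (2 * d + 1) * (?\<omega> s ^ (b + l) * cnj (?\<omega> s) ^ a))"
    unfolding interp_kernel_def L_def[symmetric] sum_product
    by (simp only: sum_divide_distrib sum_distrib_right, intro sum.cong refl)
      (simp add: power_mult_distrib power_divide power_add mult_ac)
  also have "\<dots> = (\<Sum>a<L. \<Sum>b\<le>2 * d. \<Sum>s<L. w ^ a / w ^ b / (2 * d + 1) * (?\<omega> s ^ (b + l) * cnj (?\<omega> s) ^ a))"
    by (subst sum.swap) (rule sum.cong[OF refl], rule sum.swap)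
  also have "\<dots> = (\<Sum>a<L. \<Sum>b\<le>2 * d. if b + l = a then w ^ a / w ^ b / (2 * d + 1) * L else 0)"
  proof (intro sum.cong refl)
    fix a b assume "a \<in> {..<L}" "b \<in> {..2 * d}"
    then have "b + l < L" "a < L" using l by (auto simp: L_def)
    from root_of_unity_orthogonal[OF this]
    show "(\<Sum>s<L. w ^ a / w ^ b / (2 * d + 1) * (?\<omega> s ^ (b + l) * cnj (?\<omega> s) ^ a)) =
      (if b + l = a then w ^ a / w ^ b / (2 * d + 1) * L else 0)"
      unfolding sum_distrib_left[symmetric] by simp
  qed
  also have "\<dots> = (\<Sum>b\<le>2 * d. \<Sum>a<L. if a = b + l then w ^ l / (2 * d + 1) * L else 0)"
    by (subst sum.swap) (intro sum.cong refl, use w in \<open>auto simp: power_add\<close>)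
  also have "\<dots> = (\<Sum>b\<le>2 * d. w ^ l / (2 * d + 1) * L)"
  proof (intro sum.cong refl)
    fix b assume "b \<in> {..2 * d}"
    then have "b + l < L" using l by (simp add: L_def)
    then show "(\<Sum>a<L. if a = b + l then w ^ l / (2 * d + 1) * L else 0) = w ^ l / (2 * d + 1) * L"
      by simp
  qed
  also have "\<dots> = of_nat L * w ^ l"
  proof -
    have "x * (y / x * z) = z * y" if "x \<noteq> 0" for x y z :: complex
      using that by simp
    moreover have "complex_of_nat (2 * d + 1) \<noteq> 0"
      unfolding of_nat_eq_0_iff by simp
    ultimately show ?thesis
      by (simp only: sum_constant card_atMost Suc_eq_plus1)
  qed
  finally show ?thesis by (simp add: L_def)
qed

text \<open>The two kernels are separated by Cauchy-Schwarz, and Parseval's identity evaluates each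
  sum of squares. The factor exp(6 d r) is the price of evaluating off the unit circle, where powers
  of w and 1/w may grow like exp(r) per degree.\<close>

lemma sum_norm_interp_kernel_le:
  assumes w: "norm w \<le> exp r" "norm (1 / w) \<le> exp r" and r: "0 \<le> r"
  shows "(\<Sum>s<4 * d + 1. norm (interp_kernel d s w)) \<le> 2 * real (4 * d + 1) * exp (6 * real d * r)"
proof -
  define L where "L = 4 * d + 1"
  let ?\<omega> = "root_of_unity L"
  define A where "A s = norm (\<Sum>a<L. (w * cnj (?\<omega> s)) ^ a)" for s
  define B where "B s = norm (\<Sum>b\<le>2 * d. (?\<omega> s / w) ^ b)" for s
  have pw: "(x ^ a)\<^sup>2 \<le> exp (2 * real n * r)" if "0 \<le> x" "x \<le> exp r" "a \<le> n" for x :: real and a n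
  proof -
    have "(x ^ a)\<^sup>2 = x ^ (2 * a)" by (simp add: power_mult[symmetric] mult.commute)
    also have "\<dots> \<le> exp r ^ (2 * a)" using that by (intro power_mono) auto
    also have "\<dots> \<le> exp r ^ (2 * n)" using that r by (intro power_increasing) auto
    also have "\<dots> = exp (2 * real n * r)" by (simp flip: exp_of_nat_mult)
    finally show ?thesis .
  qed
  have "(\<Sum>s<L. (A s)\<^sup>2) = (\<Sum>s<L. (norm (\<Sum>a<L. (cnj w) ^ a * ?\<omega> s ^ a))\<^sup>2)"
  proof (intro sum.cong refl arg_cong[where f = "\<lambda>x. x\<^sup>2"])
    fix s
    have "A s = norm (cnj (\<Sum>a<L. (w * cnj (?\<omega> s)) ^ a))" unfolding A_def by (rule complex_mod_cnj[symmetric])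
    also have "cnj (\<Sum>a<L. (w * cnj (?\<omega> s)) ^ a) = (\<Sum>a<L. (cnj w) ^ a * ?\<omega> s ^ a)"
      by (simp only: cnj_sum complex_cnj_power complex_cnj_mult complex_cnj_cnj power_mult_distrib)
    finally show "A s = norm (\<Sum>a<L. (cnj w) ^ a * ?\<omega> s ^ a)" .
  qed
  also have "\<dots> = L * (\<Sum>a<L. (norm w ^ a)\<^sup>2)"
    unfolding root_of_unity_parseval by (simp add: norm_power)
  also have "\<dots> \<le> L * (\<Sum>a<L. exp (2 * real (4 * d) * r))"
    using w by (intro mult_left_mono sum_mono pw) (auto simp: L_def)
  finally have A: "(\<Sum>s<L. (A s)\<^sup>2) \<le> (real L)\<^sup>2 * exp (8 * d * r)"
    by (simp add: power2_eq_square mult_ac)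
  have "(\<Sum>s<L. (B s)\<^sup>2) = (\<Sum>s<L. (norm (\<Sum>a<L. (if a \<le> 2 * d then (1 / w) ^ a else 0) * ?\<omega> s ^ a))\<^sup>2)"
  proof (intro sum.cong refl arg_cong[where f = "\<lambda>x. x\<^sup>2"])
    fix s
    have "(\<Sum>b\<le>2 * d. (?\<omega> s / w) ^ b) = (\<Sum>a\<le>2 * d. (if a \<le> 2 * d then (1 / w) ^ a else 0) * ?\<omega> s ^ a)"
      by (intro sum.cong refl) (simp add: power_divide)
    also have "\<dots> = (\<Sum>a<L. (if a \<le> 2 * d then (1 / w) ^ a else 0) * ?\<omega> s ^ a)"
      by (rule sum.mono_neutral_left) (auto simp: L_def)
    finally show "B s = norm \<dots>" by (simp add: B_def)
  qed
  also have "\<dots> = L * (\<Sum>a<L. (norm (if a \<le> 2 * d then (1 / w) ^ a else 0))\<^sup>2)"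
    by (rule root_of_unity_parseval)
  also have "(\<Sum>a<L. (norm (if a \<le> 2 * d then (1 / w) ^ a else 0))\<^sup>2) = (\<Sum>a\<le>2 * d. (norm (1 / w) ^ a)\<^sup>2)"
    by (rule sum.mono_neutral_cong_right) (auto simp: L_def norm_power norm_divide)
  also have "L * \<dots> \<le> L * (\<Sum>a\<le>2 * d. exp (2 * real (2 * d) * r))"
    using w by (intro mult_left_mono sum_mono pw) auto
  finally have B: "(\<Sum>s<L. (B s)\<^sup>2) \<le> L * real (2 * d + 1) * exp (4 * d * r)"
    by (simp add: mult_ac)
  have "(\<Sum>s<L. A s * B s)\<^sup>2 \<le> (\<Sum>s<L. (A s)\<^sup>2) * (\<Sum>s<L. (B s)\<^sup>2)"
    by (rule Cauchy_Schwarz_ineq_sum)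
  also have "\<dots> \<le> ((real L)\<^sup>2 * exp (8 * d * r)) * (L * real (2 * d + 1) * exp (4 * d * r))"
    by (intro mult_mono A B sum_nonneg) auto
  also have "\<dots> = ((real L)\<^sup>2 * real (2 * d + 1)) * real L * (exp (6 * real d * r))\<^sup>2"
    by (simp add: power2_eq_square exp_add[symmetric] mult_ac)
  \<comment> \<open>\<open>L\<close> = 4 d + 1 is at most twice 2 d + 1, so the square root of the
    product is of order \<open>L\<close> (2 d + 1), and the normalization of the kernel removes the
    second factor.\<close>
  also have "\<dots> \<le> ((real L)\<^sup>2 * real (2 * d + 1)) * (2 * real (2 * d + 1)) * (exp (6 * real d * r))\<^sup>2"
    by (intro mult_mono) (auto simp: L_def)
  also have "\<dots> \<le> (2 * real L * real (2 * d + 1) * exp (6 * real d * r))\<^sup>2"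
  proof -
    have "(2 * x * y * e)\<^sup>2 = (x\<^sup>2 * y) * (2 * y) * e\<^sup>2 + 2 * (x * y * e)\<^sup>2" for x y e :: real
      by (simp add: power2_eq_square algebra_simps)
    moreover have "0 \<le> 2 * (x * y * e)\<^sup>2" for x y e :: real by simp
    ultimately show ?thesis by (metis le_add_same_cancel1)
  qed
  finally have AB: "(\<Sum>s<L. A s * B s) \<le> 2 * real L * real (2 * d + 1) * exp (6 * real d * r)"
    by (rule power2_le_imp_le) simp
  have "(\<Sum>s<L. norm (interp_kernel d s w)) = (\<Sum>s<L. A s * B s) / real (2 * d + 1)"
    unfolding interp_kernel_def L_def[symmetric] A_def B_def norm_mult norm_divide sum_divide_distrib
    by (intro sum.cong refl) (simp add: norm_divide flip: of_nat_Suc)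
  also have "\<dots> \<le> 2 * real L * exp (6 * real d * r)"
    using AB by (subst pos_divide_le_eq) (simp_all add: algebra_simps)
  finally show ?thesis by (simp add: L_def)
qed

section \<open>Extracting one power of the sine by Cauchy's formula\<close>

lemma norm_sin_ge:
  fixes z :: complex
  assumes "norm z \<le> 1 / 2"
  shows "norm z / 2 \<le> norm (sin z)"
proof -
  have "\<bar>Im z\<bar> \<le> 1 / 2" using abs_Im_le_cmod[of z] assms by linarith
  then have e: "exp \<bar>Im z\<bar> \<le> 2"
    using exp_bound_half[of "\<bar>Im z\<bar>"] by simp
  have "norm (sin z - (\<Sum>k\<le>2. complex_of_real (sin_coeff k) * z ^ k)) \<le> exp \<bar>Im z\<bar> * (norm z) ^ (Suc 2) / fact 2"
    by (rule Taylor_sin)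
  moreover have "(\<Sum>k\<le>2. complex_of_real (sin_coeff k) * z ^ k) = z"
    by (simp add: numeral_2_eq_2 sin_coeff_def)
  ultimately have "norm (sin z - z) \<le> exp \<bar>Im z\<bar> * (norm z) ^ 3 / 2"
    by simp
  also have "\<dots> \<le> 2 * (norm z) ^ 3 / 2"
    using e by (intro divide_right_mono mult_right_mono) auto
  also have "\<dots> = (norm z)\<^sup>2 * norm z" by (simp add: power2_eq_square power3_eq_cube)
  also have "\<dots> \<le> (1 / 2)\<^sup>2 * norm z"
    using assms by (intro mult_right_mono power_mono) auto
  finally have "norm (sin z - z) \<le> norm z / 4" by (simp add: power2_eq_square)
  moreover have "norm z - norm (sin z) \<le> norm (sin z - z)"
    by (metis norm_minus_commute norm_triangle_ineq2)
  ultimately show ?thesis using norm_ge_zero[of z] by linarith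
qed

text \<open>The exponential form suits m-th powers: at |z| = i/(2 m) the factor |cos z|^(-m) costs
  at most exp(i).\<close>

lemma norm_cos_ge:
  fixes z :: complex
  assumes "norm z \<le> 1 / 2"
  shows "exp (- 2 * norm z) \<le> norm (cos z)"
proof -
  define x where "x = norm z"
  have x: "0 \<le> x" "x \<le> 1 / 2" using assms by (auto simp: x_def)
  have "\<bar>Im z\<bar> \<le> 1 / 2" using abs_Im_le_cmod[of z] assms by linarith
  then have e: "exp \<bar>Im z\<bar> \<le> 2"
    using exp_bound_half[of "\<bar>Im z\<bar>"] by simp
  have "norm (cos z - 1) \<le> exp \<bar>Im z\<bar> * x\<^sup>2"
    using Taylor_cos[of z 1] by (simp add: cos_coeff_def x_def power2_eq_square)
  also have "\<dots> \<le> 2 * x\<^sup>2"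
    using e by (intro mult_right_mono) auto
  also have "\<dots> \<le> x"
    using mult_left_mono[OF x(2) x(1)] by (simp add: power2_eq_square)
  finally have "1 - x \<le> norm (cos z)"
    using norm_triangle_ineq2[of 1 "cos z"] by (simp add: norm_minus_commute)
  moreover have "exp (- 2 * x) \<le> 1 - x"
  proof -
    have "1 \<le> (1 - x) * (1 + 2 * x)"
      using mult_left_mono[OF x(2) x(1)] by (simp add: algebra_simps)
    also have "\<dots> \<le> (1 - x) * exp (2 * x)"
      using x exp_ge_add_one_self[of "2 * x"] by (intro mult_left_mono) auto
    finally show ?thesis by (simp add: exp_minus field_simps)
  qed
  ultimately show ?thesis by (simp add: x_def)
qed

lemma sin_neq_0_small: "sin z \<noteq> 0" and cos_neq_0_small: "cos z \<noteq> 0"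
  if "z \<noteq> 0" "norm z \<le> 1 / 2" for z :: complex
proof -
  show "sin z \<noteq> 0" using norm_sin_ge[OF that(2)] that(1) by auto
  have "0 < exp (- 2 * norm z)" by simp
  then show "cos z \<noteq> 0" using norm_cos_ge[OF that(2)] by (auto simp del: exp_gt_zero)
qed

text \<open>For j different from i the integrand has the primitive sin^(j-i)/(j-i) on the circle,
  which avoids the zeros of the sine; for j = i it is cot, with residue 1 at the origin. This is
  Cauchy's coefficient formula in the variable sin z.\<close>

lemma sin_power_contour_integral:
  assumes \<rho>: "0 < \<rho>" "\<rho> \<le> 1 / 2"
  shows "((\<lambda>z. sin z ^ j * cos z / sin z ^ Suc i) has_contour_integral (if j = i then 2 * pi * \<i> else 0)) (circlepath 0 \<rho>)"
proof -
  have nz: "sin z \<noteq> 0" if "z \<in> path_image (circlepath 0 \<rho>)" for z :: complex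
    using that \<rho> by (intro sin_neq_0_small) auto
  show ?thesis
  proof (cases "j = i")
    case False
    define n where "n = int j - int i"
    have "n \<noteq> 0" using False by (simp add: n_def)
    have "((\<lambda>z. sin z powi (n - 1) * cos z) has_contour_integral 0) (circlepath 0 \<rho>)"
    proof (rule Cauchy_theorem_primitive[where S = "path_image (circlepath 0 \<rho>)"])
      fix z :: complex assume "z \<in> path_image (circlepath 0 \<rho>)"
      from nz[OF this] show "((\<lambda>z. sin z powi n / of_int n) has_field_derivative sin z powi (n - 1) * cos z) (at z within path_image (circlepath 0 \<rho>))"
        using \<open>n \<noteq> 0\<close> by (auto intro!: derivative_eq_intros)
    qed auto
    moreover have "sin z powi (n - 1) * cos z = sin z ^ j * cos z / sin z ^ Suc i"
      if "z \<in> path_image (circlepath 0 \<rho>)" for z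
    proof -
      have "n - 1 = int j - int (Suc i)" by (simp add: n_def)
      then have "sin z powi (n - 1) = sin z ^ j / sin z ^ Suc i"
        using power_int_diff[of "sin z" "int j" "int (Suc i)"] nz[OF that]
        by (simp only: power_int_of_nat) simp
      then show ?thesis by simp
    qed
    ultimately show ?thesis
      using False by (simp only: if_False) (rule has_contour_integral_eq)
  next
    case True
    have "((\<lambda>z. cos z / sin z) has_contour_integral 2 * pi * \<i> * residue (\<lambda>z. cos z / sin z) 0) (circlepath 0 \<rho>)"
    proof (rule base_residue[of "ball 0 1"])
      show "(\<lambda>z. cos z / sin z) holomorphic_on ball 0 1 - {0 :: complex}"
      proof (intro holomorphic_intros)
        fix z :: complex assume z: "z \<in> ball 0 1 - {0}"
        show "sin z \<noteq> 0"
        proof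
          assume "sin z = 0"
          then obtain n :: int where n: "z = of_real (of_int n * pi)"
            by (auto simp: sin_eq_0)
          with z have "n \<noteq> 0" by auto
          then have "1 \<le> \<bar>real_of_int n\<bar>" by linarith
          then have "1 * 1 \<le> \<bar>real_of_int n\<bar> * pi"
            using pi_gt3 by (intro mult_mono) auto
          then show False using z n by (simp add: norm_mult)
        qed
      qed
    qed (use \<rho> in auto)
    also have "residue (\<lambda>z. cos z / sin z) 0 = cos 0 / (1 :: complex)"
      by (rule residue_simple_pole_deriv[where s = UNIV]) (auto intro!: derivative_eq_intros holomorphic_intros)
    finally show ?thesis
      using True nz by (auto elim!: has_contour_integral_eq)
  qed
qed


text \<open>The frequencies of sin^j cos^m lie between -(j+m) and j+m. The shift by 2 m clears the
  negative ones, since j is at most m, and leaves degree at most 4 m.\<close>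

lemma trig_monomial_exp_poly:
  assumes "j \<le> m"
  obtains c where "\<And>z :: complex. sin z ^ j * cos z ^ m * exp (\<i> * z) ^ (2 * m) = (\<Sum>l\<le>4 * m. c l * exp (\<i> * z) ^ l)"
proof -
  define Q :: "complex poly" where
    "Q = smult ((1 / (2 * \<i>)) ^ j * (1 / 2) ^ m) (monom 1 (m - j) * ([:-1, 0, 1:] ^ j * [:1, 0, 1:] ^ m))"
  have "degree ([:-1, 0, 1 :: complex:] ^ j) \<le> 2 * j" "degree ([:1, 0, 1 :: complex:] ^ m) \<le> 2 * m"
    using degree_power_le[of "[:-1, 0, 1 :: complex:]" j] degree_power_le[of "[:1, 0, 1 :: complex:]" m] by simp_all
  then have deg: "degree Q \<le> 4 * m"
    unfolding Q_def using assms
    by (intro order.trans[OF degree_smult_le] order.trans[OF degree_mult_le] order.trans[OF add_mono[OF degree_monom_le order.trans[OF degree_mult_le]]]) auto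
  have Q: "sin z ^ j * cos z ^ m * exp (\<i> * z) ^ (2 * m) = poly Q (exp (\<i> * z))" for z :: complex
  proof -
    define w where "w = exp (\<i> * z)"
    have w: "w \<noteq> 0" "exp (- (\<i> * z)) = 1 / w" by (auto simp: w_def exp_minus field_simps)
    have s: "sin z * w = 1 / (2 * \<i>) * (w\<^sup>2 - 1)"
      unfolding sin_exp_eq w_def[symmetric] w(2) using w(1) by (simp add: field_simps power2_eq_square)
    have c: "cos z * w = 1 / 2 * (w\<^sup>2 + 1)"
      unfolding cos_exp_eq w_def[symmetric] w(2) using w(1) by (simp add: field_simps power2_eq_square)
    have "sin z ^ j * cos z ^ m * w ^ (2 * m) = (sin z * w) ^ j * (cos z * w) ^ m * w ^ (m - j)"
    proof -
      have "w ^ (2 * m) = w ^ j * w ^ m * w ^ (m - j)"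
        using assms by (simp flip: power_add add: mult_2)
      then show ?thesis by (simp add: power_mult_distrib)
    qed
    also have "\<dots> = poly Q w"
    proof -
      have "poly [:-1, 0, 1:] w = w\<^sup>2 - 1" "poly [:1, 0, 1:] w = w\<^sup>2 + 1"
        by (simp_all add: power2_eq_square)
      then show ?thesis
        unfolding s c
        by (simp only: Q_def poly_smult poly_mult poly_power poly_monom power_mult_distrib mult_1 mult_ac)
    qed
    finally show ?thesis by (simp add: w_def)
  qed
  show ?thesis
  proof (rule that[of "coeff Q"])
    fix z :: complex
    have "poly Q (exp (\<i> * z)) = (\<Sum>l\<le>4 * m. coeff Q l * exp (\<i> * z) ^ l)"
      unfolding poly_altdef using deg
      by (intro sum.mono_neutral_left) (auto simp: coeff_eq_0 not_le)
    with Q show "sin z ^ j * cos z ^ m * exp (\<i> * z) ^ (2 * m) = \<dots>" by simp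
  qed
qed

text \<open>Integrating sin^j cos^m against cos z / (cos^m z sin^(i+1) z) extracts the coefficient
  for j = i. On the circle, sin^j cos^m is replaced by its interpolation from the real nodes
  \<theta>_s, so the contour integral becomes a finite sum over these nodes; the weights do not
  depend on j.\<close>

lemma trig_coefficient_functional:
  assumes i: "1 \<le> i" "i \<le> m"
  shows "\<exists>(W :: nat \<Rightarrow> complex) (\<theta> :: nat \<Rightarrow> real) L.
    (\<forall>j\<le>m. (\<Sum>s<L. W s * complex_of_real (sin (\<theta> s) ^ j * cos (\<theta> s) ^ m)) = (if j = i then 1 else 0)) \<and>
    (\<Sum>s<L. norm (W s)) \<le> 4 * exp (8 * real i) * (4 * real m / real i) ^ i"
proof -
  \<comment> \<open>The kernel of index \<open>M\<close> is exact up to degree 2 M = 4 m, the degree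
    obtained after multiplication by exp(i M z).\<close>
  define M where "M = 2 * m"
  define L where "L = 4 * M + 1"
  define \<theta> where "\<theta> s = 2 * pi * real s / L" for s
  \<comment> \<open>Minimizes \<rho>^(-i) exp(c m \<rho>) up to factors C^i, and stays at most 1/2
    because i is at most m.\<close>
  define \<rho> where "\<rho> = real i / (2 * m)"
  have \<rho>: "0 < \<rho>" "\<rho> \<le> 1 / 2" using i by (auto simp: \<rho>_def field_simps)
  let ?\<gamma> = "circlepath 0 \<rho>"
  define K :: "complex \<Rightarrow> complex" where "K z = cos z / (cos z ^ m * sin z ^ Suc i)" for z
  define f where "f s z = interp_kernel M s (exp (\<i> * z)) / exp (\<i> * z) ^ M * K z" for s z
  define W where "W s = contour_integral ?\<gamma> (f s) * root_of_unity L s ^ M / (2 * pi * \<i> * L)" for s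
  have nz: "sin z \<noteq> 0" "cos z \<noteq> 0" if "z \<in> path_image ?\<gamma>" for z :: complex
  proof -
    have "z \<noteq> 0" "norm z \<le> 1 / 2" using that \<rho> by auto
    then show "sin z \<noteq> 0" "cos z \<noteq> 0" by (rule sin_neq_0_small cos_neq_0_small)+
  qed
  have f_int: "f s contour_integrable_on ?\<gamma>" for s
  proof -
    have "complex_of_nat (2 * M + 1) \<noteq> 0"
      unfolding of_nat_eq_0_iff by simp
    then show ?thesis
    unfolding f_def K_def interp_kernel_def
    by (intro contour_integrable_continuous_circlepath continuous_intros) (simp_all add: nz del: of_nat_add of_nat_mult)
  qed
  have lin_int: "((\<lambda>z. \<Sum>s<L. u s * f s z) has_contour_integral (\<Sum>s<L. u s * contour_integral ?\<gamma> (f s))) ?\<gamma>" for u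
    by (intro has_contour_integral_sum has_contour_integral_lmul has_contour_integral_integral f_int) auto
  have 1: "(\<Sum>s<L. W s * complex_of_real (sin (\<theta> s) ^ j * cos (\<theta> s) ^ m)) = (if j = i then 1 else 0)" if j: "j \<le> m" for j
  proof -
    obtain c where c: "\<And>z :: complex. sin z ^ j * cos z ^ m * exp (\<i> * z) ^ (2 * m) = (\<Sum>l\<le>4 * m. c l * exp (\<i> * z) ^ l)"
      using trig_monomial_exp_poly[OF j] by blast
    have c\<theta>: "root_of_unity L s ^ M * complex_of_real (sin (\<theta> s) ^ j * cos (\<theta> s) ^ m) = (\<Sum>l\<le>4 * m. c l * root_of_unity L s ^ l)" for s
    proof -
      have "root_of_unity L s = exp (\<i> * complex_of_real (\<theta> s))"
        by (simp add: root_of_unity_def \<theta>_def cis_conv_exp)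
      then show ?thesis
        using c[of "complex_of_real (\<theta> s)"] by (simp add: M_def sin_of_real cos_of_real mult_ac)
    qed
    define u where "u s = (\<Sum>l\<le>4 * m. c l * root_of_unity L s ^ l)" for s
    have "(\<Sum>s<L. u s * f s z) = L * (sin z ^ j * cos z / sin z ^ Suc i)" if z: "z \<in> path_image ?\<gamma>" for z :: complex
    proof -
      have "(\<Sum>s<L. u s * f s z) = (\<Sum>l\<le>4 * m. c l * (\<Sum>s<L. interp_kernel M s (exp (\<i> * z)) * root_of_unity L s ^ l))
          / exp (\<i> * z) ^ M * K z"
        unfolding u_def f_def sum_distrib_left sum_distrib_right sum_divide_distrib
        by (subst sum.swap) (simp add: mult_ac)
      also have "(\<Sum>l\<le>4 * m. c l * (\<Sum>s<L. interp_kernel M s (exp (\<i> * z)) * root_of_unity L s ^ l)) =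
         (\<Sum>l\<le>4 * m. c l * (of_nat L * exp (\<i> * z) ^ l))"
        unfolding L_def
        by (intro sum.cong refl arg_cong[where f = "(*) _"] interp_kernel_reproducing) (auto simp: M_def)
      also have "\<dots> = of_nat L * (sin z ^ j * cos z ^ m * exp (\<i> * z) ^ M)"
        unfolding M_def c by (simp add: sum_distrib_left mult_ac)
      also have "\<dots> / exp (\<i> * z) ^ M * K z = L * (sin z ^ j * cos z / sin z ^ Suc i)"
        using nz[OF z] by (simp add: K_def)
      finally show ?thesis .
    qed
    then have "((\<lambda>z. L * (sin z ^ j * cos z / sin z ^ Suc i)) has_contour_integral (\<Sum>s<L. u s * contour_integral ?\<gamma> (f s))) ?\<gamma>"
      by (rule has_contour_integral_eq[OF lin_int])
    moreover have "((\<lambda>z. L * (sin z ^ j * cos z / sin z ^ Suc i)) has_contour_integral L * (if j = i then 2 * pi * \<i> else 0)) ?\<gamma>"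
      by (intro has_contour_integral_lmul sin_power_contour_integral \<rho>)
    ultimately have "(\<Sum>s<L. u s * contour_integral ?\<gamma> (f s)) = L * (if j = i then 2 * pi * \<i> else 0)"
      by (rule has_contour_integral_unique)
    moreover have "(\<Sum>s<L. W s * complex_of_real (sin (\<theta> s) ^ j * cos (\<theta> s) ^ m)) =
      (\<Sum>s<L. u s * contour_integral ?\<gamma> (f s)) / (2 * pi * \<i> * L)"
      unfolding W_def u_def c\<theta>[symmetric] sum_divide_distrib by (intro sum.cong refl) (simp add: mult_ac)
    moreover have "L > 0" by (simp add: L_def)
    ultimately show ?thesis by simp
  qed
  have 2: "(\<Sum>s<L. norm (W s)) \<le> 4 * exp (8 * real i) * (4 * real m / real i) ^ i"
  proof -
    \<comment> \<open>The phases make \<open>u s\<close> times the s-th contour integral equal to 2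
      \<pi> L |W_s|. The sum of the |W_s| is then one contour integral, whose integrand is bounded
      pointwise by the total mass of the kernel; bounding each integral separately would lose a
      factor of order \<open>L\<close>.\<close>
    define u where "u s = root_of_unity L s ^ M * cnj (sgn (W s)) / \<i>" for s
    have u: "norm (u s) \<le> 1" for s
      by (simp add: u_def norm_mult norm_divide norm_power norm_sgn)
    define B where "B = 2 * real L * exp (7 * real M * \<rho>) * (exp (2 * \<rho> * real m) * (2 / \<rho>) ^ Suc i)"
    have "norm (\<Sum>s<L. u s * f s z) \<le> B" if z: "norm z = \<rho>" for z
    proof -
      have e: "norm (exp (\<i> * z)) \<le> exp \<rho>" "norm (1 / exp (\<i> * z)) \<le> exp \<rho>"
        using abs_Im_le_cmod[of z] z by (auto simp: norm_exp exp_minus[symmetric] norm_divide divide_inverse norm_inverse)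
      have K: "norm (K z) \<le> exp (2 * \<rho> * real m) * (2 / \<rho>) ^ Suc i"
      proof -
        have zp: "z \<in> path_image ?\<gamma>" using z \<rho> by simp
        have "K z = 1 / (cos z ^ (m - 1) * sin z ^ Suc i)"
          using nz[OF zp] i by (cases m) (auto simp: K_def)
        then have "norm (K z) = (1 / norm (cos z)) ^ (m - 1) * (1 / norm (sin z)) ^ Suc i"
          by (simp add: norm_divide norm_mult norm_power power_divide)
        also have "\<dots> \<le> exp (2 * \<rho>) ^ (m - 1) * (2 / \<rho>) ^ Suc i"
        proof (intro mult_mono power_mono)
          have "exp (- 2 * \<rho>) \<le> norm (cos z)" using norm_cos_ge[of z] z \<rho> by simp
          then have "1 / norm (cos z) \<le> 1 / exp (- 2 * \<rho>)" by (intro divide_left_mono) (auto simp: nz[OF zp])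
          then show "1 / norm (cos z) \<le> exp (2 * \<rho>)" by (simp add: exp_minus field_simps)
          have "\<rho> / 2 \<le> norm (sin z)" using norm_sin_ge[of z] z \<rho> by simp
          then have "1 / norm (sin z) \<le> 1 / (\<rho> / 2)" using \<rho> by (intro divide_left_mono) (auto simp: nz[OF zp])
          then show "1 / norm (sin z) \<le> 2 / \<rho>" by simp
        qed (use \<rho> in auto)
        also have "\<dots> \<le> exp (2 * \<rho>) ^ m * (2 / \<rho>) ^ Suc i"
          using \<rho> by (intro mult_right_mono power_increasing) auto
        also have "exp (2 * \<rho>) ^ m = exp (2 * \<rho> * real m)" by (simp add: exp_of_nat_mult[symmetric] mult_ac)
        finally show ?thesis .
      qed
      have E: "norm (1 / exp (\<i> * z) ^ M) \<le> exp (real M * \<rho>)"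
      proof -
        have "norm (1 / exp (\<i> * z) ^ M) = norm (1 / exp (\<i> * z)) ^ M" by (simp add: norm_divide norm_power power_divide)
        also have "\<dots> \<le> exp \<rho> ^ M" using e by (intro power_mono) auto
        finally show ?thesis by (simp add: exp_of_nat_mult)
      qed
      have I: "(\<Sum>s<L. norm (interp_kernel M s (exp (\<i> * z)))) \<le> 2 * real L * exp (6 * real M * \<rho>)"
        unfolding L_def using \<rho> by (intro sum_norm_interp_kernel_le e) simp
      have "norm (\<Sum>s<L. u s * f s z) \<le> (\<Sum>s<L. norm (interp_kernel M s (exp (\<i> * z))) * (norm (1 / exp (\<i> * z) ^ M) * norm (K z)))"
      proof (rule order.trans[OF norm_sum], rule sum_mono)
        fix s
        have "norm (u s * f s z) = norm (u s) * norm (f s z)" by (rule norm_mult)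
        also have "\<dots> \<le> 1 * norm (f s z)" using u by (intro mult_right_mono) auto
        also have "norm (f s z) = norm (interp_kernel M s (exp (\<i> * z))) * (norm (1 / exp (\<i> * z) ^ M) * norm (K z))"
          by (simp add: f_def norm_mult norm_divide)
        finally show "norm (u s * f s z) \<le> norm (interp_kernel M s (exp (\<i> * z))) * (norm (1 / exp (\<i> * z) ^ M) * norm (K z))"
          by simp
      qed
      also have "\<dots> = (\<Sum>s<L. norm (interp_kernel M s (exp (\<i> * z)))) * (norm (1 / exp (\<i> * z) ^ M) * norm (K z))"
        by (simp add: sum_distrib_right)
      also have "\<dots> \<le> (2 * real L * exp (6 * real M * \<rho>)) * (exp (real M * \<rho>) * (exp (2 * \<rho> * real m) * (2 / \<rho>) ^ Suc i))"
        using \<rho> by (intro mult_mono I K E) auto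
      also have "\<dots> = B"
        by (simp add: B_def exp_add[symmetric] algebra_simps)
      finally show ?thesis .
    qed
    then have "norm (\<Sum>s<L. u s * contour_integral ?\<gamma> (f s)) \<le> B * (2 * pi * \<rho>)"
      using \<rho> by (intro has_contour_integral_bound_circlepath[OF lin_int]) (auto simp: B_def)
    moreover have "(\<Sum>s<L. u s * contour_integral ?\<gamma> (f s)) = 2 * pi * L * complex_of_real (\<Sum>s<L. norm (W s))"
    proof -
      have "u s * contour_integral ?\<gamma> (f s) = 2 * pi * L * complex_of_real (norm (W s))" for s
      proof -
        have "W s * cnj (sgn (W s)) = complex_of_real (norm (W s))"
          by (cases "W s = 0") (simp_all add: sgn_eq complex_norm_square[symmetric] power2_eq_square)
        moreover have "u s * contour_integral ?\<gamma> (f s) = 2 * pi * L * (W s * cnj (sgn (W s)))"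
        proof -
          have "L > 0" by (simp add: L_def)
          then have "root_of_unity L s ^ M * S / \<i> * X = 2 * pi * L * (X * root_of_unity L s ^ M / (2 * pi * \<i> * L) * S)" for X S
            by (simp add: field_simps)
          then show ?thesis unfolding u_def by (simp only: W_def[symmetric])
        qed
        ultimately show ?thesis by simp
      qed
      then show ?thesis by (simp add: sum_distrib_left)
    qed
    ultimately have "2 * pi * L * (\<Sum>s<L. norm (W s)) \<le> B * (2 * pi * \<rho>)"
      by (simp add: norm_mult sum_nonneg del: of_real_sum)
    also have "B * (2 * pi * \<rho>) = 2 * pi * L * (2 * exp (7 * real M * \<rho>) * exp (2 * \<rho> * real m) * (2 / \<rho>) ^ Suc i * \<rho>)"
      by (simp only: B_def mult_ac)
    finally have "(\<Sum>s<L. norm (W s)) \<le> 2 * exp (7 * real M * \<rho>) * exp (2 * \<rho> * real m) * (2 / \<rho>) ^ Suc i * \<rho>"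
      by (subst (asm) mult_le_cancel_left_pos) (auto simp: L_def)
    \<comment> \<open>7 M \<rho> = 14 m \<rho> comes from the kernel and the shift, 2 m \<rho> from
      the cosines. One factor 2/\<rho> is spent on the length of the circle.\<close>
    also have "\<dots> = 4 * exp (16 * real m * \<rho>) * (2 / \<rho>) ^ i"
      using \<rho> by (simp add: M_def exp_add[symmetric] algebra_simps)
    also have "16 * real m * \<rho> = 8 * real i" using i by (simp add: \<rho>_def)
    also have "2 / \<rho> = 4 * real m / real i" using i by (simp add: \<rho>_def)
    finally show ?thesis .
  qed
  show ?thesis
    by (rule exI[of _ W], rule exI[of _ \<theta>], rule exI[of _ L]) (intro conjI allI impI 1 2)
qed


text \<open>A combination of exponentials of frequency sqrt m sin(\<theta>_s): after cancellation of
  the Gaussian factors its j-th Hermite moment is the extracting sum of sin^j cos^m, up to a factor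
  depending only on j, and that factor is normalized at j = i.\<close>

lemma dual_function_exists:
  assumes i: "1 \<le> i" "i \<le> m"
  shows "\<exists>b :: real \<Rightarrow> real. b \<in> borel_measurable borel \<and> (\<forall>x. \<bar>b x\<bar> \<le> (16 * exp 8) ^ i * sqrt m ^ i) \<and>
    (\<forall>j\<le>m. (\<integral>x. poly (hp j) x * b x \<partial>gauss) = (if i = j then 1 else 0))"
proof -
  obtain W :: "nat \<Rightarrow> complex" and \<theta> :: "nat \<Rightarrow> real" and L where
    W: "\<forall>j\<le>m. (\<Sum>s<L. W s * complex_of_real (sin (\<theta> s) ^ j * cos (\<theta> s) ^ m)) = (if j = i then 1 else 0)"
    and W_le: "(\<Sum>s<L. norm (W s)) \<le> 4 * exp (8 * real i) * (4 * real m / real i) ^ i"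
    using trig_coefficient_functional[OF i] by (elim exE conjE) (rule that)
  define T where "T = sqrt m"
  have T: "T > 0" "T\<^sup>2 = m" using i by (auto simp: T_def)
  define w where "w s = cos (\<theta> s) ^ m * exp ((T * sin (\<theta> s))\<^sup>2 / 2)" for s
  define a where "a = sqrt (fact i) / (\<i> * T) ^ i"
  define B where "B x = (\<Sum>s<L. W s * w s * a * iexp (T * sin (\<theta> s) * x))" for x
  \<comment> \<open>The Hermite polynomials and the required moments are real, so passing to the
    real part keeps the moments and does not increase the bound.\<close>
  define b where "b x = Re (B x)" for x
  have w_le: "\<bar>w s\<bar> \<le> 1" for s
  proof -
    define x where "x = cos (\<theta> s) * exp ((sin (\<theta> s))\<^sup>2 / 2)"
    have "(T * sin (\<theta> s))\<^sup>2 / 2 = m * ((sin (\<theta> s))\<^sup>2 / 2)"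
      by (simp add: power_mult_distrib T(2))
    then have "exp ((T * sin (\<theta> s))\<^sup>2 / 2) = exp ((sin (\<theta> s))\<^sup>2 / 2) ^ m"
      by (simp only: exp_of_nat_mult)
    then have w: "w s = x ^ m"
      by (simp only: w_def x_def power_mult_distrib)
    have "x\<^sup>2 = (cos (\<theta> s))\<^sup>2 * (exp ((sin (\<theta> s))\<^sup>2 / 2))\<^sup>2"
      by (simp add: x_def power_mult_distrib)
    also have "(exp ((sin (\<theta> s))\<^sup>2 / 2))\<^sup>2 = exp ((sin (\<theta> s))\<^sup>2)"
      by (simp flip: exp_double)
    \<comment> \<open>From 1 - x \<le> exp(-x) at x = sin^2. Since T^2 = m, each of the m cosines
      pays for exactly one of the m factors exp(sin^2 / 2).\<close>
    also have "(cos (\<theta> s))\<^sup>2 * exp ((sin (\<theta> s))\<^sup>2) \<le> exp (- (sin (\<theta> s))\<^sup>2) * exp ((sin (\<theta> s))\<^sup>2)"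
      using exp_ge_add_one_self[of "- (sin (\<theta> s))\<^sup>2"] by (intro mult_right_mono) (auto simp: cos_squared_eq)
    also have "\<dots> = 1" by (simp flip: exp_add)
    finally have "\<bar>x\<bar> \<le> 1" by (simp add: abs_square_le_1)
    then show ?thesis unfolding w power_abs by (intro power_le_one) auto
  qed
  have norm_a: "norm a = sqrt (fact i) / T ^ i"
    using T(1) by (simp add: a_def norm_divide norm_power norm_mult)
  have "\<bar>b x\<bar> \<le> (16 * exp 8) ^ i * sqrt m ^ i" for x
  proof -
    have "\<bar>b x\<bar> \<le> norm (B x)" unfolding b_def by (rule abs_Re_le_cmod)
    also have "\<dots> \<le> (\<Sum>s<L. norm (W s) * (sqrt (fact i) / T ^ i))"
      unfolding B_def
    proof (rule order.trans[OF norm_sum], rule sum_mono)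
      fix s
      have "norm (W s * w s * a * iexp (T * sin (\<theta> s) * x)) = norm (W s) * \<bar>w s\<bar> * norm a"
        by (simp add: norm_mult)
      also have "\<dots> \<le> norm (W s) * 1 * norm a"
        by (intro mult_right_mono mult_left_mono w_le) auto
      finally show "norm (W s * w s * a * iexp (T * sin (\<theta> s) * x)) \<le> norm (W s) * (sqrt (fact i) / T ^ i)"
        by (simp add: norm_a)
    qed
    also have "\<dots> = (\<Sum>s<L. norm (W s)) * (sqrt (fact i) / T ^ i)"
      by (simp only: sum_distrib_right)
    \<comment> \<open>The crude bound sqrt(i!) \<le> i^i is enough: it cancels the i^i in the
      denominator of the bound on \<open>W\<close> and leaves (4 m / T)^i = (4 T)^i.\<close>
    also have "\<dots> \<le> (4 * exp (8 * real i) * (4 * real m / real i) ^ i) * (real i ^ i / T ^ i)"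
    proof (intro mult_mono W_le divide_right_mono)
      have "fact i \<le> real (i ^ i)" by (rule fact_le_power)
      also have "\<dots> \<le> (real i ^ i)\<^sup>2"
        using i self_le_power[of "real i ^ i" 2] by simp
      finally show "sqrt (fact i) \<le> real i ^ i" by (intro real_le_lsqrt) auto
    qed (use T in auto)
    also have "\<dots> = 4 * exp 8 ^ i * (4 * real m / T) ^ i"
    proof -
      have "exp (8 * real i) = exp 8 ^ i"
        using exp_of_nat_mult[of i "8 :: real"] by (simp add: mult.commute)
      moreover have "(4 * real m / real i) ^ i * (real i ^ i / T ^ i) = (4 * real m / real i * (real i / T)) ^ i"
        by (simp only: power_mult_distrib power_divide)
      moreover have "4 * real m / real i * (real i / T) = 4 * real m / T"
        using i by simp
      ultimately show ?thesis by (simp only: mult.assoc)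
    qed
    also have "4 * real m / T = 4 * T"
      using T by (simp add: field_simps power2_eq_square)
    also have "4 * exp 8 ^ i * (4 * T) ^ i \<le> 4 ^ i * exp 8 ^ i * (4 * T) ^ i"
      using i T self_le_power[of "4 :: real" i] by (intro mult_right_mono) auto
    also have "\<dots> = (16 * exp 8) ^ i * sqrt m ^ i"
    proof -
      have "4 * exp 8 * (4 * T) = 16 * exp 8 * sqrt m" by (simp add: T_def)
      then show ?thesis by (simp only: power_mult_distrib[symmetric])
    qed
    finally show ?thesis .
  qed
  moreover have "b \<in> borel_measurable borel"
    unfolding b_def B_def by measurable
  moreover have "(\<integral>x. poly (hp j) x * b x \<partial>gauss) = (if i = j then 1 else 0)" if j: "j \<le> m" for j
  proof -
    have int: "integrable gauss (\<lambda>x. (W s * w s * a) * (complex_of_real (poly (hp j) x) * iexp (T * sin (\<theta> s) * x)))" for s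
      by (intro integrable_mult_right gauss_char_integrable)
    have eq: "complex_of_real (poly (hp j) x) * B x =
        (\<Sum>s<L. (W s * w s * a) * (complex_of_real (poly (hp j) x) * iexp (T * sin (\<theta> s) * x)))" for x
      unfolding B_def sum_distrib_left by (simp only: mult_ac)
    have intB: "integrable gauss (\<lambda>x. complex_of_real (poly (hp j) x) * B x)"
      unfolding eq by (intro Bochner_Integration.integrable_sum int)
    have "(\<integral>x. complex_of_real (poly (hp j) x) * B x \<partial>gauss) =
        (\<Sum>s<L. (W s * w s * a) * gauss_char (hp j) (T * sin (\<theta> s)))"
      unfolding eq gauss_char_def
      by (subst Bochner_Integration.integral_sum[OF int]) (simp only: integral_mult_right_zero)
    also have "\<dots> = (\<Sum>s<L. W s * complex_of_real (sin (\<theta> s) ^ j * cos (\<theta> s) ^ m)) * (a * (\<i> * T) ^ j / sqrt (fact j))"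
      unfolding sum_distrib_right
    proof (rule sum.cong[OF refl])
      fix s
      have "w s * exp (- ((T * sin (\<theta> s))\<^sup>2 / 2)) = cos (\<theta> s) ^ m"
        by (simp add: w_def exp_minus)
      then have E: "complex_of_real (w s) * complex_of_real (exp (- ((T * sin (\<theta> s))\<^sup>2 / 2))) = complex_of_real (cos (\<theta> s) ^ m)"
        by (simp only: of_real_mult[symmetric])
      have "W s * w s * a * gauss_char (hp j) (T * sin (\<theta> s)) =
        W s * a * (\<i> * complex_of_real (T * sin (\<theta> s))) ^ j / sqrt (fact j) *
         (complex_of_real (w s) * complex_of_real (exp (- ((T * sin (\<theta> s))\<^sup>2 / 2))))"
        unfolding gauss_char_hp by (simp only: mult_ac times_divide_eq_left times_divide_eq_right)
      also have "\<dots> = W s * complex_of_real (sin (\<theta> s) ^ j * cos (\<theta> s) ^ m) * (a * (\<i> * T) ^ j / sqrt (fact j))"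
        unfolding E by (simp add: power_mult_distrib mult_ac)
      finally show "W s * w s * a * gauss_char (hp j) (T * sin (\<theta> s)) = \<dots>" .
    qed
    also have "\<dots> = (if i = j then 1 else 0)"
      unfolding W[rule_format, OF j] using T by (auto simp: a_def)
    finally have "(\<integral>x. complex_of_real (poly (hp j) x) * B x \<partial>gauss) = (if i = j then 1 else 0)" .
    then have "Re (\<integral>x. complex_of_real (poly (hp j) x) * B x \<partial>gauss) = (if i = j then 1 else 0)"
      by simp
    then show ?thesis
      using integral_Re[OF intB] by (simp add: b_def)
  qed
  ultimately show ?thesis by (intro exI[of _ b] conjI allI impI)
qed

lemma dual_constant_exists: "\<exists>C. dual_constant C"
proof -
  \<comment> \<open>The square turns the bound (16 e^8)^i (sqrt m)^i on |g_i|/\<phi> into (C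
    m)^(i/2).\<close>
  define C :: real where "C = (16 * exp 8)\<^sup>2"
  have C: "C > 0" by (simp add: C_def)
  have "\<exists>g. dual_family C m g" for m
  proof -
    have "\<forall>i\<in>{1..m}. \<exists>b :: real \<Rightarrow> real. b \<in> borel_measurable borel \<and> (\<forall>x. \<bar>b x\<bar> \<le> (16 * exp 8) ^ i * sqrt m ^ i) \<and>
      (\<forall>j\<le>m. (\<integral>x. poly (hp j) x * b x \<partial>gauss) = (if i = j then 1 else 0))"
      by (intro ballI dual_function_exists) auto
    from bchoice[OF this] obtain b where b: "\<forall>i\<in>{1..m}. b i \<in> borel_measurable borel \<and>
      (\<forall>x. \<bar>b i x\<bar> \<le> (16 * exp 8) ^ i * sqrt m ^ i) \<and>
      (\<forall>j\<le>m. (\<integral>x. poly (hp j) x * b i x \<partial>gauss) = (if i = j then 1 else 0))"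
      by blast
    have b_meas: "b i \<in> borel_measurable borel" and b_le: "\<bar>b i x\<bar> \<le> (16 * exp 8) ^ i * sqrt m ^ i"
      and b_int: "j \<le> m \<Longrightarrow> (\<integral>x. poly (hp j) x * b i x \<partial>gauss) = (if i = j then 1 else 0)"
      if "i \<in> {1..m}" for i j x
      using b that by simp_all
    define g where "g i x = std_normal_density x * b i x" for i x
    have "dual_family C m g"
      unfolding dual_family_def
    proof (intro ballI conjI)
      fix i assume i: "i \<in> {1..m}"
      note [measurable] = b_meas[OF i]
      show "g i \<in> borel_measurable borel"
        unfolding g_def by measurable
      have ratio: "\<bar>g i x\<bar> / std_normal_density x = \<bar>b i x\<bar>" for x
        using normal_density_pos[of 1 0 x] by (simp add: g_def abs_mult)
      show "bdd_above (range (\<lambda>x. \<bar>g i x\<bar> / std_normal_density x))"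
        unfolding ratio using b_le[OF i] by (intro bdd_aboveI2)
      have "sup_ratio g i \<le> (16 * exp 8) ^ i * sqrt m ^ i"
        unfolding sup_ratio_def ratio using b_le[OF i] by (intro cSUP_least) auto
      also have "\<dots> = sqrt (C * m) ^ i"
        by (simp add: C_def real_sqrt_mult power_mult_distrib)
      also have "\<dots> = (C * m) powr (i / 2)"
      proof -
        have "sqrt (C * m) = (C * m) powr (1 / 2)" using C by (simp add: powr_half_sqrt)
        moreover have "C * m \<noteq> 0" using C i by simp
        from powr_power[OF this, of "1 / 2" i] have "((C * m) powr (1 / 2)) ^ i = (C * m) powr (i / 2)"
          by simp
        ultimately show ?thesis by simp
      qed
      finally show "sup_ratio g i \<le> (C * m) powr (i / 2)" .
      fix j assume j: "j \<in> {0..m}"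
      have int: "integrable gauss (\<lambda>x. poly (hp j) x * b i x)"
      proof (rule Bochner_Integration.integrable_bound)
        show "integrable gauss (\<lambda>x. ((16 * exp 8) ^ i * sqrt m ^ i) * poly (hp j) x)"
          by (intro integrable_mult_right) simp
        show "AE x in gauss. norm (poly (hp j) x * b i x) \<le> norm ((16 * exp 8) ^ i * sqrt m ^ i * poly (hp j) x)"
        proof (rule AE_I2)
          fix x
          have "\<bar>poly (hp j) x\<bar> * \<bar>b i x\<bar> \<le> \<bar>poly (hp j) x\<bar> * ((16 * exp 8) ^ i * sqrt m ^ i)"
            by (intro mult_left_mono b_le i) auto
          then show "norm (poly (hp j) x * b i x) \<le> norm ((16 * exp 8) ^ i * sqrt m ^ i * poly (hp j) x)"
            by (simp add: abs_mult power_abs mult_ac)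
        qed
      qed measurable
      have eq: "(\<lambda>x. hermite j x * g i x) = (\<lambda>x. std_normal_density x * (poly (hp j) x * b i x))"
        by (auto simp: g_def hermite_eq_poly)
      show "integrable lborel (\<lambda>x. hermite j x * g i x)"
        unfolding eq using int by (subst (asm) integrable_gauss_iff) measurable
      show "(\<integral>x. hermite j x * g i x \<partial>lborel) = (if i = j then 1 else 0)"
      proof -
        have "(\<integral>x. std_normal_density x * (poly (hp j) x * b i x) \<partial>lborel) = (\<integral>x. poly (hp j) x * b i x \<partial>gauss)"
          by (rule integral_gauss[symmetric]) measurable
        then show ?thesis unfolding eq using b_int[OF i, of j] j by simp
      qed
    qed
    then show ?thesis by blast
  qed
  with C show ?thesis unfolding dual_constant_def by blast
qed

subsection \<open>Gaussian vectors along a direction\<close>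

lemma nn_integral_gauss:
  fixes f :: "real \<Rightarrow> ennreal"
  assumes [measurable]: "f \<in> borel_measurable borel"
  shows "(\<integral>\<^sup>+x. f x \<partial>gauss) = (\<integral>\<^sup>+x. std_normal_density x * f x \<partial>lborel)"
  by (subst nn_integral_density) auto

lemma nn_integral_gauss_uminus:
  fixes f :: "real \<Rightarrow> ennreal"
  assumes [measurable]: "f \<in> borel_measurable borel"
  shows "(\<integral>\<^sup>+x. f (- x) \<partial>gauss) = (\<integral>\<^sup>+x. f x \<partial>gauss)"
proof -
  have "(\<integral>\<^sup>+x. std_normal_density x * f x \<partial>lborel) =
     (\<integral>\<^sup>+x. std_normal_density (- x) * f (- x) \<partial>lborel)"
    using nn_integral_real_affine[of "\<lambda>x. std_normal_density x * f x" "-1" 0] by simp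
  moreover have "std_normal_density (- x) = std_normal_density x" for x :: real
    by (simp add: std_normal_density_def)
  ultimately show ?thesis
    by (simp add: nn_integral_gauss)
qed

lemma std_normal_density_mult:
  "std_normal_density x * std_normal_density y = 1 / (2 * pi) * exp (- (x\<^sup>2 + y\<^sup>2) / 2)"
  by (simp add: std_normal_density_def exp_add[symmetric] add_divide_distrib diff_divide_distrib)

text \<open>For a nonzero, the rotation is split into two shears with scaling, s = a x - b y at
  fixed y and then z = (b s + y)/a at fixed s. Their Jacobians cancel, and the joint density depends
  only on the norm. For a = 0 the rotation swaps the coordinates up to one sign.\<close>

lemma nn_integral_gauss_rotation:
  fixes f :: "real \<times> real \<Rightarrow> ennreal"
  assumes ab: "a\<^sup>2 + b\<^sup>2 = (1::real)" and f [measurable]: "f \<in> borel_measurable (borel \<Otimes>\<^sub>M borel)"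
  shows "(\<integral>\<^sup>+x. \<integral>\<^sup>+y. f (a * x - b * y, b * x + a * y) \<partial>gauss \<partial>gauss) = (\<integral>\<^sup>+x. \<integral>\<^sup>+y. f (x, y) \<partial>gauss \<partial>gauss)"
proof -
  interpret G: prob_space gauss by (rule prob_space_gauss)
  interpret GG: pair_sigma_finite gauss gauss ..
  let ?\<phi> = "\<lambda>x y. ennreal (std_normal_density x * std_normal_density y)"
  have expand: "(\<integral>\<^sup>+x. \<integral>\<^sup>+y. g x y \<partial>gauss \<partial>gauss) = (\<integral>\<^sup>+x. \<integral>\<^sup>+y. ?\<phi> x y * g x y \<partial>lborel \<partial>lborel)"
    if [measurable]: "(\<lambda>(x, y). g x y) \<in> borel_measurable (borel \<Otimes>\<^sub>M borel)" for g :: "real \<Rightarrow> real \<Rightarrow> ennreal"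
  proof -
    have "(\<integral>\<^sup>+x. \<integral>\<^sup>+y. g x y \<partial>gauss \<partial>gauss) =
       (\<integral>\<^sup>+x. std_normal_density x * (\<integral>\<^sup>+y. std_normal_density y * g x y \<partial>lborel) \<partial>lborel)"
      by (subst nn_integral_gauss) (measurable, simp add: nn_integral_gauss)
    then show ?thesis
      by (simp add: nn_integral_cmult[symmetric] ennreal_mult' mult.assoc)
  qed
  show ?thesis
  proof (cases "a = 0")
    case True
    then consider "b = 1" | "b = -1" using ab by (auto simp: power2_eq_1_iff)
    then show ?thesis
    proof cases
      case 1
      have "(\<integral>\<^sup>+x. \<integral>\<^sup>+y. f (- y, x) \<partial>gauss \<partial>gauss) = (\<integral>\<^sup>+x. \<integral>\<^sup>+y. f (y, x) \<partial>gauss \<partial>gauss)"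
        by (intro nn_integral_cong nn_integral_gauss_uminus) auto
      also have "\<dots> = (\<integral>\<^sup>+y. \<integral>\<^sup>+x. f (y, x) \<partial>gauss \<partial>gauss)"
        by (rule GG.Fubini') auto
      finally show ?thesis using True 1 by simp
    next
      case 2
      have "(\<integral>\<^sup>+x. \<integral>\<^sup>+y. f (y, - x) \<partial>gauss \<partial>gauss) = (\<integral>\<^sup>+x. \<integral>\<^sup>+y. f (y, x) \<partial>gauss \<partial>gauss)"
        by (rule nn_integral_gauss_uminus[of "\<lambda>x. \<integral>\<^sup>+y. f (y, x) \<partial>gauss"]) measurable
      also have "\<dots> = (\<integral>\<^sup>+y. \<integral>\<^sup>+x. f (y, x) \<partial>gauss \<partial>gauss)"
        by (rule GG.Fubini') auto
      finally show ?thesis using True 2 by simp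
    qed
  next
    case a: False
    have "(\<integral>\<^sup>+x. \<integral>\<^sup>+y. f (a * x - b * y, b * x + a * y) \<partial>gauss \<partial>gauss) =
       (\<integral>\<^sup>+x. \<integral>\<^sup>+y. ?\<phi> x y * f (a * x - b * y, b * x + a * y) \<partial>lborel \<partial>lborel)"
      by (rule expand) measurable
    also have "\<dots> = (\<integral>\<^sup>+y. \<integral>\<^sup>+x. ?\<phi> x y * f (a * x - b * y, b * x + a * y) \<partial>lborel \<partial>lborel)"
      by (rule lborel_pair.Fubini'[symmetric]) measurable
    also have "\<dots> = (\<integral>\<^sup>+y. \<integral>\<^sup>+s. \<bar>1 / a\<bar> * (?\<phi> ((s + b * y) / a) y * f (s, (b * s + y) / a)) \<partial>lborel \<partial>lborel)"
    proof (rule nn_integral_cong)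
      fix y :: real
      have "(\<integral>\<^sup>+x. ?\<phi> x y * f (a * x - b * y, b * x + a * y) \<partial>lborel) =
         \<bar>1 / a\<bar> * (\<integral>\<^sup>+s. ?\<phi> (b * y / a + 1 / a * s) y *
           f (a * (b * y / a + 1 / a * s) - b * y, b * (b * y / a + 1 / a * s) + a * y) \<partial>lborel)"
        using a by (intro nn_integral_real_affine) auto
      also have "\<dots> = \<bar>1 / a\<bar> * (\<integral>\<^sup>+s. ?\<phi> ((s + b * y) / a) y * f (s, (b * s + y) / a) \<partial>lborel)"
      proof (intro arg_cong[where f = "(*) _"] nn_integral_cong)
        fix s
        have "b * (b * y / a + 1 / a * s) + a * y = (b * s + (a\<^sup>2 + b\<^sup>2) * y) / a"
          using a by (simp add: field_simps power2_eq_square)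
        moreover have "a * (b * y / a + 1 / a * s) - b * y = s"
          using a by (simp add: field_simps)
        moreover have "b * y / a + 1 / a * s = (s + b * y) / a"
          by (simp add: field_simps add_divide_distrib)
        ultimately show "?\<phi> (b * y / a + 1 / a * s) y *
           f (a * (b * y / a + 1 / a * s) - b * y, b * (b * y / a + 1 / a * s) + a * y) =
           ?\<phi> ((s + b * y) / a) y * f (s, (b * s + y) / a)"
          using ab by simp
      qed
      finally show "(\<integral>\<^sup>+x. ?\<phi> x y * f (a * x - b * y, b * x + a * y) \<partial>lborel) =
        (\<integral>\<^sup>+s. \<bar>1 / a\<bar> * (?\<phi> ((s + b * y) / a) y * f (s, (b * s + y) / a)) \<partial>lborel)"
        by (simp add: nn_integral_cmult)
    qed
    also have "\<dots> = (\<integral>\<^sup>+s. \<integral>\<^sup>+y. \<bar>1 / a\<bar> * (?\<phi> ((s + b * y) / a) y * f (s, (b * s + y) / a)) \<partial>lborel \<partial>lborel)"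
      by (rule lborel_pair.Fubini'[symmetric]) measurable
    also have "\<dots> = (\<integral>\<^sup>+s. \<integral>\<^sup>+z. ?\<phi> s z * f (s, z) \<partial>lborel \<partial>lborel)"
    proof (rule nn_integral_cong)
      fix s :: real
      have "(\<integral>\<^sup>+y. \<bar>1 / a\<bar> * (?\<phi> ((s + b * y) / a) y * f (s, (b * s + y) / a)) \<partial>lborel) =
        \<bar>a\<bar> * (\<integral>\<^sup>+z. \<bar>1 / a\<bar> * (?\<phi> ((s + b * (- b * s + a * z)) / a) (- b * s + a * z)
           * f (s, (b * s + (- b * s + a * z)) / a)) \<partial>lborel)"
        using a by (intro nn_integral_real_affine) auto
      also have "\<dots> = (\<integral>\<^sup>+z. ?\<phi> ((s + b * (- b * s + a * z)) / a) (- b * s + a * z)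
           * f (s, (b * s + (- b * s + a * z)) / a) \<partial>lborel)"
        using a by (subst nn_integral_cmult) (auto simp: mult.assoc[symmetric] ennreal_mult[symmetric] simp flip: abs_mult)
      also have "\<dots> = (\<integral>\<^sup>+z. ?\<phi> s z * f (s, z) \<partial>lborel)"
      proof (rule nn_integral_cong)
        fix z
        have "s + b * (- b * s + a * z) = (a\<^sup>2 + b\<^sup>2) * s - b\<^sup>2 * s + a * b * z"
          unfolding ab by (simp add: algebra_simps power2_eq_square)
        also have "\<dots> = a * (a * s + b * z)" by (simp add: algebra_simps power2_eq_square)
        finally have 1: "(s + b * (- b * s + a * z)) / a = a * s + b * z"
          using a by simp
        have "(a * s + b * z)\<^sup>2 + (- b * s + a * z)\<^sup>2 = (a\<^sup>2 + b\<^sup>2) * (s\<^sup>2 + z\<^sup>2)"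
          by (simp add: algebra_simps power2_eq_square)
        then have "?\<phi> (a * s + b * z) (- b * s + a * z) = ?\<phi> s z"
          unfolding std_normal_density_mult ab by simp
        moreover have "(b * s + (- b * s + a * z)) / a = z" using a by simp
        ultimately show "?\<phi> ((s + b * (- b * s + a * z)) / a) (- b * s + a * z)
           * f (s, (b * s + (- b * s + a * z)) / a) = ?\<phi> s z * f (s, z)"
          unfolding 1 by simp
      qed
      finally show "(\<integral>\<^sup>+y. \<bar>1 / a\<bar> * (?\<phi> ((s + b * y) / a) y * f (s, (b * s + y) / a)) \<partial>lborel) =
        (\<integral>\<^sup>+z. ?\<phi> s z * f (s, z) \<partial>lborel)" .
    qed
    also have "\<dots> = (\<integral>\<^sup>+x. \<integral>\<^sup>+y. f (x, y) \<partial>gauss \<partial>gauss)"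
      by (rule expand[symmetric]) simp
    finally show ?thesis .
  qed
qed

lemma sets_std_gaussian [measurable_cong]:
  "sets (std_gaussian p) = sets (\<Pi>\<^sub>M i\<in>{..<p}. (borel :: real measure))"
  unfolding std_gaussian_def by (intro sets_PiM_cong) auto

lemma space_std_gaussian: "space (std_gaussian p) = {..<p} \<rightarrow>\<^sub>E UNIV"
  unfolding std_gaussian_def by (simp add: space_PiM)

lemma prob_space_std_gaussian: "prob_space (std_gaussian p)"
  unfolding std_gaussian_def by (intro prob_space_PiM prob_space_gauss)

interpretation gauss: prob_space gauss by (rule prob_space_gauss)

interpretation gauss_product: product_sigma_finite "\<lambda>_::nat. gauss" ..

interpretation std_gaussian: prob_space "std_gaussian p" for p
  by (rule prob_space_std_gaussian)

lemma nn_integral_std_gaussian_Suc: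
  fixes f :: "(nat \<Rightarrow> real) \<Rightarrow> ennreal"
  assumes "f \<in> borel_measurable (\<Pi>\<^sub>M i\<in>{..<Suc p}. borel)"
  shows "(\<integral>\<^sup>+x. f x \<partial>std_gaussian (Suc p)) = (\<integral>\<^sup>+x. \<integral>\<^sup>+z. f (x(p := z)) \<partial>gauss \<partial>std_gaussian p)"
    and "(\<integral>\<^sup>+x. f x \<partial>std_gaussian (Suc p)) = (\<integral>\<^sup>+z. \<integral>\<^sup>+x. f (x(p := z)) \<partial>std_gaussian p \<partial>gauss)"
proof -
  have "f \<in> borel_measurable (\<Pi>\<^sub>M i\<in>insert p {..<p}. gauss)"
    using assms by (subst measurable_cong_sets[OF sets_PiM_cong[OF refl measurable_gauss] refl])
      (simp add: lessThan_Suc)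
  then show "(\<integral>\<^sup>+x. f x \<partial>std_gaussian (Suc p)) = (\<integral>\<^sup>+x. \<integral>\<^sup>+z. f (x(p := z)) \<partial>gauss \<partial>std_gaussian p)"
    and "(\<integral>\<^sup>+x. f x \<partial>std_gaussian (Suc p)) = (\<integral>\<^sup>+z. \<integral>\<^sup>+x. f (x(p := z)) \<partial>std_gaussian p \<partial>gauss)"
    unfolding std_gaussian_def lessThan_Suc
    by (auto intro!: gauss_product.product_nn_integral_insert gauss_product.product_nn_integral_insert_rev)
qed

text \<open>The vector t v + B u, restricted to the index set so that it is a point of the
  extensional product space.\<close>

definition along :: "nat \<Rightarrow> (nat \<Rightarrow> real) \<Rightarrow> (nat \<Rightarrow> nat \<Rightarrow> real) \<Rightarrow> real \<Rightarrow> (nat \<Rightarrow> real) \<Rightarrow> nat \<Rightarrow> real" where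
  "along p v B t u = (\<lambda>i\<in>{..<p}. v i * t + (\<Sum>l<p. B i l * u l))"

lemma measurable_along [measurable (raw)]:
  assumes [measurable]: "f \<in> borel_measurable M" "g \<in> M \<rightarrow>\<^sub>M (\<Pi>\<^sub>M i\<in>{..<p}. borel)"
  shows "(\<lambda>x. along p v B (f x) (g x)) \<in> M \<rightarrow>\<^sub>M (\<Pi>\<^sub>M i\<in>{..<p}. borel)"
  unfolding along_def by measurable

lemma measurable_upd_Suc [measurable (raw)]:
  assumes [measurable]: "f \<in> borel_measurable M" "g \<in> M \<rightarrow>\<^sub>M (\<Pi>\<^sub>M i\<in>{..<p}. borel)"
  shows "(\<lambda>x. (g x)(p := f x)) \<in> M \<rightarrow>\<^sub>M (\<Pi>\<^sub>M i\<in>{..<Suc p}. borel)"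
  unfolding lessThan_Suc by (rule measurable_fun_upd[where J = "{..<p}"]) auto

text \<open>
  Given \<open>v \<bullet> X = t\<close>, the vector \<open>X\<close> has the law of \<open>t v + B U\<close> with a standard Gaussian vector \<open>U\<close>.
  In the induction step, the component of the first \<open>p\<close> coordinates along \<open>v\<close> is rotated
  against the last coordinate.
\<close>

lemma std_gaussian_along:
  assumes "(\<Sum>i<p. (v i)\<^sup>2) = 1"
  shows "\<exists>B. (\<forall>l<p. (\<Sum>i<p. v i * B i l) = 0) \<and>
    (\<forall>f \<in> borel_measurable (\<Pi>\<^sub>M i\<in>{..<p}. borel). 
      (\<integral>\<^sup>+x. f x \<partial>std_gaussian p) = (\<integral>\<^sup>+t. \<integral>\<^sup>+u. (f (along p v B t u) :: ennreal) \<partial>std_gaussian p \<partial>gauss))"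
  using assms
proof (induction p arbitrary: v)
  case (Suc p)
  define r where "r = sqrt (\<Sum>i<p. (v i)\<^sup>2)"
  define c where "c = v p"
  have r2: "r\<^sup>2 = (\<Sum>i<p. (v i)\<^sup>2)" unfolding r_def by (simp add: sum_nonneg)
  have rc: "r\<^sup>2 + c\<^sup>2 = 1" using Suc.prems r2 by (simp add: c_def)
  show ?case
  proof (cases "r = 0")
    case True
    then have c: "c = 1 \<or> c = -1" using rc by (simp add: power2_eq_1_iff)
    have v0: "v i = 0" if "i < p" for i
    proof -
      have "(\<Sum>i<p. (v i)\<^sup>2) = 0" using True r2 by simp
      then show ?thesis using that by (simp add: sum_nonneg_eq_0_iff)
    qed
    \<comment> \<open>Here v is plus or minus the last basis vector. \<open>B\<close> keeps the
      first p coordinates and annihilates the last one, which is integrated out.\<close>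
    define B where "B i l = (if i = l \<and> i < p then 1 else 0 :: real)" for i l
    have "(\<Sum>i<Suc p. v i * B i l) = 0" for l
      using v0 by (intro sum.neutral) (auto simp: B_def)
    moreover have "(\<integral>\<^sup>+x. f x \<partial>std_gaussian (Suc p)) =
      (\<integral>\<^sup>+t. \<integral>\<^sup>+u. f (along (Suc p) v B t u) \<partial>std_gaussian (Suc p) \<partial>gauss)"
      if [measurable]: "f \<in> borel_measurable (\<Pi>\<^sub>M i\<in>{..<Suc p}. borel)" for f :: "_ \<Rightarrow> ennreal"
    proof -
      have al: "along (Suc p) v B t (u(p := w)) = u(p := c * t)"
        if "u \<in> space (std_gaussian p)" for t u w
      proof
        fix i
        have "(\<Sum>l<Suc p. B i l * (u(p := w)) l) = u i" if "i < p"
        proof -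
          have "(\<Sum>l<Suc p. B i l * (u(p := w)) l) = (\<Sum>l<Suc p. if l = i then u i else 0)"
            by (intro sum.cong) (use that in \<open>auto simp: B_def\<close>)
          then show ?thesis using that by simp
        qed
        moreover have "(\<Sum>l<Suc p. B p l * (u(p := w)) l) = 0"
          by (intro sum.neutral) (auto simp: B_def)
        ultimately show "along (Suc p) v B t (u(p := w)) i = (u(p := c * t)) i"
          using that v0 by (auto simp: along_def c_def space_std_gaussian PiE_def extensional_def
            simp del: sum.lessThan_Suc fun_upd_apply) auto
      qed
      have "(\<integral>\<^sup>+t. \<integral>\<^sup>+u. f (along (Suc p) v B t u) \<partial>std_gaussian (Suc p) \<partial>gauss) =
        (\<integral>\<^sup>+t. \<integral>\<^sup>+u. f (u(p := c * t)) \<partial>std_gaussian p \<partial>gauss)"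
      proof (rule nn_integral_cong)
        fix t
        have "(\<integral>\<^sup>+u. f (along (Suc p) v B t u) \<partial>std_gaussian (Suc p)) = 
          (\<integral>\<^sup>+u. \<integral>\<^sup>+w. f (along (Suc p) v B t (u(p := w))) \<partial>gauss \<partial>std_gaussian p)"
          by (rule nn_integral_std_gaussian_Suc) measurable
        also have "\<dots> = (\<integral>\<^sup>+u. f (u(p := c * t)) \<partial>std_gaussian p)"
          by (intro nn_integral_cong) (simp add: al gauss.emeasure_space_1[simplified])
        finally show "(\<integral>\<^sup>+u. f (along (Suc p) v B t u) \<partial>std_gaussian (Suc p)) = \<dots>" .
      qed
      also have "\<dots> = (\<integral>\<^sup>+t. \<integral>\<^sup>+u. f (u(p := t)) \<partial>std_gaussian p \<partial>gauss)"
        using c nn_integral_gauss_uminus[of "\<lambda>t. \<integral>\<^sup>+u. f (u(p := t)) \<partial>std_gaussian p"] by auto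
      also have "\<dots> = (\<integral>\<^sup>+x. f x \<partial>std_gaussian (Suc p))"
        by (rule nn_integral_std_gaussian_Suc(2)[symmetric]) measurable
      finally show ?thesis ..
    qed
    ultimately show ?thesis by blast
  next
    case r0: False
    define w where "w i = v i / r" for i
    have "(\<Sum>i<p. (w i)\<^sup>2) = 1"
      using r0 by (simp add: w_def power_divide r2[symmetric] flip: sum_divide_distrib)
    from Suc.IH[OF this] obtain B' where
      B'0: "\<And>l. l < p \<Longrightarrow> (\<Sum>i<p. w i * B' i l) = 0" and
      B': "\<And>f :: _ \<Rightarrow> ennreal. f \<in> borel_measurable (\<Pi>\<^sub>M i\<in>{..<p}. borel) \<Longrightarrow>
        (\<integral>\<^sup>+x. f x \<partial>std_gaussian p) = (\<integral>\<^sup>+t. \<integral>\<^sup>+u. f (along p w B' t u) \<partial>std_gaussian p \<partial>gauss)"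
      by blast
    \<comment> \<open>Here v = (r w, c). The new column (-c w, r) is the unit vector orthogonal to v
      in the plane of w and the last axis; the other columns come from the induction hypothesis for
      w.\<close>
    define B where "B i l = (if i < p then if l < p then B' i l else - c * w i else if l < p then 0 else r)" for i l
    have vw: "v i = r * w i" for i using r0 by (simp add: w_def)
    have "(\<Sum>i<Suc p. v i * B i l) = 0" if "l < Suc p" for l
    proof (cases "l < p")
      case True
      then have "(\<Sum>i<Suc p. v i * B i l) = r * (\<Sum>i<p. w i * B' i l)"
        by (simp add: B_def sum_distrib_left vw mult.assoc)
      then show ?thesis using B'0[OF True] by simp
    next
      case False
      then have "(\<Sum>i<Suc p. v i * B i l) = (\<Sum>i<p. - (c * r) * (w i)\<^sup>2) + c * r"
        by (simp add: B_def c_def[symmetric]) (simp add: vw mult_ac power2_eq_square)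
      also have "\<dots> = 0"
        using \<open>(\<Sum>i<p. (w i)\<^sup>2) = 1\<close> by (simp add: sum_negf flip: sum_distrib_left)
      finally show ?thesis .
    qed
    moreover have "(\<integral>\<^sup>+x. f x \<partial>std_gaussian (Suc p)) =
      (\<integral>\<^sup>+t. \<integral>\<^sup>+u. f (along (Suc p) v B t u) \<partial>std_gaussian (Suc p) \<partial>gauss)"
      if [measurable]: "f \<in> borel_measurable (\<Pi>\<^sub>M i\<in>{..<Suc p}. borel)" for f :: "_ \<Rightarrow> ennreal"
    proof -
      interpret gp: pair_sigma_finite "std_gaussian p" gauss ..
      have al: "(along p w B' (r * t - c * z) u)(p := c * t + r * z) = along (Suc p) v B t (u(p := z))" for t z u
      proof
        fix i
        have "(\<Sum>l<Suc p. B i l * (u(p := z)) l) = (\<Sum>l<p. B' i l * u l) - c * w i * z" if "i < p"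
          using that by (simp add: B_def)
        moreover have "(\<Sum>l<Suc p. B p l * (u(p := z)) l) = r * z"
          by (simp add: B_def)
        ultimately show "((along p w B' (r * t - c * z) u)(p := c * t + r * z)) i = along (Suc p) v B t (u(p := z)) i"
          by (auto simp: along_def c_def[symmetric] simp del: sum.lessThan_Suc) (auto simp: vw algebra_simps)
      qed
      have "(\<integral>\<^sup>+x. f x \<partial>std_gaussian (Suc p)) = (\<integral>\<^sup>+x. \<integral>\<^sup>+z. f (x(p := z)) \<partial>gauss \<partial>std_gaussian p)"
        by (rule nn_integral_std_gaussian_Suc) measurable
      also have "\<dots> = (\<integral>\<^sup>+s. \<integral>\<^sup>+u. \<integral>\<^sup>+z. f ((along p w B' s u)(p := z)) \<partial>gauss \<partial>std_gaussian p \<partial>gauss)"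
        by (rule B') measurable
      also have "\<dots> = (\<integral>\<^sup>+s. \<integral>\<^sup>+z. \<integral>\<^sup>+u. f ((along p w B' s u)(p := z)) \<partial>std_gaussian p \<partial>gauss \<partial>gauss)"
        by (intro nn_integral_cong gp.Fubini'[symmetric]) measurable
      also have "\<dots> = (\<integral>\<^sup>+t. \<integral>\<^sup>+z. \<integral>\<^sup>+u. f ((along p w B' (r * t - c * z) u)(p := c * t + r * z)) \<partial>std_gaussian p \<partial>gauss \<partial>gauss)"
        using nn_integral_gauss_rotation[OF rc, of "\<lambda>(s, z). \<integral>\<^sup>+u. f ((along p w B' s u)(p := z)) \<partial>std_gaussian p"]
        by simp
      also have "\<dots> = (\<integral>\<^sup>+t. \<integral>\<^sup>+z. \<integral>\<^sup>+u. f (along (Suc p) v B t (u(p := z))) \<partial>std_gaussian p \<partial>gauss \<partial>gauss)"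
        unfolding al ..
      also have "\<dots> = (\<integral>\<^sup>+t. \<integral>\<^sup>+u. f (along (Suc p) v B t u) \<partial>std_gaussian (Suc p) \<partial>gauss)"
        by (intro nn_integral_cong nn_integral_std_gaussian_Suc(2)[symmetric]) measurable
      finally show ?thesis .
    qed
    ultimately show ?thesis by blast
  qed
qed simp

text \<open>An equality of measures, so that signed integrands can be transported too. The response
  with law \<open>R\<close> is carried along unchanged, and \<open>B\<close> is fixed before
  \<open>R\<close>.\<close>

lemma std_gaussian_disintegrate:
  assumes "(\<Sum>i<p. (v i)\<^sup>2) = 1"
  shows "\<exists>B. (\<forall>l<p. (\<Sum>i<p. v i * B i l) = 0) \<and>
    (\<forall>R :: real measure. prob_space R \<longrightarrow> std_gaussian p \<Otimes>\<^sub>M R =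
      distr ((gauss \<Otimes>\<^sub>M R) \<Otimes>\<^sub>M std_gaussian p) (std_gaussian p \<Otimes>\<^sub>M R) (\<lambda>z. (along p v B (fst (fst z)) (snd z), snd (fst z))))"
proof -
  obtain B where B0: "\<And>l. l < p \<Longrightarrow> (\<Sum>i<p. v i * B i l) = 0" and
    B: "\<And>f :: _ \<Rightarrow> ennreal. f \<in> borel_measurable (\<Pi>\<^sub>M i\<in>{..<p}. borel) \<Longrightarrow>
      (\<integral>\<^sup>+x. f x \<partial>std_gaussian p) = (\<integral>\<^sup>+t. \<integral>\<^sup>+u. f (along p v B t u) \<partial>std_gaussian p \<partial>gauss)"
    using std_gaussian_along[OF assms] by blast
  have "std_gaussian p \<Otimes>\<^sub>M R =
      distr ((gauss \<Otimes>\<^sub>M R) \<Otimes>\<^sub>M std_gaussian p) (std_gaussian p \<Otimes>\<^sub>M R) (\<lambda>z. (along p v B (fst (fst z)) (snd z), snd (fst z)))"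
    (is "?L = distr _ _ ?f")
    if "prob_space R" for R :: "real measure"
  proof (rule measure_eqI)
    fix A assume A [measurable]: "A \<in> sets ?L"
    interpret R: prob_space R by fact
    interpret pR: pair_sigma_finite "std_gaussian p" R ..
    interpret Rp: pair_sigma_finite R "std_gaussian p" ..
    interpret gR: pair_sigma_finite gauss R ..
    have f [measurable]: "?f \<in> (gauss \<Otimes>\<^sub>M R) \<Otimes>\<^sub>M std_gaussian p \<rightarrow>\<^sub>M ?L"
      by measurable
    have "emeasure ?L A = (\<integral>\<^sup>+x. \<integral>\<^sup>+y. indicator A (x, y) \<partial>R \<partial>std_gaussian p)"
      by (simp add: R.emeasure_pair_measure)
    also have "\<dots> = (\<integral>\<^sup>+t. \<integral>\<^sup>+u. \<integral>\<^sup>+y. indicator A (along p v B t u, y) \<partial>R \<partial>std_gaussian p \<partial>gauss)"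
      by (rule B) measurable
    also have "\<dots> = (\<integral>\<^sup>+t. \<integral>\<^sup>+y. \<integral>\<^sup>+u. indicator A (along p v B t u, y) \<partial>std_gaussian p \<partial>R \<partial>gauss)"
      by (intro nn_integral_cong Rp.Fubini') measurable
    also have "\<dots> = (\<integral>\<^sup>+z. \<integral>\<^sup>+u. indicator A (?f (z, u)) \<partial>std_gaussian p \<partial>(gauss \<Otimes>\<^sub>M R))"
      by (subst R.nn_integral_fst[symmetric]) auto
    also have "\<dots> = (\<integral>\<^sup>+z. indicator A (?f z) \<partial>((gauss \<Otimes>\<^sub>M R) \<Otimes>\<^sub>M std_gaussian p))"
      by (subst std_gaussian.nn_integral_fst[symmetric]) auto
    also have "\<dots> = (\<integral>\<^sup>+z. indicator (?f -` A \<inter> space ((gauss \<Otimes>\<^sub>M R) \<Otimes>\<^sub>M std_gaussian p)) z \<partial>((gauss \<Otimes>\<^sub>M R) \<Otimes>\<^sub>M std_gaussian p))"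
      by (intro nn_integral_cong) (auto simp: indicator_def)
    also have "\<dots> = emeasure (distr ((gauss \<Otimes>\<^sub>M R) \<Otimes>\<^sub>M std_gaussian p) ?L ?f) A"
      using measurable_sets[OF f A] by (subst emeasure_distr) simp_all
    finally show "emeasure ?L A = \<dots>" .
  qed simp
  with B0 show ?thesis by blast
qed

lemma along_inner:
  assumes "\<And>l. l < p \<Longrightarrow> (\<Sum>i<p. v i * B i l) = 0"
  shows "(\<Sum>i<p. w i * along p v B t u i) = (\<Sum>i<p. v i * w i) * t + (\<Sum>i<p. w i * (\<Sum>l<p. B i l * u l))"
    and "(\<Sum>i<p. (v i)\<^sup>2) = 1 \<Longrightarrow> (\<Sum>i<p. v i * along p v B t u i) = t"
proof -
  show *: "(\<Sum>i<p. w i * along p v B t u i) = (\<Sum>i<p. v i * w i) * t + (\<Sum>i<p. w i * (\<Sum>l<p. B i l * u l))" for w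
    by (simp add: along_def algebra_simps sum.distrib sum_distrib_left sum_distrib_right)
  have "(\<Sum>i<p. v i * (\<Sum>l<p. B i l * u l)) = (\<Sum>l<p. u l * (\<Sum>i<p. v i * B i l))"
    by (simp add: sum_distrib_left mult_ac, subst sum.swap) simp
  also have "\<dots> = 0" using assms by simp
  finally show "(\<Sum>i<p. v i * along p v B t u i) = t" if "(\<Sum>i<p. (v i)\<^sup>2) = 1"
    using *[of v] that by (simp add: power2_eq_square)
qed

section \<open>Functions with all moments, and polynomials with random coefficients\<close>

text \<open>Closed under sums, products and powers, so integrability of every polynomial expression
  follows by structure alone.\<close>

definition all_moments :: "'a measure \<Rightarrow> ('a \<Rightarrow> real) \<Rightarrow> bool" where
  "all_moments M f \<longleftrightarrow> f \<in> borel_measurable M \<and> (\<forall>k::nat. integrable M (\<lambda>x. \<bar>f x\<bar> ^ k))"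

lemma all_moments_measurable: "all_moments M f \<Longrightarrow> f \<in> borel_measurable M"
  by (simp add: all_moments_def)

lemma all_moments_integrable: "all_moments M f \<Longrightarrow> integrable M f"
  using integrable_abs_iff[of f M] unfolding all_moments_def
  by (auto dest: spec[of _ "1 :: nat"])

lemma all_moments_const: "finite_measure M \<Longrightarrow> all_moments M (\<lambda>_. c)"
  by (auto simp: all_moments_def finite_measure.integrable_const)

lemma all_moments_mult:
  assumes "all_moments M f" "all_moments M g"
  shows "all_moments M (\<lambda>x. f x * g x)"
  unfolding all_moments_def
proof safe
  have [measurable]: "f \<in> borel_measurable M" "g \<in> borel_measurable M"
    using assms by (auto simp: all_moments_def)
  show "(\<lambda>x. f x * g x) \<in> borel_measurable M" by simp
  fix k :: nat
  have "integrable M (\<lambda>x. \<bar>f x\<bar> ^ (2 * k) + \<bar>g x\<bar> ^ (2 * k))"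
    using assms by (auto simp: all_moments_def intro!: Bochner_Integration.integrable_add)
  then show "integrable M (\<lambda>x. \<bar>f x * g x\<bar> ^ k)"
  proof (rule Bochner_Integration.integrable_bound)
    show "AE x in M. norm (\<bar>f x * g x\<bar> ^ k) \<le> norm (\<bar>f x\<bar> ^ (2 * k) + \<bar>g x\<bar> ^ (2 * k))"
    proof (intro AE_I2)
      fix x
      have "2 * (\<bar>f x\<bar> ^ k * \<bar>g x\<bar> ^ k) \<le> (\<bar>f x\<bar> ^ k)\<^sup>2 + (\<bar>g x\<bar> ^ k)\<^sup>2"
        using sum_squares_bound[of "\<bar>f x\<bar> ^ k" "\<bar>g x\<bar> ^ k"] by simp
      moreover have "0 \<le> \<bar>f x\<bar> ^ k * \<bar>g x\<bar> ^ k" by simp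
      ultimately have "\<bar>f x\<bar> ^ k * \<bar>g x\<bar> ^ k \<le> (\<bar>f x\<bar> ^ k)\<^sup>2 + (\<bar>g x\<bar> ^ k)\<^sup>2"
        by linarith
      then show "norm (\<bar>f x * g x\<bar> ^ k) \<le> norm (\<bar>f x\<bar> ^ (2 * k) + \<bar>g x\<bar> ^ (2 * k))"
        by (simp add: abs_mult power_mult_distrib power_mult[symmetric] mult.commute[of k])
    qed
  qed measurable
qed

lemma all_moments_add:
  assumes "all_moments M f" "all_moments M g"
  shows "all_moments M (\<lambda>x. f x + g x)"
  unfolding all_moments_def
proof safe
  have [measurable]: "f \<in> borel_measurable M" "g \<in> borel_measurable M"
    using assms by (auto simp: all_moments_def)
  show "(\<lambda>x. f x + g x) \<in> borel_measurable M" by simp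
  fix k :: nat
  have "integrable M (\<lambda>x. 2 ^ k * (\<bar>f x\<bar> ^ k + \<bar>g x\<bar> ^ k))"
    using assms by (auto simp: all_moments_def)
  then show "integrable M (\<lambda>x. \<bar>f x + g x\<bar> ^ k)"
  proof (rule Bochner_Integration.integrable_bound)
    show "AE x in M. norm (\<bar>f x + g x\<bar> ^ k) \<le> norm (2 ^ k * (\<bar>f x\<bar> ^ k + \<bar>g x\<bar> ^ k))"
    proof (intro AE_I2)
      fix x
      have "\<bar>f x + g x\<bar> ^ k \<le> (2 * max \<bar>f x\<bar> \<bar>g x\<bar>) ^ k"
        by (intro power_mono) auto
      also have "\<dots> = 2 ^ k * (max \<bar>f x\<bar> \<bar>g x\<bar>) ^ k" by (simp add: power_mult_distrib)
      also have "\<dots> \<le> 2 ^ k * (\<bar>f x\<bar> ^ k + \<bar>g x\<bar> ^ k)"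
        by (intro mult_left_mono) (auto simp: max_def)
      finally show "norm (\<bar>f x + g x\<bar> ^ k) \<le> norm (2 ^ k * (\<bar>f x\<bar> ^ k + \<bar>g x\<bar> ^ k))"
        by simp
    qed
  qed measurable
qed

lemma all_moments_sum:
  assumes "finite_measure M" "\<And>i. i \<in> I \<Longrightarrow> all_moments M (f i)"
  shows "all_moments M (\<lambda>x. \<Sum>i\<in>I. f i x)"
  using assms(2)
  by (induction I rule: infinite_finite_induct) (auto intro: all_moments_add all_moments_const[OF assms(1)])

lemma all_moments_prod:
  assumes "finite_measure M" "\<And>i. i \<in> I \<Longrightarrow> all_moments M (f i)"
  shows "all_moments M (\<lambda>x. \<Prod>i\<in>I. f i x)"
  using assms(2)
  by (induction I rule: infinite_finite_induct) (auto intro: all_moments_mult all_moments_const[OF assms(1)])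

lemma all_moments_power:
  assumes "finite_measure M" "all_moments M f"
  shows "all_moments M (\<lambda>x. f x ^ n)"
  by (induction n) (auto intro: all_moments_mult assms all_moments_const[OF assms(1)])

lemma all_moments_distr:
  assumes "g \<in> M \<rightarrow>\<^sub>M N" "all_moments (distr M N g) f"
  shows "all_moments M (\<lambda>x. f (g x))"
  using assms by (auto simp: all_moments_def integrable_distr_eq)

lemma all_moments_gauss_poly: "all_moments gauss (poly q)"
proof -
  have "all_moments gauss (\<lambda>x. x)"
    unfolding all_moments_def
  proof safe
    fix k :: nat
    show "integrable gauss (\<lambda>x. \<bar>x\<bar> ^ k)"
      using integrable_abs[OF integrable_gauss_power[of k]] by (simp add: power_abs)
  qed simp
  then have "all_moments gauss (\<lambda>x. \<Sum>i\<le>degree q. coeff q i * x ^ i)"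
    by (intro all_moments_sum all_moments_mult all_moments_power all_moments_const gauss.finite_measure_axioms)
  then show ?thesis by (simp add: poly_altdef[abs_def])
qed

lemma all_moments_component:
  assumes "i < p"
  shows "all_moments (std_gaussian p) (\<lambda>x. x i)"
proof (rule all_moments_distr[where N = gauss and f = "\<lambda>x. x"])
  have "distr (std_gaussian p) gauss (\<lambda>x. x i) = gauss"
    unfolding std_gaussian_def
    by (rule distr_PiM_component[of "{..<p}" "\<lambda>_. gauss" i]) (simp_all add: assms prob_space_gauss)
  then show "all_moments (distr (std_gaussian p) gauss (\<lambda>x. x i)) (\<lambda>x. x)"
    using all_moments_gauss_poly[of "[:0, 1:]"] by (simp add: poly_pCons[abs_def])
  show "(\<lambda>x. x i) \<in> std_gaussian p \<rightarrow>\<^sub>M gauss"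
    unfolding std_gaussian_def by (rule measurable_component_singleton) (simp add: assms)
qed

text \<open>A polynomial in t whose coefficients are random variables in u and whose degree is
  bounded uniformly in u. It arises when t v + B u is substituted into a polynomial in X.\<close>

definition random_poly :: "'a measure \<Rightarrow> nat \<Rightarrow> ('a \<Rightarrow> real poly) \<Rightarrow> bool" where
  "random_poly M d Q \<longleftrightarrow> (\<forall>u. degree (Q u) \<le> d) \<and> (\<forall>a. all_moments M (\<lambda>u. coeff (Q u) a))"

lemma random_poly_const: "finite_measure M \<Longrightarrow> degree q \<le> d \<Longrightarrow> random_poly M d (\<lambda>_. q)"
  by (simp add: random_poly_def all_moments_const)

lemma random_poly_mult:
  assumes "finite_measure M" "random_poly M d Q" "random_poly M e S"
  shows "random_poly M (d + e) (\<lambda>u. Q u * S u)"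
  using assms unfolding random_poly_def coeff_mult
  by (auto intro!: all_moments_sum all_moments_mult order.trans[OF degree_mult_le] add_mono)

lemma random_poly_power:
  assumes "finite_measure M" "random_poly M d Q"
  shows "random_poly M (n * d) (\<lambda>u. Q u ^ n)"
proof (induction n)
  case 0
  show ?case using random_poly_const[OF assms(1), of 1 0] by simp
next
  case (Suc n)
  show ?case using random_poly_mult[OF assms Suc] by simp
qed

lemma random_poly_prod:
  assumes "finite_measure M" "\<And>i. i \<in> I \<Longrightarrow> random_poly M (d i) (Q i)"
  shows "random_poly M (\<Sum>i\<in>I. d i) (\<lambda>u. \<Prod>i\<in>I. Q i u)"
  using assms(2)
proof (induction I rule: infinite_finite_induct)
  case (infinite I)
  then show ?case using random_poly_const[OF assms(1), of 1 0] by simp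
next
  case empty
  then show ?case using random_poly_const[OF assms(1), of 1 0] by simp
next
  case (insert i I)
  then show ?case using random_poly_mult[OF assms(1), of "d i" "Q i"] by simp
qed

lemma random_poly_mono: "random_poly M d Q \<Longrightarrow> d \<le> e \<Longrightarrow> random_poly M e Q"
  by (auto simp: random_poly_def intro: order.trans)

lemma random_poly_sum:
  assumes "finite_measure M" "\<And>i. i \<in> I \<Longrightarrow> random_poly M d (Q i)"
  shows "random_poly M d (\<lambda>u. \<Sum>i\<in>I. Q i u)"
  using assms unfolding random_poly_def coeff_sum
  by (cases "finite I") (auto intro!: all_moments_sum degree_sum_le all_moments_const)

lemma pcompose_sum_powers: "pcompose q r = (\<Sum>i\<le>degree q. smult (coeff q i) (r ^ i))"
  for q :: "real poly"
  by (rule poly_ext) (simp add: poly_pcompose poly_sum poly_altdef[of q])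

lemma random_poly_pcompose:
  assumes "finite_measure M" "random_poly M 1 Q" "degree q \<le> d"
  shows "random_poly M d (\<lambda>u. pcompose q (Q u))"
  unfolding pcompose_sum_powers
proof (rule random_poly_sum[OF assms(1)])
  fix i assume "i \<in> {..degree q}"
  then have "random_poly M d (\<lambda>u. Q u ^ i)"
    using random_poly_mono[OF random_poly_power[OF assms(1,2), of i], of d] assms(3) by simp
  then show "random_poly M d (\<lambda>u. smult (coeff q i) (Q u ^ i))"
    using random_poly_mult[OF assms(1) random_poly_const[OF assms(1), of "[:coeff q i:]" 0], of d]
    by simp
qed

lemma random_poly_linear:
  assumes "finite_measure M" "all_moments M f"
  shows "random_poly M 1 (\<lambda>u. [:f u, c:])"
  unfolding random_poly_def
proof safe
  fix a
  show "all_moments M (\<lambda>u. coeff [:f u, c:] a)"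
    using assms all_moments_const[OF assms(1)] by (cases a) (auto simp: coeff_pCons split: nat.split)
qed simp

section \<open>Conditional means given a linear form\<close>

lemma integrable_pair_mult:
  fixes f :: "'a \<Rightarrow> real" and g :: "'b \<Rightarrow> real"
  assumes "prob_space M" "prob_space N" "integrable M f" "integrable N g"
  shows "integrable (M \<Otimes>\<^sub>M N) (\<lambda>(x, y). f x * g y)"
    and "(\<integral>(x, y). f x * g y \<partial>(M \<Otimes>\<^sub>M N)) = (\<integral>x. f x \<partial>M) * (\<integral>y. g y \<partial>N)"
proof -
  interpret M: prob_space M by fact
  interpret N: prob_space N by fact
  interpret P: pair_sigma_finite M N ..
  have [measurable]: "f \<in> borel_measurable M" "g \<in> borel_measurable N"
    using assms by auto
  show int: "integrable (M \<Otimes>\<^sub>M N) (\<lambda>(x, y). f x * g y)"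
    using assms by (intro P.Fubini_integrable) (auto simp: abs_mult)
  show "(\<integral>(x, y). f x * g y \<partial>(M \<Otimes>\<^sub>M N)) = (\<integral>x. f x \<partial>M) * (\<integral>y. g y \<partial>N)"
    using P.integral_fst'[OF int] assms by simp
qed


text \<open>After the substitution, \<open>X\<close> is a polynomial in t with coefficients
  depending only on u, which is independent of (t, y). Averaging the coefficients gives
  \<open>q\<close>, the conditional mean of \<open>X\<close> given v . x = t.\<close>

lemma integral_along:
  fixes G :: "real \<Rightarrow> real \<Rightarrow> real"
  assumes unit: "(\<Sum>i<p. (v i)\<^sup>2) = 1" and B0: "\<And>l. l < p \<Longrightarrow> (\<Sum>i<p. v i * B i l) = 0"
    and R: "prob_space R" and R_borel [measurable_cong]: "sets R = sets borel"
    and B: "std_gaussian p \<Otimes>\<^sub>M R = distr ((gauss \<Otimes>\<^sub>M R) \<Otimes>\<^sub>M std_gaussian p) (std_gaussian p \<Otimes>\<^sub>M R)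
       (\<lambda>z. (along p v B (fst (fst z)) (snd z), snd (fst z)))"
    and X [measurable]: "X \<in> borel_measurable (\<Pi>\<^sub>M i\<in>{..<p}. borel)"
    and G [measurable]: "(\<lambda>(t, y). G t y) \<in> borel_measurable (borel \<Otimes>\<^sub>M borel)"
    and G_int: "\<And>a. integrable (gauss \<Otimes>\<^sub>M R) (\<lambda>(t, y). t ^ a * G t y)"
    and Q: "random_poly (std_gaussian p) d Q" and XQ: "\<And>t u. X (along p v B t u) = poly (Q u) t"
  defines "q \<equiv> \<Sum>a\<le>d. monom (\<integral>u. coeff (Q u) a \<partial>std_gaussian p) a"
  shows "integrable (std_gaussian p \<Otimes>\<^sub>M R) (\<lambda>(x, y). X x * G (\<Sum>i<p. v i * x i) y)"
    and "(\<integral>(x, y). X x * G (\<Sum>i<p. v i * x i) y \<partial>(std_gaussian p \<Otimes>\<^sub>M R)) =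
      (\<integral>(t, y). poly q t * G t y \<partial>(gauss \<Otimes>\<^sub>M R))"
proof -
  interpret R: prob_space R by fact
  interpret gR: pair_prob_space gauss R ..
  let ?\<Phi> = "\<lambda>z :: (real \<times> real) \<times> (nat \<Rightarrow> real). (along p v B (fst (fst z)) (snd z), snd (fst z))"
  let ?f = "\<lambda>(x, y). X x * G (\<Sum>i<p. v i * x i) y"
  have [measurable]: "?\<Phi> \<in> (gauss \<Otimes>\<^sub>M R) \<Otimes>\<^sub>M std_gaussian p \<rightarrow>\<^sub>M std_gaussian p \<Otimes>\<^sub>M R"
    by measurable
  have f [measurable]: "?f \<in> borel_measurable (std_gaussian p \<Otimes>\<^sub>M R)"
    by measurable
  have coeff_int: "integrable (std_gaussian p) (\<lambda>u. coeff (Q u) a)" for a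
    using Q by (auto simp: random_poly_def intro: all_moments_integrable)
  have f_eq: "?f (?\<Phi> z) = (\<Sum>a\<le>d. (\<lambda>(x, u). (\<lambda>(t, y). t ^ a * G t y) x * coeff (Q u) a) z)" for z
  proof -
    have "poly (Q u) t = (\<Sum>a\<le>d. coeff (Q u) a * t ^ a)" for u t
      unfolding poly_altdef using Q
      by (intro sum.mono_neutral_left) (auto simp: random_poly_def coeff_eq_0 not_le)
    then show ?thesis
      by (simp add: case_prod_unfold XQ along_inner(2)[OF B0 unit] sum_distrib_right sum_distrib_left mult_ac)
  qed
  have int: "integrable ((gauss \<Otimes>\<^sub>M R) \<Otimes>\<^sub>M std_gaussian p) (\<lambda>(x, u). (\<lambda>(t, y). t ^ a * G t y) x * coeff (Q u) a)"
    and int_eq: "(\<integral>(x, u). (\<lambda>(t, y). t ^ a * G t y) x * coeff (Q u) a \<partial>((gauss \<Otimes>\<^sub>M R) \<Otimes>\<^sub>M std_gaussian p)) =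
      (\<integral>(t, y). t ^ a * G t y \<partial>(gauss \<Otimes>\<^sub>M R)) * (\<integral>u. coeff (Q u) a \<partial>std_gaussian p)" for a
    using integrable_pair_mult[OF gR.prob_space_axioms std_gaussian.prob_space_axioms G_int coeff_int]
    by auto
  show "integrable (std_gaussian p \<Otimes>\<^sub>M R) ?f"
    by (subst B, subst integrable_distr_eq) (measurable, simp only: f_eq Bochner_Integration.integrable_sum int)
  have "integral\<^sup>L (std_gaussian p \<Otimes>\<^sub>M R) ?f = (\<integral>z. ?f (?\<Phi> z) \<partial>((gauss \<Otimes>\<^sub>M R) \<Otimes>\<^sub>M std_gaussian p))"
    by (subst B, subst integral_distr) measurable
  also have "\<dots> = (\<Sum>a\<le>d. (\<integral>(t, y). t ^ a * G t y \<partial>(gauss \<Otimes>\<^sub>M R)) * (\<integral>u. coeff (Q u) a \<partial>std_gaussian p))"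
    unfolding f_eq by (subst Bochner_Integration.integral_sum) (simp_all only: int int_eq)
  also have "\<dots> = (\<integral>z. (\<Sum>a\<le>d. (\<integral>u. coeff (Q u) a \<partial>std_gaussian p) * (\<lambda>(t, y). t ^ a * G t y) z) \<partial>(gauss \<Otimes>\<^sub>M R))"
    by (subst Bochner_Integration.integral_sum)
      (intro integrable_mult_right G_int, simp only: integral_mult_right_zero mult.commute)
  also have "\<dots> = (\<integral>(t, y). poly q t * G t y \<partial>(gauss \<Otimes>\<^sub>M R))"
    by (intro Bochner_Integration.integral_cong)
      (auto simp: q_def poly_sum poly_monom sum_distrib_right mult.assoc)
  finally show "integral\<^sup>L (std_gaussian p \<Otimes>\<^sub>M R) ?f = \<dots>" .
qed

lemma degree_sum_monom_le: "degree (\<Sum>a\<le>d. monom (c a) a) \<le> d"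
  by (intro degree_sum_le) (auto intro: order.trans[OF degree_monom_le])

text \<open>Conditioning on v . x does not raise the degree; this eliminates Hermite components of
  order above the degree of the monomial. One \<open>q\<close> serves for every \<open>G\<close>, so
  the likelihood ratio and its components can be compared through the same polynomial.\<close>

lemma monomial_reduction:
  assumes unit: "(\<Sum>i<p. (v i)\<^sup>2) = 1" and R: "prob_space R" and R_borel: "sets R = sets borel"
  obtains q where "degree q \<le> (\<Sum>i<p. \<beta> i)"
    and "\<And>G :: real \<Rightarrow> real \<Rightarrow> real. (\<lambda>(t, y). G t y) \<in> borel_measurable (borel \<Otimes>\<^sub>M borel) \<Longrightarrow>
      (\<And>a. integrable (gauss \<Otimes>\<^sub>M R) (\<lambda>(t, y). t ^ a * G t y)) \<Longrightarrow>
      integrable (std_gaussian p \<Otimes>\<^sub>M R) (\<lambda>(x, y). (\<Prod>i<p. x i ^ \<beta> i) * G (\<Sum>i<p. v i * x i) y) \<and>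
      (\<integral>(x, y). (\<Prod>i<p. x i ^ \<beta> i) * G (\<Sum>i<p. v i * x i) y \<partial>(std_gaussian p \<Otimes>\<^sub>M R)) =
        (\<integral>(t, y). poly q t * G t y \<partial>(gauss \<Otimes>\<^sub>M R))"
proof -
  obtain B where B0: "\<forall>l<p. (\<Sum>i<p. v i * B i l) = 0" and
    B: "\<forall>R :: real measure. prob_space R \<longrightarrow> std_gaussian p \<Otimes>\<^sub>M R =
      distr ((gauss \<Otimes>\<^sub>M R) \<Otimes>\<^sub>M std_gaussian p) (std_gaussian p \<Otimes>\<^sub>M R) (\<lambda>z. (along p v B (fst (fst z)) (snd z), snd (fst z)))"
    using std_gaussian_disintegrate[OF unit] by blast
  \<comment> \<open>Coordinate i of t v + B u is a linear polynomial in t with constant term (B u)_i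
    and slope v_i.\<close>
  define Q where "Q u = (\<Prod>i<p. [:\<Sum>l<p. B i l * u l, v i:] ^ \<beta> i)" for u
  have fin: "finite_measure (std_gaussian p)"
    by (rule std_gaussian.finite_measure_axioms)
  have Q: "random_poly (std_gaussian p) (\<Sum>i<p. \<beta> i * 1) Q"
    unfolding Q_def
    by (intro random_poly_prod random_poly_power random_poly_linear fin all_moments_sum all_moments_mult
      all_moments_component all_moments_const) auto
  have XQ: "(\<Prod>i<p. along p v B t u i ^ \<beta> i) = poly (Q u) t" for t u
    by (simp add: Q_def poly_prod along_def add.commute mult.commute)
  define q where "q = (\<Sum>a\<le>\<Sum>i<p. \<beta> i * 1. monom (\<integral>u. coeff (Q u) a \<partial>std_gaussian p) a)"
  show ?thesis
  proof (rule that[of q])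
    show "degree q \<le> (\<Sum>i<p. \<beta> i)"
      using degree_sum_monom_le[where d = "\<Sum>i<p. \<beta> i * 1"] unfolding q_def by simp
    fix G :: "real \<Rightarrow> real \<Rightarrow> real"
    assume G: "(\<lambda>(t, y). G t y) \<in> borel_measurable (borel \<Otimes>\<^sub>M borel)"
      "\<And>a. integrable (gauss \<Otimes>\<^sub>M R) (\<lambda>(t, y). t ^ a * G t y)"
    have X: "(\<lambda>x. \<Prod>i<p. x i ^ \<beta> i) \<in> borel_measurable (\<Pi>\<^sub>M i\<in>{..<p}. (borel :: real measure))"
      by measurable
    show "integrable (std_gaussian p \<Otimes>\<^sub>M R) (\<lambda>(x, y). (\<Prod>i<p. x i ^ \<beta> i) * G (\<Sum>i<p. v i * x i) y) \<and>
      (\<integral>(x, y). (\<Prod>i<p. x i ^ \<beta> i) * G (\<Sum>i<p. v i * x i) y \<partial>(std_gaussian p \<Otimes>\<^sub>M R)) =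
        (\<integral>(t, y). poly q t * G t y \<partial>(gauss \<Otimes>\<^sub>M R))"
      unfolding q_def
      by (intro conjI integral_along[OF unit B0[rule_format] R R_borel B[rule_format, OF R] X G Q XQ])
  qed
qed

lemma coeff_pcompose_linear:
  fixes q :: "real poly"
  assumes "degree q \<le> l"
  shows "coeff (pcompose q [:w, \<rho>:]) l = coeff q l * \<rho> ^ l"
proof -
  have deg: "degree ([:w, \<rho>:] ^ i) \<le> i" for i
    using degree_power_le[of "[:w, \<rho>:]" i] by (auto intro: order.trans)
  have top: "coeff ([:w, \<rho>:] ^ i) i = \<rho> ^ i" for i
  proof (induction i)
    case (Suc i)
    then show ?case using coeff_eq_0[of "[:w, \<rho>:] ^ i" "Suc i"] deg[of i] by simp
  qed simp
  have "coeff (pcompose q [:w, \<rho>:]) l = (\<Sum>i\<le>degree q. coeff q i * coeff ([:w, \<rho>:] ^ i) l)"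
    by (simp add: pcompose_sum_powers coeff_sum)
  also have "\<dots> = (\<Sum>i\<le>degree q. if i = l then coeff q l * \<rho> ^ l else 0)"
    using assms deg by (intro sum.cong) (auto simp: top intro!: coeff_eq_0 le_less_trans[OF deg])
  also have "\<dots> = coeff q l * \<rho> ^ l"
    using assms by (auto simp: coeff_eq_0)
  finally show ?thesis .
qed

text \<open>
  Given \<open>v \<bullet> X = t\<close>, the conditional mean of \<open>he\<^sub>l(w \<bullet> X)\<close> is a polynomial of degree at most \<open>l\<close>
  in \<open>t\<close>; only its coefficient at \<open>t\<^sup>l\<close> matters, since \<open>he\<^sub>j\<close> is orthogonal to lower degrees.
\<close>

lemma hermite_projections:
  assumes v: "(\<Sum>i<p. (v i)\<^sup>2) = 1" and w: "(\<Sum>i<p. (w i)\<^sup>2) = 1"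
  shows "integrable (std_gaussian p) (\<lambda>x. poly (hp j) (\<Sum>i<p. v i * x i) * poly (hp l) (\<Sum>i<p. w i * x i))"
    and "(\<integral>x. poly (hp j) (\<Sum>i<p. v i * x i) * poly (hp l) (\<Sum>i<p. w i * x i) \<partial>std_gaussian p) =
      (if j = l then (\<Sum>i<p. v i * w i) ^ j else 0)"
proof -
  have fin: "finite_measure (std_gaussian p)"
    by (rule std_gaussian.finite_measure_axioms)
  have mom: "all_moments (std_gaussian p) (\<lambda>x. poly (hp j) (\<Sum>i<p. v i * x i))" for j v
    unfolding poly_altdef
    by (intro all_moments_sum all_moments_mult all_moments_power all_moments_const all_moments_component fin) auto
  show "integrable (std_gaussian p) (\<lambda>x. poly (hp j) (\<Sum>i<p. v i * x i) * poly (hp l) (\<Sum>i<p. w i * x i))"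
    by (intro all_moments_integrable all_moments_mult mom)
  \<comment> \<open>With the lower order l conditioned on the form of the higher order j, the
    conditional mean has degree at most j. The other case follows by exchanging v and w.\<close>
  have le: "(\<integral>x. poly (hp j) (\<Sum>i<p. v i * x i) * poly (hp l) (\<Sum>i<p. w i * x i) \<partial>std_gaussian p) =
      (if j = l then (\<Sum>i<p. v i * w i) ^ j else 0)"
    if v: "(\<Sum>i<p. (v i)\<^sup>2) = 1" and w: "(\<Sum>i<p. (w i)\<^sup>2) = 1" and lj: "l \<le> j" for v w j l
  proof -
    obtain B where B0: "\<forall>l<p. (\<Sum>i<p. v i * B i l) = 0" and
      B: "\<forall>R :: real measure. prob_space R \<longrightarrow> std_gaussian p \<Otimes>\<^sub>M R =
        distr ((gauss \<Otimes>\<^sub>M R) \<Otimes>\<^sub>M std_gaussian p) (std_gaussian p \<Otimes>\<^sub>M R) (\<lambda>z. (along p v B (fst (fst z)) (snd z), snd (fst z)))"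
      using std_gaussian_disintegrate[OF v] by blast
    define \<rho> where "\<rho> = (\<Sum>i<p. v i * w i)"
    define Q where "Q u = pcompose (hp l) [:\<Sum>i<p. w i * (\<Sum>l<p. B i l * u l), \<rho>:]" for u
    have Q: "random_poly (std_gaussian p) l Q"
      unfolding Q_def
      by (intro random_poly_pcompose random_poly_linear fin all_moments_sum all_moments_mult
        all_moments_component all_moments_const degree_hp_le) auto
    have XQ: "poly (hp l) (\<Sum>i<p. w i * along p v B t u i) = poly (Q u) t" for t u
      by (simp add: Q_def poly_pcompose along_inner(1)[OF B0[rule_format]] \<rho>_def add.commute mult.commute)
    define q where "q = (\<Sum>a\<le>l. monom (\<integral>u. coeff (Q u) a \<partial>std_gaussian p) a)"
    have q_l: "coeff q l = \<rho> ^ l / sqrt (fact l)"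
      by (simp add: q_def coeff_sum coeff_monom Q_def coeff_pcompose_linear[OF degree_hp_le]
        coeff_hp_top std_gaussian.prob_space)
    have q_deg: "degree q \<le> l" unfolding q_def by (rule degree_sum_monom_le)
    have int: "integrable (gauss \<Otimes>\<^sub>M gauss) (\<lambda>(t, y). t ^ a * poly (hp j) t)" for a
    proof -
      have "integrable gauss (\<lambda>t. t ^ a * poly (hp j) t)"
        using integrable_gauss_poly[of "monom 1 a * hp j"] by (simp add: poly_monom poly_mult[abs_def])
      from integrable_pair_mult(1)[OF prob_space_gauss prob_space_gauss this, of "\<lambda>_. 1"]
      show ?thesis by simp
    qed
    have meas: "(\<lambda>x. poly (hp l) (\<Sum>i<p. w i * x i)) \<in> borel_measurable (\<Pi>\<^sub>M i\<in>{..<p}. borel)"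
      "(\<lambda>(t :: real, y :: real). poly (hp j) t) \<in> borel_measurable (borel \<Otimes>\<^sub>M borel)"
      by measurable
    \<comment> \<open>A dummy independent Gaussian response brings the integral into the form of
      \<open>integral_along\<close>.\<close>
    have "(\<integral>x. poly (hp j) (\<Sum>i<p. v i * x i) * poly (hp l) (\<Sum>i<p. w i * x i) \<partial>std_gaussian p) = 
      (\<integral>(x, y). (poly (hp j) (\<Sum>i<p. v i * x i) * poly (hp l) (\<Sum>i<p. w i * x i)) * 1 \<partial>(std_gaussian p \<Otimes>\<^sub>M gauss))"
      by (subst integrable_pair_mult(2))
        (auto intro!: all_moments_integrable all_moments_mult mom simp: gauss.prob_space[simplified] prob_space_gauss prob_space_std_gaussian)
    also have "\<dots> = (\<integral>(x, y). poly (hp l) (\<Sum>i<p. w i * x i) * poly (hp j) (\<Sum>i<p. v i * x i) \<partial>(std_gaussian p \<Otimes>\<^sub>M gauss))"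
      by (simp add: mult.commute)
    also have "\<dots> = (\<integral>(t, y). poly q t * poly (hp j) t \<partial>(gauss \<Otimes>\<^sub>M gauss))"
      unfolding q_def
      by (rule integral_along(2)[OF v B0[rule_format] prob_space_gauss measurable_gauss B[rule_format, OF prob_space_gauss] meas int Q XQ])
    also have "\<dots> = (\<integral>(t, y). poly (q * hp j) t * 1 \<partial>(gauss \<Otimes>\<^sub>M gauss))" by simp
    also have "\<dots> = (\<integral>t. poly (q * hp j) t \<partial>gauss)"
      by (subst integrable_pair_mult(2)) (auto simp: gauss.prob_space[simplified] prob_space_gauss)
    also have "\<dots> = sqrt (fact j) * coeff q j"
      using gauss_hp_top[of q j] q_deg lj by (simp add: mult.commute)
    also have "\<dots> = (if j = l then \<rho> ^ j else 0)"
      using q_l q_deg lj by (auto simp: coeff_eq_0)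
    finally show ?thesis by (simp add: \<rho>_def)
  qed
  show "(\<integral>x. poly (hp j) (\<Sum>i<p. v i * x i) * poly (hp l) (\<Sum>i<p. w i * x i) \<partial>std_gaussian p) =
      (if j = l then (\<Sum>i<p. v i * w i) ^ j else 0)"
  proof (cases "l \<le> j")
    case True
    then show ?thesis by (rule le[OF v w])
  next
    case False
    then show ?thesis using le[OF w v, of j l] by (simp add: mult.commute)
  qed
qed

subsection \<open>Low-degree polynomials under a planted direction\<close>

definition sq_integrable :: "'a measure \<Rightarrow> ('a \<Rightarrow> real) \<Rightarrow> bool" where
  "sq_integrable M f \<longleftrightarrow> f \<in> borel_measurable M \<and> integrable M (\<lambda>x. (f x)\<^sup>2)"

lemma sq_integrable_mult:
  assumes "sq_integrable M f" "sq_integrable M g"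
  shows "integrable M (\<lambda>x. f x * g x)"
proof (rule Bochner_Integration.integrable_bound)
  show "integrable M (\<lambda>x. (f x)\<^sup>2 + (g x)\<^sup>2)"
    using assms by (auto simp: sq_integrable_def)
  show "(\<lambda>x. f x * g x) \<in> borel_measurable M"
    using assms by (auto simp: sq_integrable_def)
  show "AE x in M. norm (f x * g x) \<le> norm ((f x)\<^sup>2 + (g x)\<^sup>2)"
  proof (rule AE_I2)
    fix x
    have "2 * (\<bar>f x\<bar> * \<bar>g x\<bar>) \<le> (f x)\<^sup>2 + (g x)\<^sup>2"
      using sum_squares_bound[of "\<bar>f x\<bar>" "\<bar>g x\<bar>"] by simp
    moreover have "0 \<le> \<bar>f x\<bar> * \<bar>g x\<bar>" by simp
    ultimately show "norm (f x * g x) \<le> norm ((f x)\<^sup>2 + (g x)\<^sup>2)"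
      unfolding real_norm_def abs_mult by linarith
  qed
qed

lemma sq_integrable_add:
  assumes f: "sq_integrable M f" and g: "sq_integrable M g"
  shows "sq_integrable M (\<lambda>x. f x + g x)"
  using assms sq_integrable_mult[OF f g] unfolding sq_integrable_def power2_sum
  by (auto simp: mult.assoc)

lemma sq_integrable_scale:
  "sq_integrable M f \<Longrightarrow> sq_integrable M (\<lambda>x. c * f x)"
  by (auto simp: sq_integrable_def power_mult_distrib)

lemma sq_integrable_sum:
  "(\<And>i. i \<in> I \<Longrightarrow> sq_integrable M (f i)) \<Longrightarrow> sq_integrable M (\<lambda>x. \<Sum>i\<in>I. f i x)"
  by (induction I rule: infinite_finite_induct)
    (auto intro!: sq_integrable_add simp: sq_integrable_def[of _ "\<lambda>_. 0"])

lemma sq_integrable_all_moments: "all_moments M f \<Longrightarrow> sq_integrable M f"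
  unfolding sq_integrable_def all_moments_def
  by (auto dest!: spec[of _ "2 :: nat"])

lemma sq_integrable_integrable:
  assumes "finite_measure M" "sq_integrable M f"
  shows "integrable M f"
  using sq_integrable_mult[OF assms(2) sq_integrable_all_moments[OF all_moments_const[OF assms(1), of 1]]]
  by simp

lemma integral_Cauchy_Schwarz:
  assumes f: "sq_integrable M f" and g: "sq_integrable M g"
  shows "(\<integral>x. f x * g x \<partial>M)\<^sup>2 \<le> (\<integral>x. (f x)\<^sup>2 \<partial>M) * (\<integral>x. (g x)\<^sup>2 \<partial>M)"
proof -
  define a where "a = (\<integral>x. (f x)\<^sup>2 \<partial>M)"
  define b where "b = (\<integral>x. f x * g x \<partial>M)"
  define c where "c = (\<integral>x. (g x)\<^sup>2 \<partial>M)"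
  note int = sq_integrable_mult[OF f g] f[unfolded sq_integrable_def, THEN conjunct2]
    g[unfolded sq_integrable_def, THEN conjunct2]
  have quad: "0 \<le> s\<^sup>2 * a - 2 * s * t * b + t\<^sup>2 * c" for s t
  proof -
    have "0 \<le> (\<integral>x. (s * f x - t * g x)\<^sup>2 \<partial>M)" by simp
    also have "\<dots> = (\<integral>x. s\<^sup>2 * (f x)\<^sup>2 - 2 * s * t * (f x * g x) + t\<^sup>2 * (g x)\<^sup>2 \<partial>M)"
      by (intro Bochner_Integration.integral_cong) (auto simp: power2_eq_square algebra_simps)
    also have "\<dots> = s\<^sup>2 * a - 2 * s * t * b + t\<^sup>2 * c"
      using int by (simp add: a_def b_def c_def)
    finally show ?thesis .
  qed
  have "0 \<le> a" unfolding a_def by simp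
  show ?thesis
  proof (cases "a = 0")
    case True
    have "b = 0"
    proof (rule ccontr)
      \<comment> \<open>The quadratic form at s = (c + 1)/b, t = 1 would be -c - 2.\<close>
      assume "b \<noteq> 0"
      moreover have "0 \<le> c" unfolding c_def by simp
      ultimately show False
        using quad[of "(c + 1) / b" 1] True by simp
    qed
    then show ?thesis by (simp add: a_def[symmetric] b_def[symmetric] True)
  next
    case False
    with \<open>0 \<le> a\<close> have "0 < a" by simp
    have "0 \<le> a * (a * c - b\<^sup>2)"
      using quad[of b a] by (simp add: power2_eq_square algebra_simps)
    with \<open>0 < a\<close> have "b\<^sup>2 \<le> a * c" by (simp add: zero_le_mult_iff)
    then show ?thesis by (simp add: a_def b_def c_def)
  qed
qed

lemma hermite_expansion:
  assumes "degree q \<le> k"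
  shows "q = (\<Sum>j\<le>k. smult (\<integral>t. poly q t * poly (hp j) t \<partial>gauss) (hp j))"
proof -
  have "\<exists>a. q = (\<Sum>j\<le>k. smult (a j) (hp j))"
    using assms
  proof (induction k arbitrary: q)
    case 0
    then obtain c where "q = [:c:]" by (meson degree_eq_zeroE le_zero_eq)
    then show ?case by (intro exI[of _ "\<lambda>_. c"]) simp
  next
    case (Suc k)
    define b where "b = coeff q (Suc k) * sqrt (fact (Suc k))"
    have "degree (q - smult b (hp (Suc k))) \<le> k"
    proof (rule degree_le, safe)
      fix i assume "k < i"
      show "coeff (q - smult b (hp (Suc k))) i = 0"
      proof (cases "i = Suc k")
        case True
        then show ?thesis by (simp add: b_def coeff_hp_top del: hp.simps fact_Suc)
      next
        case False
        then have "Suc k < i" using \<open>k < i\<close> by simp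
        then show ?thesis
          using Suc.prems degree_hp_le[of "Suc k"] by (simp add: coeff_eq_0 del: hp.simps)
      qed
    qed
    from Suc.IH[OF this] obtain a where a: "q - smult b (hp (Suc k)) = (\<Sum>j\<le>k. smult (a j) (hp j))"
      by blast
    have "q = (q - smult b (hp (Suc k))) + smult b (hp (Suc k))" by simp
    also have "\<dots> = (\<Sum>j\<le>Suc k. smult ((a(Suc k := b)) j) (hp j))"
      unfolding a by (simp del: hp.simps)
    finally show ?case by blast
  qed
  then obtain a where a: "q = (\<Sum>j\<le>k. smult (a j) (hp j))" by blast
  have "(\<integral>t. poly q t * poly (hp i) t \<partial>gauss) = a i" if "i \<le> k" for i
  proof -
    have int: "integrable gauss (\<lambda>t. poly (hp j) t * poly (hp i) t)" for j
      using integrable_gauss_poly[of "hp j * hp i"] by (simp add: poly_mult[abs_def])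
    have "(\<integral>t. poly q t * poly (hp i) t \<partial>gauss) = (\<integral>t. (\<Sum>j\<le>k. a j * (poly (hp j) t * poly (hp i) t)) \<partial>gauss)"
      by (subst a) (simp add: poly_sum sum_distrib_right mult.assoc)
    also have "\<dots> = (\<Sum>j\<le>k. a j * (if j = i then 1 else 0))"
      by (subst Bochner_Integration.integral_sum) (auto simp: int gauss_hp_orthonormal)
    also have "\<dots> = (\<Sum>j\<le>k. if j = i then a j else 0)"
      by (intro sum.cong) auto
    finally show ?thesis using that by simp
  qed
  then have "(\<Sum>j\<le>k. smult (\<integral>t. poly q t * poly (hp j) t \<partial>gauss) (hp j)) = (\<Sum>j\<le>k. smult (a j) (hp j))"
    by (intro sum.cong) auto
  then show ?thesis using a by simp
qed

lemma geometric_tail_le: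
  fixes \<eta> :: real
  assumes "0 \<le> \<eta>" "\<eta> \<le> 1 / 2"
  shows "(\<Sum>j\<le>k. if m < j then \<eta> ^ j else 0) \<le> 2 * \<eta> ^ Suc m"
proof -
  \<comment> \<open>The subtracted \<eta>^k makes the induction close: \<eta> \<le> 1/2 gives 2
    \<eta>^(k+1) \<le> \<eta>^k.\<close>
  have "(\<Sum>j\<le>k. if m < j then \<eta> ^ j else 0) \<le> (if k \<le> m then 0 else 2 * \<eta> ^ Suc m - \<eta> ^ k)"
  proof (induction k)
    case (Suc k)
    have "\<eta> ^ Suc k \<le> (1 / 2) * \<eta> ^ k"
      using assms mult_right_mono[of \<eta> "1 / 2" "\<eta> ^ k"] by simp
    then show ?case
      using Suc by (cases k m rule: linorder_cases) auto
  qed simp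
  also have "\<dots> \<le> 2 * \<eta> ^ Suc m" using assms by auto
  finally show ?thesis .
qed

section \<open>Orthogonal decomposition of a likelihood ratio along one direction\<close>

text \<open>Isolates what the low-degree argument uses of the one-sample likelihood ratio.
  \<open>lr_total\<close> says that the response has law \<open>R\<close> under both hypotheses; the
  orthogonality holds for each y separately, so multiplication by powers of y cannot destroy
  it.\<close>

locale planted_direction =
  fixes R :: "real measure" and \<ll> :: "real \<Rightarrow> real \<Rightarrow> real" and A :: real and m :: nat
  assumes R_prob: "prob_space R" and R_borel [measurable_cong]: "sets R = sets borel"
    and R_moments: "all_moments R (\<lambda>y. y)"
    and lr_measurable [measurable]: "(\<lambda>(t, y). \<ll> t y) \<in> borel_measurable (borel \<Otimes>\<^sub>M borel)"
    and lr_nonneg: "0 \<le> \<ll> t y"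
    and lr_square: "integrable gauss (\<lambda>t. (\<ll> t y)\<^sup>2)"
    and lr_square_pair: "integrable (gauss \<Otimes>\<^sub>M R) (\<lambda>(t, y). (\<ll> t y)\<^sup>2)"
    and lr_square_le: "(\<integral>(t, y). (\<ll> t y)\<^sup>2 \<partial>(gauss \<Otimes>\<^sub>M R)) \<le> A"
    and lr_total: "(\<integral>t. \<ll> t y \<partial>gauss) = 1"
    and lr_orthogonal: "1 \<le> j \<Longrightarrow> j \<le> m \<Longrightarrow> (\<integral>t. \<ll> t y * poly (hp j) t \<partial>gauss) = 0"
begin

sublocale R: prob_space R by (rule R_prob)
sublocale gR: pair_prob_space gauss R ..
sublocale null: pair_prob_space "std_gaussian p" R for p ..

definition herm_coeff :: "nat \<Rightarrow> real \<Rightarrow> real" where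
  "herm_coeff j y = (\<integral>t. \<ll> t y * poly (hp j) t \<partial>gauss)"

lemma herm_coeff_0: "herm_coeff 0 y = 1"
  by (simp add: herm_coeff_def lr_total)

lemma herm_coeff_vanish: "1 \<le> j \<Longrightarrow> j \<le> m \<Longrightarrow> herm_coeff j y = 0"
  by (simp add: herm_coeff_def lr_orthogonal del: hp.simps)

lemma herm_coeff_measurable [measurable]: "herm_coeff j \<in> borel_measurable borel"
  unfolding herm_coeff_def by measurable

lemma sq_integrable_lr: "sq_integrable gauss (\<lambda>t. \<ll> t y)"
  using lr_square by (simp add: sq_integrable_def)

lemma sq_integrable_lr_pair: "sq_integrable (gauss \<Otimes>\<^sub>M R) (\<lambda>(t, y). \<ll> t y)"
  using lr_square_pair by (simp add: sq_integrable_def case_prod_unfold)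

lemma sq_integrable_gauss_poly: "sq_integrable gauss (poly q)"
  by (intro sq_integrable_all_moments all_moments_gauss_poly)

lemma herm_coeff_square_le: "(herm_coeff j y)\<^sup>2 \<le> (\<integral>t. (\<ll> t y)\<^sup>2 \<partial>gauss)"
  using integral_Cauchy_Schwarz[OF sq_integrable_lr sq_integrable_gauss_poly, of y "hp j"]
    gauss_hp_orthonormal[of j j]
  by (simp add: herm_coeff_def power2_eq_square del: hp.simps)

lemma lr_square_snd: "integrable R (\<lambda>y. \<integral>t. (\<ll> t y)\<^sup>2 \<partial>gauss)"
  "(\<integral>y. \<integral>t. (\<ll> t y)\<^sup>2 \<partial>gauss \<partial>R) \<le> A"
  using gR.integrable_snd[OF lr_square_pair] gR.integral_snd[OF lr_square_pair] lr_square_le by auto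

lemma sq_integrable_herm_coeff: "sq_integrable R (herm_coeff j)"
  unfolding sq_integrable_def
proof
  show "integrable R (\<lambda>x. (herm_coeff j x)\<^sup>2)"
    by (rule Bochner_Integration.integrable_bound[OF lr_square_snd(1)])
      (use herm_coeff_square_le in \<open>auto intro!: AE_I2\<close>)
qed measurable

lemma integral_herm_coeff_square_le: "(\<integral>y. (herm_coeff j y)\<^sup>2 \<partial>R) \<le> A"
  by (rule order.trans[OF integral_mono lr_square_snd(2)])
    (use sq_integrable_herm_coeff lr_square_snd(1) herm_coeff_square_le in \<open>auto simp: sq_integrable_def\<close>)

abbreviation null_law :: "nat \<Rightarrow> sample measure" where
  "null_law p \<equiv> std_gaussian p \<Otimes>\<^sub>M R"

definition planted_law :: "nat \<Rightarrow> (nat \<Rightarrow> real) \<Rightarrow> sample measure" where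
  "planted_law p v = density (null_law p) (\<lambda>(x, y). ennreal (\<ll> (\<Sum>i<p. v i * x i) y))"

definition monomial :: "nat \<Rightarrow> (nat \<Rightarrow> nat) \<Rightarrow> nat \<Rightarrow> sample \<Rightarrow> real" where
  "monomial p \<beta> b z = (\<Prod>i<p. fst z i ^ \<beta> i) * snd z ^ b"

text \<open>The component of order j in the Hermite expansion of the likelihood ratio in the
  variable v . x, with y held fixed.\<close>

definition ridge :: "nat \<Rightarrow> (nat \<Rightarrow> real) \<Rightarrow> nat \<Rightarrow> sample \<Rightarrow> real" where
  "ridge p v j z = herm_coeff j (snd z) * poly (hp j) (\<Sum>i<p. v i * fst z i)"

lemma monomial_measurable [measurable]: "monomial p \<beta> b \<in> borel_measurable (null_law p)"
  unfolding monomial_def by measurable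

lemma ridge_measurable [measurable]: "ridge p v j \<in> borel_measurable (null_law p)"
  unfolding ridge_def by measurable

lemma all_moments_y: "all_moments R (\<lambda>y. y ^ b)"
  by (intro all_moments_power R_moments R.finite_measure_axioms)

lemma integrable_ty: "integrable (gauss \<Otimes>\<^sub>M R) (\<lambda>(t, y). t ^ a * (y ^ b * \<ll> t y))"
proof -
  have sq: "sq_integrable gauss (\<lambda>t. t ^ a)"
    using sq_integrable_gauss_poly[of "monom 1 a"] by (simp add: poly_monom[abs_def])
  have "integrable (gauss \<Otimes>\<^sub>M R) (\<lambda>(t, y). (t ^ a)\<^sup>2 * (y ^ b)\<^sup>2)"
    using sq sq_integrable_all_moments[OF all_moments_y]
    by (intro integrable_pair_mult prob_space_gauss R_prob) (auto simp: sq_integrable_def)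
  then have "sq_integrable (gauss \<Otimes>\<^sub>M R) (\<lambda>(t, y). t ^ a * y ^ b)"
    by (simp add: sq_integrable_def case_prod_unfold power_mult_distrib)
  from sq_integrable_mult[OF this sq_integrable_lr_pair] show ?thesis
    by (simp add: case_prod_unfold mult.assoc)
qed

lemma integrable_y_herm_coeff: "integrable R (\<lambda>y. y ^ b * herm_coeff j y)"
  by (intro sq_integrable_mult sq_integrable_herm_coeff sq_integrable_all_moments all_moments_y)

lemma integrable_t_hp: "integrable gauss (\<lambda>t. poly q t * poly (hp j) t)"
  using integrable_gauss_poly[of "q * hp j"] by (simp add: poly_mult[abs_def])

text \<open>All integrals reduce to the conditional mean \<open>q\<close> of the X-part. A component
  of order j above the degree of \<open>q\<close> is orthogonal to it; conversely, expanding
  \<open>q\<close> itself up to order k gives the planted mean as a finite sum, so convergence of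
  the Hermite series of the likelihood ratio is not at issue. The power of y only enters through
  moments under \<open>R\<close>.\<close>

lemma monomial_moments:
  assumes unit: "(\<Sum>i<p. (v i)\<^sup>2) = 1"
  shows "integrable (planted_law p v) (monomial p \<beta> b)"
    and "integrable (null_law p) (\<lambda>z. monomial p \<beta> b z * ridge p v j z)"
    and "(\<Sum>i<p. \<beta> i) < j \<Longrightarrow> (\<integral>z. monomial p \<beta> b z * ridge p v j z \<partial>null_law p) = 0"
    and "(\<Sum>i<p. \<beta> i) \<le> k \<Longrightarrow>
      (\<integral>z. monomial p \<beta> b z \<partial>planted_law p v) = (\<Sum>j\<le>k. \<integral>z. monomial p \<beta> b z * ridge p v j z \<partial>null_law p)"
proof -
  obtain q where q: "degree q \<le> (\<Sum>i<p. \<beta> i)"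
    and red: "\<And>G :: real \<Rightarrow> real \<Rightarrow> real. (\<lambda>(t, y). G t y) \<in> borel_measurable (borel \<Otimes>\<^sub>M borel) \<Longrightarrow>
      (\<And>a. integrable (gauss \<Otimes>\<^sub>M R) (\<lambda>(t, y). t ^ a * G t y)) \<Longrightarrow>
      integrable (null_law p) (\<lambda>(x, y). (\<Prod>i<p. x i ^ \<beta> i) * G (\<Sum>i<p. v i * x i) y) \<and>
      (\<integral>(x, y). (\<Prod>i<p. x i ^ \<beta> i) * G (\<Sum>i<p. v i * x i) y \<partial>null_law p) =
        (\<integral>(t, y). poly q t * G t y \<partial>(gauss \<Otimes>\<^sub>M R))"
    by (rule monomial_reduction[OF unit R_prob R_borel, of \<beta>]) blast
  have "integrable (null_law p) (\<lambda>(x, y). (\<Prod>i<p. x i ^ \<beta> i) * (y ^ b * \<ll> (\<Sum>i<p. v i * x i) y)) \<and>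
      (\<integral>(x, y). (\<Prod>i<p. x i ^ \<beta> i) * (y ^ b * \<ll> (\<Sum>i<p. v i * x i) y) \<partial>null_law p) =
        (\<integral>(t, y). poly q t * (y ^ b * \<ll> t y) \<partial>(gauss \<Otimes>\<^sub>M R))"
    by (rule red) (measurable, rule integrable_ty)
  then have int: "integrable (null_law p) (\<lambda>z. \<ll> (\<Sum>i<p. v i * fst z i) (snd z) * monomial p \<beta> b z)" and
    int_eq: "(\<integral>z. \<ll> (\<Sum>i<p. v i * fst z i) (snd z) * monomial p \<beta> b z \<partial>null_law p) =
        (\<integral>(t, y). poly q t * (y ^ b * \<ll> t y) \<partial>(gauss \<Otimes>\<^sub>M R))"
    by (auto simp: monomial_def case_prod_unfold mult_ac)
  show "integrable (planted_law p v) (monomial p \<beta> b)"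
    unfolding planted_law_def case_prod_unfold
    by (subst integrable_density) (use int lr_nonneg in \<open>auto simp: case_prod_unfold\<close>)
  have hc: "integrable (null_law p) (\<lambda>z. monomial p \<beta> b z * ridge p v j z)"
    "(\<integral>z. monomial p \<beta> b z * ridge p v j z \<partial>null_law p) =
      (\<integral>t. poly q t * poly (hp j) t \<partial>gauss) * (\<integral>y. y ^ b * herm_coeff j y \<partial>R)" for j
  proof -
    have I: "integrable (gauss \<Otimes>\<^sub>M R) (\<lambda>(t, y). t ^ a * (y ^ b * (herm_coeff j y * poly (hp j) t)))" for a
    proof -
      have "integrable (gauss \<Otimes>\<^sub>M R) (\<lambda>(t, y). (t ^ a * poly (hp j) t) * (y ^ b * herm_coeff j y))"
        using integrable_t_hp[of "monom 1 a"]
        by (intro integrable_pair_mult prob_space_gauss R_prob integrable_y_herm_coeff) (simp add: poly_monom)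
      then show ?thesis by (simp add: mult_ac)
    qed
    have "integrable (null_law p) (\<lambda>(x, y). (\<Prod>i<p. x i ^ \<beta> i) * (y ^ b * (herm_coeff j y * poly (hp j) (\<Sum>i<p. v i * x i)))) \<and>
      (\<integral>(x, y). (\<Prod>i<p. x i ^ \<beta> i) * (y ^ b * (herm_coeff j y * poly (hp j) (\<Sum>i<p. v i * x i))) \<partial>null_law p) =
        (\<integral>(t, y). poly q t * (y ^ b * (herm_coeff j y * poly (hp j) t)) \<partial>(gauss \<Otimes>\<^sub>M R))"
      by (rule red) (measurable, rule I)
    moreover have "(\<integral>(t, y). poly q t * (y ^ b * (herm_coeff j y * poly (hp j) t)) \<partial>(gauss \<Otimes>\<^sub>M R)) =
      (\<integral>(t, y). (poly q t * poly (hp j) t) * (y ^ b * herm_coeff j y) \<partial>(gauss \<Otimes>\<^sub>M R))"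
      by (simp add: mult_ac)
    moreover have "\<dots> = (\<integral>t. poly q t * poly (hp j) t \<partial>gauss) * (\<integral>y. y ^ b * herm_coeff j y \<partial>R)"
      by (intro integrable_pair_mult(2) prob_space_gauss R_prob integrable_y_herm_coeff integrable_t_hp)
    ultimately show "integrable (null_law p) (\<lambda>z. monomial p \<beta> b z * ridge p v j z)"
      "(\<integral>z. monomial p \<beta> b z * ridge p v j z \<partial>null_law p) =
      (\<integral>t. poly q t * poly (hp j) t \<partial>gauss) * (\<integral>y. y ^ b * herm_coeff j y \<partial>R)"
      by (auto simp: monomial_def ridge_def case_prod_unfold mult.assoc)
  qed
  show "integrable (null_law p) (\<lambda>z. monomial p \<beta> b z * ridge p v j z)" by (rule hc)
  show "(\<integral>z. monomial p \<beta> b z * ridge p v j z \<partial>null_law p) = 0" if "(\<Sum>i<p. \<beta> i) < j"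
    using gauss_hp_top[of q j] q that by (simp add: hc coeff_eq_0 mult.commute)
  show "(\<integral>z. monomial p \<beta> b z \<partial>planted_law p v) = (\<Sum>j\<le>k. \<integral>z. monomial p \<beta> b z * ridge p v j z \<partial>null_law p)"
    if "(\<Sum>i<p. \<beta> i) \<le> k"
  proof -
    define c where "c j = (\<integral>t. poly q t * poly (hp j) t \<partial>gauss)" for j
    have q_exp: "poly q t = (\<Sum>j\<le>k. c j * poly (hp j) t)" for t
      using arg_cong[OF hermite_expansion[of q k], of "\<lambda>q. poly q t"] q that by (simp add: poly_sum c_def)
    have int_pair: "integrable (gauss \<Otimes>\<^sub>M R) (\<lambda>(t, y). poly q t * (y ^ b * \<ll> t y))"
    proof -
      have "integrable (gauss \<Otimes>\<^sub>M R) (\<lambda>z. \<Sum>i\<le>degree q. coeff q i * (\<lambda>(t, y). t ^ i * (y ^ b * \<ll> t y)) z)"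
        by (intro Bochner_Integration.integrable_sum integrable_mult_right integrable_ty)
      then show ?thesis
        by (simp add: case_prod_unfold poly_altdef sum_distrib_right mult.assoc)
    qed
    have int_lh: "integrable gauss (\<lambda>t. \<ll> t y * poly (hp j) t)" for y j
      by (intro sq_integrable_mult sq_integrable_lr sq_integrable_gauss_poly)
    have "(\<integral>z. monomial p \<beta> b z \<partial>planted_law p v) =
       (\<integral>z. \<ll> (\<Sum>i<p. v i * fst z i) (snd z) * monomial p \<beta> b z \<partial>null_law p)"
      unfolding planted_law_def case_prod_unfold
      by (subst integral_density) (use lr_nonneg in \<open>auto simp: case_prod_unfold\<close>)
    also have "\<dots> = (\<integral>y. \<integral>t. poly q t * (y ^ b * \<ll> t y) \<partial>gauss \<partial>R)"
      unfolding int_eq using gR.integral_snd[OF int_pair] by simp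
    also have "\<dots> = (\<integral>y. (\<Sum>j\<le>k. c j * (y ^ b * herm_coeff j y)) \<partial>R)"
    proof (intro Bochner_Integration.integral_cong refl)
      fix y
      have "(\<integral>t. poly q t * (y ^ b * \<ll> t y) \<partial>gauss) = (\<integral>t. (\<Sum>j\<le>k. (c j * y ^ b) * (\<ll> t y * poly (hp j) t)) \<partial>gauss)"
        unfolding q_exp sum_distrib_right by (simp only: mult_ac)
      also have "\<dots> = (\<Sum>j\<le>k. (c j * y ^ b) * herm_coeff j y)"
        by (subst Bochner_Integration.integral_sum) (auto simp: herm_coeff_def int_lh)
      finally show "(\<integral>t. poly q t * (y ^ b * \<ll> t y) \<partial>gauss) = (\<Sum>j\<le>k. c j * (y ^ b * herm_coeff j y))"
        by (simp add: mult.assoc)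
    qed
    also have "\<dots> = (\<Sum>j\<le>k. c j * (\<integral>y. y ^ b * herm_coeff j y \<partial>R))"
      by (subst Bochner_Integration.integral_sum) (auto simp: integrable_y_herm_coeff)
    finally show ?thesis by (simp add: hc c_def)
  qed
qed

lemma ridge_product:
  assumes "(\<Sum>i<p. (v i)\<^sup>2) = 1" "(\<Sum>i<p. (w i)\<^sup>2) = 1"
  shows "integrable (null_law p) (\<lambda>z. ridge p v j z * ridge p w l z)"
    and "(\<integral>z. ridge p v j z * ridge p w l z \<partial>null_law p) =
      (if j = l then (\<integral>y. (herm_coeff j y)\<^sup>2 \<partial>R) * (\<Sum>i<p. v i * w i) ^ j else 0)"
proof -
  have c: "integrable R (\<lambda>y. herm_coeff j y * herm_coeff l y)"
    by (intro sq_integrable_mult sq_integrable_herm_coeff)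
  note H = hermite_projections[OF assms, of j l]
  note I = integrable_pair_mult[OF prob_space_std_gaussian[of p] R_prob H(1) c]
  have eq: "(\<lambda>z. ridge p v j z * ridge p w l z) =
    (\<lambda>(x, y). (poly (hp j) (\<Sum>i<p. v i * x i) * poly (hp l) (\<Sum>i<p. w i * x i)) * (herm_coeff j y * herm_coeff l y))"
    by (auto simp: ridge_def)
  show "integrable (null_law p) (\<lambda>z. ridge p v j z * ridge p w l z)"
    unfolding eq by (rule I)
  show "(\<integral>z. ridge p v j z * ridge p w l z \<partial>null_law p) =
      (if j = l then (\<integral>y. (herm_coeff j y)\<^sup>2 \<partial>R) * (\<Sum>i<p. v i * w i) ^ j else 0)"
    unfolding eq I(2) H(2) by (auto simp: power2_eq_square)
qed

definition ridges :: "nat \<Rightarrow> nat \<Rightarrow> (nat \<Rightarrow> real) \<Rightarrow> (nat \<Rightarrow> nat) \<Rightarrow> (nat \<Rightarrow> sample) \<Rightarrow> real" where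
  "ridges n p v J Z = (\<Prod>s<n. ridge p v (J s) (Z s))"

definition profiles :: "nat \<Rightarrow> nat \<Rightarrow> (nat \<Rightarrow> nat) set" where
  "profiles n k = {J \<in> {..<n} \<rightarrow>\<^sub>E {..k}. (\<Sum>s<n. J s) \<le> k}"

lemma finite_profiles [simp]: "finite (profiles n k)"
  unfolding profiles_def by (rule finite_subset[of _ "{..<n} \<rightarrow>\<^sub>E {..k}"]) (auto intro: finite_PiE)

sublocale nulls: product_prob_space "\<lambda>_ :: nat. null_law p" for p ..

lemma sigma_finite_planted_law:
  assumes "(\<Sum>i<p. (v i)\<^sup>2) = 1"
  shows "sigma_finite_measure (planted_law p v)"
proof -
  \<comment> \<open>The monomial of degree 0 is the constant 1, so its integrability already makes
    the planted law finite.\<close>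
  have "integrable (planted_law p v) (monomial p (\<lambda>_. 0) 0)"
    by (rule monomial_moments(1)[OF assms])
  then have "integrable (planted_law p v) (\<lambda>_. 1 :: real)"
    by (simp add: monomial_def[abs_def])
  then have "finite_measure (planted_law p v)"
    by (intro finite_measureI) (auto simp: integrable_iff_bounded less_top)
  then show ?thesis by (rule finite_measure.axioms)
qed

text \<open>Samples are independent under the null, so the inner product factorizes, and a single
  sample with different orders makes it vanish.\<close>

lemma ridges_product:
  assumes "(\<Sum>i<p. (v i)\<^sup>2) = 1" "(\<Sum>i<p. (w i)\<^sup>2) = 1"
  shows "integrable (samples n (null_law p)) (\<lambda>Z. ridges n p v J Z * ridges n p w K Z)"
    and "(\<integral>Z. ridges n p v J Z * ridges n p w K Z \<partial>samples n (null_law p)) =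
      (if \<forall>s<n. J s = K s then \<Prod>s<n. (\<integral>y. (herm_coeff (J s) y)\<^sup>2 \<partial>R) * (\<Sum>i<p. v i * w i) ^ J s else 0)"
proof -
  have eq: "(\<lambda>Z. ridges n p v J Z * ridges n p w K Z) = (\<lambda>Z. \<Prod>s<n. ridge p v (J s) (Z s) * ridge p w (K s) (Z s))"
    by (simp add: ridges_def prod.distrib)
  show "integrable (samples n (null_law p)) (\<lambda>Z. ridges n p v J Z * ridges n p w K Z)"
    unfolding eq samples_def by (intro nulls.product_integrable_prod ridge_product assms) simp
  have "(\<integral>Z. ridges n p v J Z * ridges n p w K Z \<partial>samples n (null_law p)) =
    (\<Prod>s<n. if J s = K s then (\<integral>y. (herm_coeff (J s) y)\<^sup>2 \<partial>R) * (\<Sum>i<p. v i * w i) ^ J s else 0)"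
    unfolding eq samples_def
    by (subst nulls.product_integral_prod) (auto simp: ridge_product assms intro!: ridge_product(1) assms)
  also have "\<dots> = (if \<forall>s<n. J s = K s then \<Prod>s<n. (\<integral>y. (herm_coeff (J s) y)\<^sup>2 \<partial>R) * (\<Sum>i<p. v i * w i) ^ J s else 0)"
    by auto
  finally show "(\<integral>Z. ridges n p v J Z * ridges n p w K Z \<partial>samples n (null_law p)) = \<dots>" .
qed

lemma ridges_measurable: "ridges n p v J \<in> borel_measurable (samples n (null_law p))"
  unfolding ridges_def samples_def by measurable

lemma sq_integrable_ridges:
  "(\<Sum>i<p. (v i)\<^sup>2) = 1 \<Longrightarrow> sq_integrable (samples n (null_law p)) (ridges n p v J)"
  using ridges_product(1)[where v = v and w = v and J = J and K = J] ridges_measurable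
  by (simp add: sq_integrable_def power2_eq_square)

lemma sample_poly_monomials:
  assumes "sample_poly n p k h"
  obtains a where "\<And>Z. h Z = (\<Sum>\<alpha>\<in>multi_indices n p k.
    a \<alpha> * (\<Prod>s<n. monomial p (\<lambda>i. \<alpha> (s, i)) (\<alpha> (s, p)) (Z s)))"
    and "\<And>\<alpha>. \<alpha> \<in> multi_indices n p k \<Longrightarrow> (\<Sum>s<n. \<Sum>i<p. \<alpha> (s, i)) \<le> k"
proof -
  obtain a where a: "\<And>Z. h Z = (\<Sum>\<alpha>\<in>multi_indices n p k. a \<alpha> * (\<Prod>e\<in>{..<n} \<times> {..p}. entry p Z e ^ \<alpha> e))"
    using assms unfolding sample_poly_def by blast
  have "(\<Prod>e\<in>{..<n} \<times> {..p}. entry p Z e ^ \<alpha> e) = (\<Prod>s<n. monomial p (\<lambda>i. \<alpha> (s, i)) (\<alpha> (s, p)) (Z s))" for Z \<alpha>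
    by (simp add: prod.cartesian_product' monomial_def entry_def lessThan_Suc_atMost[symmetric])
  moreover have "(\<Sum>s<n. \<Sum>i<p. \<alpha> (s, i)) \<le> k" if "\<alpha> \<in> multi_indices n p k" for \<alpha>
  proof -
    have "(\<Sum>s<n. \<Sum>i<p. \<alpha> (s, i)) \<le> (\<Sum>s<n. \<Sum>i\<le>p. \<alpha> (s, i))"
      by (intro sum_mono sum_mono2) auto
    also have "\<dots> = (\<Sum>e\<in>{..<n} \<times> {..p}. \<alpha> e)"
      by (simp add: sum.cartesian_product')
    finally show ?thesis using that by (simp add: multi_indices_def)
  qed
  ultimately show ?thesis by (intro that[of a]) (simp_all only: a)
qed

lemma all_moments_monomial: "all_moments (null_law p) (monomial p \<beta> b)"
proof -
  have fin: "finite_measure (null_law p)"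
    by (rule null.finite_measure_axioms)
  have 1: "all_moments (null_law p) (\<lambda>z. snd z)"
    unfolding all_moments_def
  proof safe
    show "integrable (null_law p) (\<lambda>z. \<bar>snd z\<bar> ^ a)" for a
      using integrable_pair_mult(1)[OF prob_space_std_gaussian[of p] R_prob, of "\<lambda>_. 1" "\<lambda>y. \<bar>y\<bar> ^ a"] R_moments
      by (simp add: all_moments_def case_prod_unfold)
  qed measurable
  have 2: "all_moments (null_law p) (\<lambda>z. fst z i)" if "i < p" for i
    unfolding all_moments_def
  proof safe
    show "integrable (null_law p) (\<lambda>z. \<bar>fst z i\<bar> ^ a)" for a
      using integrable_pair_mult(1)[OF prob_space_std_gaussian[of p] R_prob, of "\<lambda>x. \<bar>x i\<bar> ^ a" "\<lambda>_. 1"]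
        all_moments_component[OF that]
      by (simp add: all_moments_def case_prod_unfold)
    show "(\<lambda>z. fst z i) \<in> borel_measurable (null_law p)"
      using all_moments_measurable[OF all_moments_component[OF that]]
      by (rule measurable_compose[OF measurable_fst])
  qed
  have "all_moments (null_law p) (\<lambda>z. \<Prod>i<p. fst z i ^ \<beta> i)"
    by (rule all_moments_prod[OF fin], rule all_moments_power[OF fin], rule 2) simp
  then show ?thesis
    unfolding monomial_def[abs_def] by (rule all_moments_mult[OF _ all_moments_power[OF fin 1]])
qed

lemma all_moments_sample_poly:
  assumes "sample_poly n p k h"
  shows "all_moments (samples n (null_law p)) h"
proof -
  interpret S: prob_space "samples n (null_law p)"
    unfolding samples_def by (intro prob_space_PiM null.prob_space_axioms)
  obtain a where h: "\<And>Z. h Z = (\<Sum>\<alpha>\<in>multi_indices n p k.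
    a \<alpha> * (\<Prod>s<n. monomial p (\<lambda>i. \<alpha> (s, i)) (\<alpha> (s, p)) (Z s)))"
    using sample_poly_monomials[OF assms] by blast
  have "all_moments (samples n (null_law p)) (\<lambda>Z. monomial p \<beta> b (Z s))" if "s < n" for s \<beta> b
  proof (rule all_moments_distr[where N = "null_law p" and f = "monomial p \<beta> b"])
    show "(\<lambda>Z. Z s) \<in> samples n (null_law p) \<rightarrow>\<^sub>M null_law p"
      unfolding samples_def by (rule measurable_component_singleton) (simp add: that)
    have "distr (samples n (null_law p)) (null_law p) (\<lambda>Z. Z s) = null_law p"
      unfolding samples_def
      by (rule distr_PiM_component) (simp_all add: that null.prob_space_axioms)
    then show "all_moments (distr (samples n (null_law p)) (null_law p) (\<lambda>Z. Z s)) (monomial p \<beta> b)"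
      by (simp add: all_moments_monomial)
  qed
  then show ?thesis
    unfolding h[abs_def]
    by (intro all_moments_sum all_moments_mult all_moments_prod all_moments_const S.finite_measure_axioms) auto
qed

text \<open>
  A monomial of degree \<open>d\<close> in \<open>X\<close> is orthogonal to all Hermite components of order above \<open>d\<close>, so
  for a polynomial of total degree \<open>k\<close> only profiles of total order at most \<open>k\<close> survive.
\<close>

lemma mean_planted:
  assumes unit: "(\<Sum>i<p. (v i)\<^sup>2) = 1" and h: "sample_poly n p k h"
  shows "mean (samples n (planted_law p v)) h =
    (\<Sum>J\<in>profiles n k. \<integral>Z. h Z * ridges n p v J Z \<partial>samples n (null_law p))"
proof -
  interpret planted: product_sigma_finite "\<lambda>_ :: nat. planted_law p v"
    by (intro product_sigma_finite.intro sigma_finite_planted_law unit)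
  obtain a where h: "\<And>Z. h Z = (\<Sum>\<alpha>\<in>multi_indices n p k.
    a \<alpha> * (\<Prod>s<n. monomial p (\<lambda>i. \<alpha> (s, i)) (\<alpha> (s, p)) (Z s)))"
    and deg: "\<And>\<alpha>. \<alpha> \<in> multi_indices n p k \<Longrightarrow> (\<Sum>s<n. \<Sum>i<p. \<alpha> (s, i)) \<le> k"
    using sample_poly_monomials[OF h] by blast
  define M where "M \<alpha> s = monomial p (\<lambda>i. \<alpha> (s, i)) (\<alpha> (s, p))" for \<alpha> :: "nat \<times> nat \<Rightarrow> nat" and s
  define E where "E \<alpha> s j = (\<integral>z. M \<alpha> s z * ridge p v j z \<partial>null_law p)" for \<alpha> s j
  have int_prod: "integrable (samples n (planted_law p v)) (\<lambda>Z. \<Prod>s<n. M \<alpha> s (Z s))" for \<alpha>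
    unfolding samples_def M_def by (intro planted.product_integrable_prod monomial_moments unit) simp
  have int_ridge: "integrable (samples n (null_law p)) (\<lambda>Z. (\<Prod>s<n. M \<alpha> s (Z s)) * ridges n p v J Z)"
    and int_ridge_eq: "(\<integral>Z. (\<Prod>s<n. M \<alpha> s (Z s)) * ridges n p v J Z \<partial>samples n (null_law p)) = (\<Prod>s<n. E \<alpha> s (J s))" for \<alpha> J
    unfolding samples_def M_def E_def ridges_def prod.distrib[symmetric]
    by (auto intro!: nulls.product_integrable_prod nulls.product_integral_prod monomial_moments(2) unit)
  have "mean (samples n (planted_law p v)) h = (\<Sum>\<alpha>\<in>multi_indices n p k. a \<alpha> * (\<integral>Z. (\<Prod>s<n. M \<alpha> s (Z s)) \<partial>samples n (planted_law p v)))"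
    unfolding mean_def h M_def[symmetric]
    by (subst Bochner_Integration.integral_sum) (auto simp: int_prod)
  also have "\<dots> = (\<Sum>\<alpha>\<in>multi_indices n p k. a \<alpha> * (\<Sum>J\<in>profiles n k. \<Prod>s<n. E \<alpha> s (J s)))"
  proof (rule sum.cong[OF refl], rule arg_cong[where f = "(*) _"])
    fix \<alpha> assume \<alpha>: "\<alpha> \<in> multi_indices n p k"
    have deg_s: "(\<Sum>i<p. \<alpha> (s, i)) \<le> k" if "s < n" for s
      using deg[OF \<alpha>] member_le_sum[of s "{..<n}" "\<lambda>s. \<Sum>i<p. \<alpha> (s, i)"] that by simp
    have "(\<integral>Z. (\<Prod>s<n. M \<alpha> s (Z s)) \<partial>samples n (planted_law p v)) = (\<Prod>s<n. \<integral>z. M \<alpha> s z \<partial>planted_law p v)"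
      unfolding samples_def M_def by (intro planted.product_integral_prod monomial_moments unit) simp
    also have "\<dots> = (\<Prod>s<n. \<Sum>j\<le>k. E \<alpha> s j)"
      unfolding M_def E_def by (intro prod.cong refl monomial_moments(4) unit deg_s) simp
    also have "\<dots> = (\<Sum>J\<in>{..<n} \<rightarrow>\<^sub>E {..k}. \<Prod>s<n. E \<alpha> s (J s))"
      by (rule prod_sum_PiE) auto
    also have "\<dots> = (\<Sum>J\<in>profiles n k. \<Prod>s<n. E \<alpha> s (J s))"
    \<comment> \<open>If the orders sum to more than k, while the X-degrees sum to at most k, then
      some sample has order above its X-degree, and its factor is 0.\<close>
    proof (rule sum.mono_neutral_right)
      show "\<forall>J\<in>({..<n} \<rightarrow>\<^sub>E {..k}) - profiles n k. (\<Prod>s<n. E \<alpha> s (J s)) = 0"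
      proof
        fix J assume J: "J \<in> ({..<n} \<rightarrow>\<^sub>E {..k}) - profiles n k"
        have "\<exists>s<n. (\<Sum>i<p. \<alpha> (s, i)) < J s"
        proof (rule ccontr)
          assume "\<not> ?thesis"
          then have "(\<Sum>s<n. J s) \<le> (\<Sum>s<n. \<Sum>i<p. \<alpha> (s, i))"
            by (intro sum_mono) (meson lessThan_iff not_less)
          then show False using J deg[OF \<alpha>] by (auto simp: profiles_def)
        qed
        then obtain s where s: "s < n" "(\<Sum>i<p. \<alpha> (s, i)) < J s" by blast
        then have "E \<alpha> s (J s) = 0"
          unfolding E_def M_def by (intro monomial_moments(3) unit)
        then show "(\<Prod>s<n. E \<alpha> s (J s)) = 0"
          using s(1) by (intro prod_zero) auto
      qed
    qed (auto simp: profiles_def intro: finite_PiE)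
    finally show "(\<integral>Z. (\<Prod>s<n. M \<alpha> s (Z s)) \<partial>samples n (planted_law p v)) = \<dots>" .
  qed
  also have "\<dots> = (\<Sum>J\<in>profiles n k. \<Sum>\<alpha>\<in>multi_indices n p k. a \<alpha> * (\<Prod>s<n. E \<alpha> s (J s)))"
    unfolding sum_distrib_left by (rule sum.swap)
  also have "\<dots> = (\<Sum>J\<in>profiles n k. \<integral>Z. h Z * ridges n p v J Z \<partial>samples n (null_law p))"
  proof (rule sum.cong[OF refl])
    fix J
    have "(\<integral>Z. h Z * ridges n p v J Z \<partial>samples n (null_law p)) =
      (\<integral>Z. (\<Sum>\<alpha>\<in>multi_indices n p k. a \<alpha> * ((\<Prod>s<n. M \<alpha> s (Z s)) * ridges n p v J Z)) \<partial>samples n (null_law p))"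
      unfolding h M_def[symmetric] by (simp add: sum_distrib_right mult.assoc)
    also have "\<dots> = (\<Sum>\<alpha>\<in>multi_indices n p k. a \<alpha> * (\<Prod>s<n. E \<alpha> s (J s)))"
      by (subst Bochner_Integration.integral_sum) (auto simp: int_ridge int_ridge_eq)
    finally show "(\<Sum>\<alpha>\<in>multi_indices n p k. a \<alpha> * (\<Prod>s<n. E \<alpha> s (J s))) =
      (\<integral>Z. h Z * ridges n p v J Z \<partial>samples n (null_law p))" ..
  qed
  finally show ?thesis .
qed


text \<open>For uniform v in \<open>V\<close> the gap of the means is the inner product of h - \<mu>
  with \<open>W\<close>, so by Cauchy-Schwarz it is below the standard deviation once
  \<open>W\<close> has norm below 1. The set \<open>V\<close> enters the norm only through the
  moments in \<open>corr\<close>.\<close>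

theorem low_degree_bound:
  assumes V: "finite V" "V \<noteq> {}" and unit: "\<And>v. v \<in> V \<Longrightarrow> (\<Sum>i<p. (v i)\<^sup>2) = 1"
    and h: "sample_poly n p k h" and var: "var (samples n (null_law p)) h > 0"
    and \<eta>: "0 \<le> \<eta>" "\<eta> \<le> 1 / 2"
    and corr: "\<And>d. 1 \<le> d \<Longrightarrow> d \<le> k \<Longrightarrow>
      (\<Sum>v\<in>V. \<Sum>w\<in>V. \<bar>\<Sum>i<p. v i * w i\<bar> ^ d) \<le> (real (card V))\<^sup>2 * \<eta> ^ d"
    and n: "4 * real n * A * \<eta> ^ Suc m \<le> 1"
  shows "\<bar>mean (samples n (null_law p)) h - (\<Sum>v\<in>V. mean (samples n (planted_law p v)) h) / card V\<bar>
    < sqrt (var (samples n (null_law p)) h)"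
proof -
  let ?\<Omega> = "samples n (null_law p)"
  interpret S: prob_space ?\<Omega>
    unfolding samples_def by (intro prob_space_PiM null.prob_space_axioms)
  define z :: "nat \<Rightarrow> nat" where "z = (\<lambda>s\<in>{..<n}. 0)"
  define P where "P = profiles n k - {z}"
  define N where "N = real (card V)"
  have N: "N > 0" using V by (simp add: N_def card_gt_0_iff)
  have z: "z \<in> profiles n k" by (auto simp: z_def profiles_def)
  have finP: "finite P" by (simp add: P_def)
  have P_PiE: "J \<in> {..<n} \<rightarrow>\<^sub>E {..k}" if "J \<in> P" for J using that by (simp add: P_def profiles_def)
  have PiE_neq: "\<exists>s<n. J s \<noteq> K s" if "J \<in> {..<n} \<rightarrow>\<^sub>E {..k}" "K \<in> {..<n} \<rightarrow>\<^sub>E {..k}" "J \<noteq> K" for J K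
    using that by (metis PiE_ext lessThan_iff)
  have z_PiE: "z \<in> {..<n} \<rightarrow>\<^sub>E {..k}" using z by (simp add: profiles_def)
  have ridges_z: "ridges n p v z Z = 1" for v Z
    by (simp add: ridges_def ridge_def z_def herm_coeff_0)
  have h_sq: "sq_integrable ?\<Omega> h"
    by (rule sq_integrable_all_moments[OF all_moments_sample_poly[OF h]])
  have h_int: "integrable ?\<Omega> h"
    by (rule all_moments_integrable[OF all_moments_sample_poly[OF h]])
  define \<mu> where "\<mu> = mean ?\<Omega> h"
  \<comment> \<open>The average over \<open>V\<close> of the retained components. Removing the zero
    profile \<open>z\<close>, whose component is the constant 1, makes \<open>W\<close>
    centred.\<close>
  define W where "W Z = (\<Sum>J\<in>P. \<Sum>v\<in>V. (1 / N) * ridges n p v J Z)" for Z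
  have W_sq: "sq_integrable ?\<Omega> W"
    unfolding W_def by (intro sq_integrable_sum sq_integrable_scale sq_integrable_ridges unit)
  have W_int: "integrable ?\<Omega> W"
    by (rule sq_integrable_integrable[OF S.finite_measure_axioms W_sq])
  have hr_int: "integrable ?\<Omega> (\<lambda>Z. h Z * ridges n p v J Z)" if "v \<in> V" for v J
    by (intro sq_integrable_mult h_sq sq_integrable_ridges unit that)
  have W_mean: "(\<integral>Z. W Z \<partial>?\<Omega>) = 0"
  proof -
    have "(\<integral>Z. ridges n p v J Z \<partial>?\<Omega>) = 0" if "v \<in> V" "J \<in> P" for v J
    proof -
      have "\<exists>s<n. J s \<noteq> z s"
        using that z_PiE P_PiE by (intro PiE_neq) (auto simp: P_def)
      then show ?thesis
        using ridges_product(2)[OF unit unit, of v v n J z] that by (auto simp: ridges_z)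
    qed
    moreover have "integrable ?\<Omega> (ridges n p v J)" if "v \<in> V" for v J
      by (intro sq_integrable_integrable sq_integrable_ridges unit S.finite_measure_axioms that)
    ultimately show ?thesis
      unfolding W_def by (subst Bochner_Integration.integral_sum Bochner_Integration.integral_sum; simp)+
  qed
  have diff: "(\<Sum>v\<in>V. mean (samples n (planted_law p v)) h) / card V - \<mu> = (\<integral>Z. (h Z - \<mu>) * W Z \<partial>?\<Omega>)"
  proof -
    have "(\<Sum>v\<in>V. mean (samples n (planted_law p v)) h) =
      (\<Sum>v\<in>V. \<mu> + (\<Sum>J\<in>P. \<integral>Z. h Z * ridges n p v J Z \<partial>?\<Omega>))"
    proof (rule sum.cong[OF refl])
      fix v assume v: "v \<in> V"
      have "(\<Sum>J\<in>profiles n k. \<integral>Z. h Z * ridges n p v J Z \<partial>?\<Omega>) =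
        (\<integral>Z. h Z * ridges n p v z Z \<partial>?\<Omega>) + (\<Sum>J\<in>P. \<integral>Z. h Z * ridges n p v J Z \<partial>?\<Omega>)"
        unfolding P_def by (rule sum.remove) (auto simp: z)
      then show "mean (samples n (planted_law p v)) h = \<mu> + (\<Sum>J\<in>P. \<integral>Z. h Z * ridges n p v J Z \<partial>?\<Omega>)"
        unfolding mean_planted[OF unit[OF v] h] by (simp add: ridges_z \<mu>_def mean_def)
    qed
    also have "\<dots> = N * \<mu> + (\<Sum>v\<in>V. \<Sum>J\<in>P. \<integral>Z. h Z * ridges n p v J Z \<partial>?\<Omega>)"
      by (simp add: sum.distrib N_def)
    also have "(\<Sum>v\<in>V. \<Sum>J\<in>P. \<integral>Z. h Z * ridges n p v J Z \<partial>?\<Omega>) = N * (\<integral>Z. h Z * W Z \<partial>?\<Omega>)"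
    proof -
      have "(\<integral>Z. h Z * W Z \<partial>?\<Omega>) = (\<integral>Z. (\<Sum>J\<in>P. \<Sum>v\<in>V. (1 / N) * (h Z * ridges n p v J Z)) \<partial>?\<Omega>)"
        by (simp add: W_def sum_distrib_left mult_ac)
      also have "\<dots> = (\<Sum>J\<in>P. \<Sum>v\<in>V. (1 / N) * (\<integral>Z. h Z * ridges n p v J Z \<partial>?\<Omega>))"
        by (subst Bochner_Integration.integral_sum, (simp add: hr_int),
            rule sum.cong[OF refl], subst Bochner_Integration.integral_sum, (simp add: hr_int),
            simp only: integral_mult_right_zero)
      also have "\<dots> = (1 / N) * (\<Sum>v\<in>V. \<Sum>J\<in>P. \<integral>Z. h Z * ridges n p v J Z \<partial>?\<Omega>)"
        by (simp only: sum_distrib_left) (rule sum.swap)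
      finally show ?thesis using N by simp
    qed
    finally have "(\<Sum>v\<in>V. mean (samples n (planted_law p v)) h) / card V = \<mu> + (\<integral>Z. h Z * W Z \<partial>?\<Omega>)"
      using N by (simp add: N_def[symmetric] field_simps)
    moreover have "(\<integral>Z. (h Z - \<mu>) * W Z \<partial>?\<Omega>) = (\<integral>Z. h Z * W Z - \<mu> * W Z \<partial>?\<Omega>)"
      by (simp add: algebra_simps)
    moreover have "\<dots> = (\<integral>Z. h Z * W Z \<partial>?\<Omega>)"
      using sq_integrable_mult[OF h_sq W_sq] W_int W_mean by simp
    ultimately show ?thesis by simp
  qed
  define a where "a j = (\<integral>y. (herm_coeff j y)\<^sup>2 \<partial>R)" for j
  \<comment> \<open>A common majorant of the squared coefficients \<open>a j\<close>: exact at order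
    0, zero on the matched orders, and the second moment bound beyond.\<close>
  define b where "b j = (if j = 0 then 1 else if j \<le> m then 0 else A)" for j
  have a_nonneg: "0 \<le> a j" for j by (simp add: a_def)
  have a0: "a 0 = 1" by (simp add: a_def herm_coeff_0 R.prob_space)
  have a_le: "a j \<le> b j" for j
    using integral_herm_coeff_square_le[of j] a0 unfolding b_def a_def
    by (auto simp: herm_coeff_vanish)
  have A1: "1 \<le> A" using integral_herm_coeff_square_le[of 0] a0 by (simp add: a_def)
  have b_nonneg: "0 \<le> b j" for j using A1 by (simp add: b_def)
  have W2: "(\<integral>Z. (W Z)\<^sup>2 \<partial>?\<Omega>) < 1"
  proof -
    have "(\<integral>Z. (W Z)\<^sup>2 \<partial>?\<Omega>) = (\<integral>Z. (\<Sum>J\<in>P. \<Sum>v\<in>V. \<Sum>K\<in>P. \<Sum>w\<in>V.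
       (1 / N\<^sup>2) * (ridges n p v J Z * ridges n p w K Z)) \<partial>?\<Omega>)"
    proof (rule Bochner_Integration.integral_cong[OF refl])
      fix Z
      have "(W Z)\<^sup>2 = (\<Sum>J\<in>P. \<Sum>v\<in>V. (1 / N) * ridges n p v J Z) * W Z"
        by (simp add: W_def power2_eq_square)
      also have "\<dots> = (\<Sum>J\<in>P. \<Sum>v\<in>V. \<Sum>K\<in>P. \<Sum>w\<in>V.
         ((1 / N) * ridges n p v J Z) * ((1 / N) * ridges n p w K Z))"
        by (simp only: sum_distrib_right) (simp only: W_def sum_distrib_left)
      finally show "(W Z)\<^sup>2 = (\<Sum>J\<in>P. \<Sum>v\<in>V. \<Sum>K\<in>P. \<Sum>w\<in>V.
         (1 / N\<^sup>2) * (ridges n p v J Z * ridges n p w K Z))"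
        by (simp add: power2_eq_square mult_ac)
    qed
    also have "\<dots> = (\<Sum>J\<in>P. \<Sum>v\<in>V. \<Sum>K\<in>P. \<Sum>w\<in>V.
       (1 / N\<^sup>2) * (\<integral>Z. ridges n p v J Z * ridges n p w K Z \<partial>?\<Omega>))"
      by (intro trans[OF Bochner_Integration.integral_sum] sum.cong refl Bochner_Integration.integrable_sum
          integrable_mult_right ridges_product unit integral_mult_right_zero)
    also have "\<dots> = (\<Sum>J\<in>P. \<Sum>v\<in>V. \<Sum>K\<in>P. \<Sum>w\<in>V.
       if K = J then (1 / N\<^sup>2) * (\<Prod>s<n. a (J s) * (\<Sum>i<p. v i * w i) ^ J s) else 0)"
    proof (intro sum.cong refl)
      fix J v K w assume "J \<in> P" "v \<in> V" "K \<in> P" "w \<in> V"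
      then show "(1 / N\<^sup>2) * (\<integral>Z. ridges n p v J Z * ridges n p w K Z \<partial>?\<Omega>) =
        (if K = J then (1 / N\<^sup>2) * (\<Prod>s<n. a (J s) * (\<Sum>i<p. v i * w i) ^ J s) else 0)"
        using PiE_neq[OF P_PiE P_PiE, of J K]
        by (auto simp: ridges_product(2)[OF unit unit] a_def)
    qed
    also have "\<dots> = (\<Sum>J\<in>P. \<Sum>v\<in>V. \<Sum>w\<in>V. (1 / N\<^sup>2) * (\<Prod>s<n. a (J s) * (\<Sum>i<p. v i * w i) ^ J s))"
    proof (intro sum.cong refl)
      fix J v assume "J \<in> P"
      show "(\<Sum>K\<in>P. \<Sum>w\<in>V. if K = J then (1 / N\<^sup>2) * (\<Prod>s<n. a (J s) * (\<Sum>i<p. v i * w i) ^ J s) else 0) =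
        (\<Sum>w\<in>V. (1 / N\<^sup>2) * (\<Prod>s<n. a (J s) * (\<Sum>i<p. v i * w i) ^ J s))"
        by (subst sum.swap) (simp add: sum.delta finP \<open>J \<in> P\<close>)
    qed
    also have "\<dots> \<le> (\<Sum>J\<in>P. \<Prod>s<n. b (J s) * \<eta> ^ J s)"
    proof (rule sum_mono)
      fix J assume J: "J \<in> P"
      define d where "d = (\<Sum>s<n. J s)"
      have "\<exists>s<n. J s \<noteq> z s" using J by (intro PiE_neq P_PiE z_PiE) (auto simp: P_def)
      then obtain s where s: "s < n" "J s \<noteq> 0" by (auto simp: z_def)
      have "J s \<le> d" unfolding d_def using s by (intro member_le_sum) auto
      then have d: "1 \<le> d" "d \<le> k" using s J by (auto simp: d_def P_def profiles_def)
      \<comment> \<open>The same pair v, w occurs in all samples, so its powers combine to the total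
        order d, and only the d-th moment of v . w matters.\<close>
      have "(\<Sum>v\<in>V. \<Sum>w\<in>V. (1 / N\<^sup>2) * (\<Prod>s<n. a (J s) * (\<Sum>i<p. v i * w i) ^ J s)) =
        (\<Prod>s<n. a (J s)) * ((1 / N\<^sup>2) * (\<Sum>v\<in>V. \<Sum>w\<in>V. (\<Sum>i<p. v i * w i) ^ d))"
        by (simp add: prod.distrib power_sum d_def sum_distrib_left mult_ac)
      also have "\<dots> \<le> (\<Prod>s<n. a (J s)) * ((1 / N\<^sup>2) * (N\<^sup>2 * \<eta> ^ d))"
      proof (intro mult_left_mono prod_nonneg)
        have "(\<Sum>v\<in>V. \<Sum>w\<in>V. (\<Sum>i<p. v i * w i) ^ d) \<le> (\<Sum>v\<in>V. \<Sum>w\<in>V. \<bar>\<Sum>i<p. v i * w i\<bar> ^ d)"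
          by (intro sum_mono) (metis abs_ge_self power_abs)
        also have "\<dots> \<le> N\<^sup>2 * \<eta> ^ d" using corr[OF d] by (simp add: N_def)
        finally show "(\<Sum>v\<in>V. \<Sum>w\<in>V. (\<Sum>i<p. v i * w i) ^ d) \<le> N\<^sup>2 * \<eta> ^ d" .
      qed (auto simp: a_nonneg)
      also have "\<dots> = (\<Prod>s<n. a (J s)) * \<eta> ^ d" using N by simp
      also have "\<dots> \<le> (\<Prod>s<n. b (J s)) * \<eta> ^ d"
        using \<eta> by (intro mult_right_mono prod_mono) (auto simp: a_nonneg a_le)
      also have "\<dots> = (\<Prod>s<n. b (J s) * \<eta> ^ J s)"
        by (simp add: prod.distrib power_sum d_def)
      finally show "(\<Sum>v\<in>V. \<Sum>w\<in>V. (1 / N\<^sup>2) * (\<Prod>s<n. a (J s) * (\<Sum>i<p. v i * w i) ^ J s)) \<le> \<dots>" .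
    qed
    \<comment> \<open>The bound on total order has served its purpose, namely d \<le> k for the
      moment bound. Enlarging to all profiles with entries at most k, which adds nonnegative terms,
      lets the sum factorize over the samples.\<close>
    also have "\<dots> \<le> (\<Sum>J\<in>({..<n} \<rightarrow>\<^sub>E {..k}) - {z}. \<Prod>s<n. b (J s) * \<eta> ^ J s)"
      using \<eta> b_nonneg by (intro sum_mono2 prod_nonneg) (auto simp: P_def profiles_def intro!: finite_PiE)
    also have "\<dots> = (\<Sum>J\<in>{..<n} \<rightarrow>\<^sub>E {..k}. \<Prod>s<n. b (J s) * \<eta> ^ J s) - (\<Prod>s<n. b (z s) * \<eta> ^ z s)"
      using sum.remove[of "{..<n} \<rightarrow>\<^sub>E {..k}" z "\<lambda>J. \<Prod>s<n. b (J s) * \<eta> ^ J s"] z_PiE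
      by (simp add: finite_PiE)
    also have "(\<Sum>J\<in>{..<n} \<rightarrow>\<^sub>E {..k}. \<Prod>s<n. b (J s) * \<eta> ^ J s) = (\<Prod>s<n. \<Sum>j\<le>k. b j * \<eta> ^ j)"
      by (rule prod_sum_PiE[symmetric]) auto
    also have "(\<Prod>s<n. b (z s) * \<eta> ^ z s) = 1" by (simp add: z_def b_def)
    also have "(\<Prod>s<n. \<Sum>j\<le>k. b j * \<eta> ^ j) = (\<Sum>j\<le>k. b j * \<eta> ^ j) ^ n" by simp
    also have "(\<Sum>j\<le>k. b j * \<eta> ^ j) ^ n \<le> exp (real n * (2 * A * \<eta> ^ Suc m))"
    proof -
      have "(\<Sum>j\<le>k. b j * \<eta> ^ j) \<le> (\<Sum>j\<le>k. (if j = 0 then 1 else 0) + A * (if m < j then \<eta> ^ j else 0))"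
        using A1 by (intro sum_mono) (auto simp: b_def)
      also have "\<dots> = 1 + A * (\<Sum>j\<le>k. if m < j then \<eta> ^ j else 0)"
        by (simp add: sum.distrib sum_distrib_left)
      also have "\<dots> \<le> 1 + A * (2 * \<eta> ^ Suc m)"
        using A1 by (intro add_left_mono mult_left_mono geometric_tail_le \<eta>) auto
      also have "\<dots> \<le> exp (2 * A * \<eta> ^ Suc m)"
        using exp_ge_add_one_self[of "2 * A * \<eta> ^ Suc m"] by (simp add: mult_ac)
      finally have "(\<Sum>j\<le>k. b j * \<eta> ^ j) ^ n \<le> exp (2 * A * \<eta> ^ Suc m) ^ n"
        using \<eta> b_nonneg by (intro power_mono sum_nonneg) auto
      then show ?thesis by (simp add: exp_of_nat_mult)
    qed
    \<comment> \<open>The hypothesis on n makes the exponent at most 1/2; e \<le> 3 < 4 then gives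
      exp(1/2) - 1 < 1.\<close>
    also have "exp (real n * (2 * A * \<eta> ^ Suc m)) \<le> exp (1 / 2)"
      using n by (simp add: mult_ac)
    also have "exp (1 / 2 :: real) - 1 < 1"
    proof -
      have "exp (1 / 2 :: real) ^ 2 \<le> 3" using exp_le by (simp flip: exp_double)
      also have "3 < (2 :: real) ^ 2" by simp
      finally show ?thesis using power_less_imp_less_base[of "exp (1 / 2 :: real)" 2 2] by simp
    qed
    finally show ?thesis by simp
  qed
  have hm_sq: "sq_integrable ?\<Omega> (\<lambda>Z. h Z - \<mu>)"
    using sq_integrable_add[OF h_sq sq_integrable_all_moments[OF all_moments_const[OF S.finite_measure_axioms, of "- \<mu>"]]]
    by simp
  have "(\<integral>Z. (h Z - \<mu>) * W Z \<partial>?\<Omega>)\<^sup>2 \<le> var ?\<Omega> h * (\<integral>Z. (W Z)\<^sup>2 \<partial>?\<Omega>)"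
    using integral_Cauchy_Schwarz[OF hm_sq W_sq] by (simp add: var_def mean_def \<mu>_def)
  also have "\<dots> < var ?\<Omega> h * 1"
    using var W2 by (intro mult_strict_left_mono)
  finally have "\<bar>\<integral>Z. (h Z - \<mu>) * W Z \<partial>?\<Omega>\<bar> < sqrt (var ?\<Omega> h)"
    by (intro real_less_rsqrt) simp
  moreover have "\<bar>\<mu> - (\<Sum>v\<in>V. mean (samples n (planted_law p v)) h) / card V\<bar> =
      \<bar>\<integral>Z. (h Z - \<mu>) * W Z \<partial>?\<Omega>\<bar>"
    unfolding diff[symmetric] by (rule abs_minus_commute)
  ultimately show ?thesis unfolding \<mu>_def by (simp only:)
qed

end

context planted_direction
begin

text \<open>Needed to integrate over the prior on the sphere. The planted mean is a finite sum of
  integrals over the fixed null law, in which v is only a parameter of the integrand.\<close>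

lemma mean_planted_measurable:
  assumes h: "sample_poly n p k h"
  shows "(\<lambda>v. mean (samples n (planted_law p v)) h) \<in>
    borel_measurable (restrict_space (\<Pi>\<^sub>M i\<in>{..<p}. borel) (unit_sphere p))"
proof -
  let ?S = "restrict_space (\<Pi>\<^sub>M i\<in>{..<p}. (borel :: real measure)) (unit_sphere p)"
  let ?\<Omega> = "samples n (null_law p)"
  interpret S: prob_space ?\<Omega>
    unfolding samples_def by (intro prob_space_PiM null.prob_space_axioms)
  have h_meas [measurable]: "h \<in> borel_measurable ?\<Omega>"
    using all_moments_sample_poly[OF h] by (rule all_moments_measurable)
  have v_i [measurable]: "(\<lambda>v. v i) \<in> borel_measurable ?S" if "i < p" for i
    by (intro measurable_restrict_space1 measurable_component_singleton) (simp add: that)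
  have Z_s [measurable]: "(\<lambda>Z. Z s) \<in> ?\<Omega> \<rightarrow>\<^sub>M null_law p" if "s < n" for s
    unfolding samples_def by (intro measurable_component_singleton) (simp add: that)
  have x_i [measurable]: "(\<lambda>z. fst z i) \<in> borel_measurable (null_law p)" if "i < p" for i
    by (intro measurable_compose[OF measurable_fst all_moments_measurable[OF all_moments_component[OF that]]])
  have y [measurable]: "snd \<in> borel_measurable (null_law p)"
    by measurable
  have "(\<lambda>v. \<Sum>J\<in>profiles n k. \<integral>Z. h Z * ridges n p v J Z \<partial>?\<Omega>) \<in> borel_measurable ?S"
  proof (intro borel_measurable_sum S.borel_measurable_lebesgue_integral)
    fix J
    have "(\<lambda>x. herm_coeff (J s) (snd (snd x s)) * poly (hp (J s)) (\<Sum>i<p. fst x i * fst (snd x s) i)) \<in> borel_measurable (?S \<Otimes>\<^sub>M ?\<Omega>)"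
      if "s < n" for s
    proof -
      have Zs: "(\<lambda>x. snd x s) \<in> ?S \<Otimes>\<^sub>M ?\<Omega> \<rightarrow>\<^sub>M null_law p"
        by (rule measurable_compose[OF measurable_snd Z_s[OF that]])
      have [measurable]: "(\<lambda>x. snd (snd x s)) \<in> borel_measurable (?S \<Otimes>\<^sub>M ?\<Omega>)"
        by (rule measurable_compose[OF Zs y])
      have [measurable]: "(\<lambda>x. fst (snd x s) i) \<in> borel_measurable (?S \<Otimes>\<^sub>M ?\<Omega>)" if "i < p" for i
        by (rule measurable_compose[OF Zs x_i[OF that]])
      have [measurable]: "(\<lambda>x. fst x i) \<in> borel_measurable (?S \<Otimes>\<^sub>M ?\<Omega>)" if "i < p" for i
        by (rule measurable_compose[OF measurable_fst v_i[OF that]])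
      have "(\<lambda>x. \<Sum>i<p. fst x i * fst (snd x s) i) \<in> borel_measurable (?S \<Otimes>\<^sub>M ?\<Omega>)"
        by (intro borel_measurable_sum borel_measurable_times) auto
      then show ?thesis by measurable
    qed
    then have "(\<lambda>x. h (snd x) * (\<Prod>s<n. herm_coeff (J s) (snd (snd x s)) * poly (hp (J s)) (\<Sum>i<p. fst x i * fst (snd x s) i)))
        \<in> borel_measurable (?S \<Otimes>\<^sub>M ?\<Omega>)"
      by (intro borel_measurable_times borel_measurable_prod measurable_compose[OF measurable_snd h_meas]) auto
    then show "(\<lambda>(v, Z). h Z * ridges n p v J Z) \<in> borel_measurable (?S \<Otimes>\<^sub>M ?\<Omega>)"
      by (simp add: ridges_def ridge_def case_prod_unfold)
  qed
  then show ?thesis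
    by (rule measurable_cong[THEN iffD1, rotated])
      (auto simp: space_restrict_space unit_sphere_def mean_planted[OF _ h])
qed

end


subsection \<open>Random sign vectors\<close>

text \<open>A product set, so exponential sums over it factorize by coordinates, and a finite subset
  of the sphere for positive p.\<close>

definition cube :: "nat \<Rightarrow> (nat \<Rightarrow> real) set" where
  "cube p = {..<p} \<rightarrow>\<^sub>E {- 1 / sqrt p, 1 / sqrt p}"

lemma finite_cube [simp]: "finite (cube p)"
  unfolding cube_def by (intro finite_PiE) auto

lemma cube_nonempty [simp]: "cube p \<noteq> {}"
  unfolding cube_def by (auto simp: PiE_eq_empty_iff)

lemma cube_coord:
  assumes "v \<in> cube p" "i < p"
  shows "v i = 1 / sqrt p \<or> v i = - 1 / sqrt p"
  using assms PiE_mem[of v "{..<p}" "\<lambda>_. {- 1 / sqrt p, 1 / sqrt p}" i] unfolding cube_def by auto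

lemma cube_unit:
  assumes "v \<in> cube p" "p > 0"
  shows "(\<Sum>i<p. (v i)\<^sup>2) = 1"
proof -
  have "(\<Sum>i<p. (v i)\<^sup>2) = (\<Sum>i<p. 1 / p)"
  proof (rule sum.cong[OF refl])
    fix i assume "i \<in> {..<p}"
    then have "v i = 1 / sqrt p \<or> v i = - 1 / sqrt p" using cube_coord[OF assms(1)] by blast
    then show "(v i)\<^sup>2 = 1 / p" by (elim disjE) (simp_all add: power_divide)
  qed
  then show ?thesis using assms(2) by simp
qed

lemma card_cube: "p > 0 \<Longrightarrow> card (cube p) = 2 ^ p"
  unfolding cube_def by (subst card_PiE) (auto simp: numeral_2_eq_2)

text \<open>The moment generating function of a random sign: add exp x \<le> 1 + x + x^2 and exp(-x)
  \<le> 1/(1+x) \<le> 1 - x + x^2.\<close>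

lemma exp_pair_le:
  assumes "0 \<le> x" "x \<le> (1 :: real)"
  shows "exp x + exp (- x) \<le> 2 * exp (x\<^sup>2)"
proof -
  have "exp (- x) \<le> 1 / (1 + x)"
    using assms exp_ge_add_one_self[of x] by (simp add: exp_minus inverse_eq_divide frac_le)
  also have "\<dots> \<le> 1 - x + x\<^sup>2"
  proof -
    have "(1 - x + x\<^sup>2) * (1 + x) = 1 + x ^ 3"
      by (simp add: algebra_simps power2_eq_square power3_eq_cube)
    then show ?thesis using assms by (simp add: pos_divide_le_eq)
  qed
  finally have "exp x + exp (- x) \<le> 2 * (1 + x\<^sup>2)"
    using exp_bound[OF assms] by simp
  then show ?thesis
    using exp_ge_add_one_self[of "x\<^sup>2"] by (simp only: distrib_left)
qed

text \<open>Each product p v_i w_i is plus or minus 1, so every coordinate contributes exp x +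
  exp(-x), whatever the sign of w_i.\<close>

lemma cube_exp_sum_le:
  assumes w: "w \<in> cube p" and p: "p > 0" and x: "0 \<le> x" "x \<le> 1" and s: "s = 1 \<or> s = -1"
  shows "(\<Sum>v\<in>cube p. exp (s * x * p * (\<Sum>i<p. v i * w i))) \<le> 2 ^ p * exp (p * x\<^sup>2)"
proof -
  have "(\<Sum>v\<in>cube p. exp (s * x * p * (\<Sum>i<p. v i * w i))) = (\<Sum>v\<in>cube p. \<Prod>i<p. exp (s * x * p * (v i * w i)))"
    by (simp add: sum_distrib_left exp_sum)
  also have "\<dots> = (\<Prod>i<p. \<Sum>e\<in>{- 1 / sqrt p, 1 / sqrt p}. exp (s * x * p * (e * w i)))"
    unfolding cube_def by (rule prod_sum_PiE[symmetric]) auto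
  also have "\<dots> = (\<Prod>i<p. exp x + exp (- x))"
  proof (rule prod.cong[OF refl])
    fix i assume "i \<in> {..<p}"
    then have wi: "w i = 1 / sqrt p \<or> w i = - 1 / sqrt p" using cube_coord[OF w] by blast
    define a where "a = 1 / sqrt p"
    have a: "a \<noteq> - a" "real p * (a * a) = 1" using p by (simp_all add: a_def)
    have "- 1 / sqrt p = - a" by (simp add: a_def)
    with wi have "w i = a \<or> w i = - a" by (simp add: a_def)
    then show "(\<Sum>e\<in>{- 1 / sqrt p, 1 / sqrt p}. exp (s * x * p * (e * w i))) = exp x + exp (- x)"
      unfolding \<open>- 1 / sqrt p = - a\<close> a_def[symmetric] using s a by (auto simp: mult.assoc)
  qed
  also have "\<dots> \<le> (2 * exp (x\<^sup>2)) ^ p"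
    unfolding prod_constant card_lessThan by (intro power_mono exp_pair_le x) (simp add: add_nonneg_nonneg)
  also have "\<dots> = 2 ^ p * exp (p * x\<^sup>2)"
    by (simp add: power_mult_distrib exp_of_nat_mult)
  finally show ?thesis .
qed

lemma power_le_fact_exp:
  assumes "0 \<le> (x :: real)"
  shows "x ^ d \<le> fact d * exp x"
proof -
  have "x ^ d / fact d \<le> (\<Sum>i. x ^ i /\<^sub>R fact i)"
    using assms sum_le_suminf[OF summable_exp_generic[of x], of "{d}"] by (simp add: divide_inverse mult.commute)
  then show ?thesis by (simp add: exp_def field_simps)
qed

text \<open>A Chernoff argument: |S|^d is at most d!/(x p)^d exp(x p |S|), and the mean of the
  exponential is at most 2 exp(p x^2). With x = sqrt(d/p) one has p x^2 = d and d/(x p) = x; d \<le>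
  p keeps x \<le> 1.\<close>

lemma cube_correlation_moment:
  assumes w: "w \<in> cube p" and d: "1 \<le> d" "d \<le> p"
  shows "(\<Sum>v\<in>cube p. \<bar>\<Sum>i<p. v i * w i\<bar> ^ d) \<le> card (cube p) * (2 * exp 1 * sqrt (d / p)) ^ d"
proof -
  have p: "p > 0" using d by simp
  define x where "x = sqrt (real d / p)"
  have x: "0 < x" "x \<le> 1" "x\<^sup>2 = real d / p" using d p by (auto simp: x_def)
  define S where "S v = (\<Sum>i<p. v i * w i)" for v
  have "\<bar>S v\<bar> ^ d \<le> fact d / (x * p) ^ d * (exp (1 * x * p * S v) + exp ((-1) * x * p * S v))" for v
  proof -
    have "(x * p * \<bar>S v\<bar>) ^ d \<le> fact d * exp (x * p * \<bar>S v\<bar>)"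
      using x by (intro power_le_fact_exp) auto
    also have "exp (x * p * \<bar>S v\<bar>) \<le> exp (1 * x * p * S v) + exp ((-1) * x * p * S v)"
      by (cases "0 \<le> S v") auto
    finally show ?thesis
      using x p by (simp add: power_mult_distrib field_simps)
  qed
  then have "(\<Sum>v\<in>cube p. \<bar>S v\<bar> ^ d) \<le>
     (\<Sum>v\<in>cube p. fact d / (x * p) ^ d * (exp (1 * x * p * S v) + exp ((-1) * x * p * S v)))"
    by (intro sum_mono)
  also have "\<dots> = fact d / (x * p) ^ d * ((\<Sum>v\<in>cube p. exp (1 * x * p * S v)) + (\<Sum>v\<in>cube p. exp ((-1) * x * p * S v)))"
    by (simp only: sum_distrib_left[symmetric] sum.distrib)
  also have "\<dots> \<le> fact d / (x * p) ^ d * (2 ^ p * exp (p * x\<^sup>2) + 2 ^ p * exp (p * x\<^sup>2))"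
    unfolding S_def using x p
    by (intro mult_left_mono add_mono cube_exp_sum_le w) auto
  also have "\<dots> = 2 ^ p * (2 * (fact d * exp d / (x * p) ^ d))"
    using p by (simp add: x(3))
  also have "\<dots> \<le> 2 ^ p * (2 ^ d * (real d ^ d * exp d / (x * p) ^ d))"
  proof (intro mult_left_mono mult_mono divide_right_mono)
    show "(2 :: real) \<le> 2 ^ d" using d self_le_power[of "2 :: real" d] by simp
    show "fact d \<le> real d ^ d" using fact_le_power[of d] by simp
  qed (use x in auto)
  also have "2 ^ d * (real d ^ d * exp d / (x * p) ^ d) = (2 * exp 1 * (d / (x * p))) ^ d"
    by (simp add: power_mult_distrib power_divide exp_of_nat_mult[of d 1, simplified])
  also have "d / (x * p) = x"
    using x p by (simp add: field_simps power2_eq_square)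
  finally show ?thesis
    by (simp add: S_def x_def card_cube[OF p])
qed



subsection \<open>The contaminated regression model\<close>

text \<open>The requirement \<delta> \<le> \<epsilon> is \<epsilon>/\<delta> \<ge> 1. Together with
  \<epsilon> < 1/2 it gives \<delta> < 1/2, which keeps the Gaussian likelihood ratio square
  integrable with a uniform bound.\<close>

locale contaminated_regression =
  fixes \<epsilon> \<delta> C :: real and m :: nat and g :: "nat \<Rightarrow> real \<Rightarrow> real"
  assumes \<epsilon>: "0 < \<epsilon>" "\<epsilon> < 1 / 2" and \<delta>: "0 < \<delta>" "\<delta> \<le> \<epsilon>" and C: "0 < C"
    and m: "m = num_moments C \<epsilon> \<delta>" and g: "dual_family C m g"
begin

abbreviation \<phi> :: "real \<Rightarrow> real" where "\<phi> \<equiv> std_normal_density"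
abbreviation a :: "nat \<Rightarrow> real \<Rightarrow> real" where "a \<equiv> coeff_a \<epsilon> \<delta>"
abbreviation \<kappa> :: real where "\<kappa> \<equiv> kappa \<epsilon> \<delta> m g"
abbreviation D :: "real \<Rightarrow> real" where "D \<equiv> dens_D \<epsilon> \<delta> m g"
abbreviation f :: "real \<Rightarrow> real \<Rightarrow> real" where "f \<equiv> pert_f \<epsilon> \<delta> m g"
definition s :: real where "s = sqrt (1 - \<delta>\<^sup>2)"

definition r :: "real \<Rightarrow> real" where "r y = (1 - \<epsilon>) * \<phi> y + \<epsilon> * D y"

text \<open>The conditional density of the response given v . X = t. As X has the same law under
  both hypotheses, division by the density of \<open>law_R\<close> gives the full likelihood
  ratio.\<close>

definition numer :: "real \<Rightarrow> real \<Rightarrow> real" where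
  "numer t y = (1 - \<epsilon>) * normal_density (\<delta> * t) s y + \<epsilon> * dens_E \<epsilon> \<delta> m g t y"

definition lr :: "real \<Rightarrow> real \<Rightarrow> real" where "lr t y = numer t y / r y"

lemma \<phi>_pos: "0 < \<phi> x" by (rule normal_density_pos) simp

lemma s_pos: "0 < s" and s_sq: "\<delta>\<^sup>2 + s\<^sup>2 = 1" and s_sq_ge: "3 / 4 \<le> s\<^sup>2"
proof -
  have "\<delta>\<^sup>2 \<le> (1 / 2)\<^sup>2" using \<epsilon> \<delta> by (intro power_mono) auto
  then have "\<delta>\<^sup>2 \<le> 1 / 4" by (simp add: power2_eq_square)
  then show "0 < s" "\<delta>\<^sup>2 + s\<^sup>2 = 1" "3 / 4 \<le> s\<^sup>2" by (auto simp: s_def)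
qed

lemma g_measurable: "i \<in> {1..m} \<Longrightarrow> g i \<in> borel_measurable borel"
  using g unfolding dual_family_def by blast

lemma g_le: "i \<in> {1..m} \<Longrightarrow> \<bar>g i x\<bar> \<le> sup_ratio g i * \<phi> x"
proof -
  assume "i \<in> {1..m}"
  then have "bdd_above (range (\<lambda>x. \<bar>g i x\<bar> / \<phi> x))"
    using g[unfolded dual_family_def, THEN bspec] by simp
  then have "\<bar>g i x\<bar> / \<phi> x \<le> sup_ratio g i"
    unfolding sup_ratio_def by (intro cSUP_upper) auto
  then show ?thesis using \<phi>_pos[of x] by (simp add: pos_divide_le_eq)
qed

lemma sup_ratio_nonneg: "i \<in> {1..m} \<Longrightarrow> 0 \<le> sup_ratio g i"
  using g_le[of i 0] \<phi>_pos[of 0] by (metis abs_ge_zero order.trans zero_le_mult_iff not_le)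

lemma g_integrable: "i \<in> {1..m} \<Longrightarrow> integrable lborel (\<lambda>x. g i x * poly (hp j) x)"
proof -
  assume i: "i \<in> {1..m}"
  have [measurable]: "g i \<in> borel_measurable borel" by (rule g_measurable[OF i])
  have "integrable lborel (\<lambda>x. \<phi> x * (sup_ratio g i * poly (hp j) x))"
    using integrable_gauss_poly[of "smult (sup_ratio g i) (hp j)"] by (subst (asm) integrable_gauss_iff) auto
  then show ?thesis
  proof (rule Bochner_Integration.integrable_bound)
    show "AE x in lborel. norm (g i x * poly (hp j) x) \<le> norm (\<phi> x * (sup_ratio g i * poly (hp j) x))"
    proof (rule AE_I2)
      fix x
      have "\<bar>g i x\<bar> * \<bar>poly (hp j) x\<bar> \<le> sup_ratio g i * \<phi> x * \<bar>poly (hp j) x\<bar>"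
        by (intro mult_right_mono g_le i) auto
      then show "norm (g i x * poly (hp j) x) \<le> norm (\<phi> x * (sup_ratio g i * poly (hp j) x))"
        using sup_ratio_nonneg[OF i] \<phi>_pos[of x] by (simp add: abs_mult mult_ac)
    qed
  qed measurable
qed

lemma g_dual: "i \<in> {1..m} \<Longrightarrow> j \<le> m \<Longrightarrow> (\<integral>x. g i x * poly (hp j) x \<partial>lborel) = (if i = j then 1 else 0)"
  using g unfolding dual_family_def by (simp add: hermite_eq_poly mult.commute)

text \<open>The choice of m makes sqrt(C m) at most \<epsilon>/(2 \<delta>), so that \<delta>^i
  times the bound on |g_i|/\<phi> is at most (\<epsilon>/2)^i.\<close>

lemma m_le: "C * m \<le> (\<epsilon> / (2 * \<delta>))\<^sup>2"
proof -
  have "real m \<le> \<epsilon>\<^sup>2 / (4 * C * \<delta>\<^sup>2)"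
    unfolding m num_moments_def using C by simp
  then have "C * m \<le> C * (\<epsilon>\<^sup>2 / (4 * C * \<delta>\<^sup>2))"
    using C by (intro mult_left_mono) auto
  also have "\<dots> = (\<epsilon> / (2 * \<delta>))\<^sup>2"
    using C by (simp add: power2_eq_square)
  finally show ?thesis .
qed

lemma hp_abs_integral: "(\<integral>y. \<phi> y * \<bar>poly (hp i) y\<bar> \<partial>lborel) \<le> 1"
proof -
  have "(\<integral>y. \<phi> y * \<bar>poly (hp i) y\<bar> \<partial>lborel) = (\<integral>y. \<bar>poly (hp i) y\<bar> \<partial>gauss)"
    by (rule integral_gauss[symmetric]) measurable
  also have "\<dots> \<le> (\<integral>y. 1 / 2 + 1 / 2 * (poly (hp i) y * poly (hp i) y) \<partial>gauss)"
  proof (rule integral_mono)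
    show "integrable gauss (\<lambda>y. 1 / 2 + 1 / 2 * (poly (hp i) y * poly (hp i) y))"
      using integrable_gauss_poly[of "[:1 / 2:] + smult (1 / 2) (hp i * hp i)"] by (simp add: poly_add[abs_def])
    fix y
    show "\<bar>poly (hp i) y\<bar> \<le> 1 / 2 + 1 / 2 * (poly (hp i) y * poly (hp i) y)"
      using sum_squares_bound[of 1 "\<bar>poly (hp i) y\<bar>"] by (simp add: power2_eq_square)
  qed simp
  also have "\<dots> = 1 / 2 + 1 / 2 * (\<integral>y. poly (hp i) y * poly (hp i) y \<partial>gauss)"
    using integrable_gauss_poly[of "hp i * hp i"]
    by (subst Bochner_Integration.integral_add) (auto simp: poly_mult[abs_def] gauss.prob_space[simplified])
  also have "\<dots> = 1" by (simp add: gauss_hp_orthonormal)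
  finally show ?thesis .
qed

lemma a_eq: "a i y = - ((1 - \<epsilon>) * \<delta> ^ i / \<epsilon>) * poly (hp i) y"
  by (simp add: coeff_a_def hermite_eq_poly)

lemma abs_a_eq: "\<bar>a i y\<bar> = ((1 - \<epsilon>) * \<delta> ^ i / \<epsilon>) * \<bar>poly (hp i) y\<bar>"
  using \<epsilon> \<delta> by (simp add: a_eq abs_mult)

lemma a_measurable [measurable]: "a i \<in> borel_measurable borel"
  unfolding a_eq[abs_def] by measurable

lemma \<phi>_a_integrable: "integrable lborel (\<lambda>y. \<phi> y * \<bar>a i y\<bar>)"
proof -
  have "integrable gauss (\<lambda>y. \<bar>a i y\<bar>)"
    unfolding abs_a_eq by (intro integrable_mult_right integrable_abs) simp
  then show ?thesis by (subst (asm) integrable_gauss_iff) auto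
qed

text \<open>The summands are at most (1-\<epsilon>)/\<epsilon> (\<epsilon>/2)^i, and the geometric
  sum gives 1 - \<epsilon>. This leaves \<open>D\<close> a positive multiple of \<phi>, hence
  division by \<open>D\<close> is harmless.\<close>

lemma \<kappa>_less: "\<kappa> < 1"
proof -
  have "\<kappa> \<le> (\<Sum>i=1..m. (1 - \<epsilon>) / \<epsilon> * (\<epsilon> / 2) ^ i)"
    unfolding kappa_def
  proof (rule sum_mono)
    fix i assume i: "i \<in> {1..m}"
    have "(\<integral>y. \<phi> y * \<bar>a i y\<bar> \<partial>lborel) = ((1 - \<epsilon>) * \<delta> ^ i / \<epsilon>) * (\<integral>y. \<phi> y * \<bar>poly (hp i) y\<bar> \<partial>lborel)"
      unfolding abs_a_eq by (simp add: mult.left_commute flip: integral_mult_right_zero)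
    also have "\<dots> \<le> ((1 - \<epsilon>) * \<delta> ^ i / \<epsilon>) * 1"
      using \<epsilon> \<delta> by (intro mult_left_mono hp_abs_integral) auto
    finally have 1: "(\<integral>y. \<phi> y * \<bar>a i y\<bar> \<partial>lborel) \<le> (1 - \<epsilon>) * \<delta> ^ i / \<epsilon>" by simp
    have "sup_ratio g i \<le> (C * m) powr (i / 2)"
      using g i unfolding dual_family_def by blast
    also have "\<dots> \<le> ((\<epsilon> / (2 * \<delta>))\<^sup>2) powr (i / 2)"
      using C m_le by (intro powr_mono2) auto
    also have "\<dots> = (\<epsilon> / (2 * \<delta>)) ^ i"
    proof -
      have p: "0 < \<epsilon> / (2 * \<delta>)" using \<epsilon> \<delta> by simp
      then have "(\<epsilon> / (2 * \<delta>))\<^sup>2 = (\<epsilon> / (2 * \<delta>)) powr 2" by simp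
      then have "((\<epsilon> / (2 * \<delta>))\<^sup>2) powr (i / 2) = (\<epsilon> / (2 * \<delta>)) powr real i" by (simp only: powr_powr) simp
      then show ?thesis using p by (simp only: powr_realpow)
    qed
    finally have 2: "sup_ratio g i \<le> (\<epsilon> / (2 * \<delta>)) ^ i" .
    have "sup_ratio g i * (\<integral>y. \<phi> y * \<bar>a i y\<bar> \<partial>lborel) \<le> (\<epsilon> / (2 * \<delta>)) ^ i * ((1 - \<epsilon>) * \<delta> ^ i / \<epsilon>)"
      using \<epsilon> \<delta> by (intro mult_mono 1 2 integral_nonneg) auto
    also have "\<dots> = (1 - \<epsilon>) / \<epsilon> * (\<epsilon> / (2 * \<delta>) * \<delta>) ^ i"
      by (simp only: power_mult_distrib) simp
    also have "\<epsilon> / (2 * \<delta>) * \<delta> = \<epsilon> / 2" using \<delta> by simp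
    finally show "sup_ratio g i * (\<integral>y. \<phi> y * \<bar>a i y\<bar> \<partial>lborel) \<le> (1 - \<epsilon>) / \<epsilon> * (\<epsilon> / 2) ^ i" .
  qed
  also have "\<dots> = (1 - \<epsilon>) / \<epsilon> * (\<Sum>i=1..m. (\<epsilon> / 2) ^ i)"
    by (simp only: sum_distrib_left)
  also have "(\<Sum>i=1..m. (\<epsilon> / 2) ^ i) = (\<Sum>j\<le>m. if 0 < j then (\<epsilon> / 2) ^ j else 0)"
    by (rule sum.mono_neutral_cong_left) auto
  also have "(1 - \<epsilon>) / \<epsilon> * \<dots> \<le> (1 - \<epsilon>) / \<epsilon> * (2 * (\<epsilon> / 2) ^ Suc 0)"
    using \<epsilon> by (intro mult_left_mono geometric_tail_le) auto
  also have "\<dots> = 1 - \<epsilon>" using \<epsilon> by simp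
  finally show "\<kappa> < 1" using \<epsilon> by simp
qed

lemma D_sum_nonneg: "0 \<le> (\<Sum>i=1..m. \<phi> y * \<bar>a i y\<bar> * sup_ratio g i)"
  using \<phi>_pos[of y] sup_ratio_nonneg by (intro sum_nonneg mult_nonneg_nonneg) auto

lemma D_pos: "0 < D y"
  using D_sum_nonneg[of y] \<kappa>_less \<phi>_pos[of y] unfolding dens_D_def by (intro add_pos_nonneg mult_pos_pos) auto

lemma D_measurable [measurable]: "D \<in> borel_measurable borel"
  unfolding dens_D_def by measurable

lemma D_integral: "integrable lborel D" "(\<integral>y. D y \<partial>lborel) = 1"
proof -
  have 1: "integrable lborel (\<lambda>y. (1 - \<kappa>) * \<phi> y)" by simp
  have 2: "integrable lborel (\<lambda>y. \<phi> y * \<bar>a i y\<bar> * sup_ratio g i)" for i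
    by (intro integrable_mult_left \<phi>_a_integrable)
  have 3: "integrable lborel (\<lambda>y. \<Sum>i=1..m. \<phi> y * \<bar>a i y\<bar> * sup_ratio g i)"
    by (intro Bochner_Integration.integrable_sum 2)
  show "integrable lborel D"
    unfolding dens_D_def[abs_def] by (intro Bochner_Integration.integrable_add 1 3)
  have "(\<integral>y. D y \<partial>lborel) = (1 - \<kappa>) + (\<Sum>i=1..m. (\<integral>y. \<phi> y * \<bar>a i y\<bar> \<partial>lborel) * sup_ratio g i)"
    unfolding dens_D_def Bochner_Integration.integral_add[OF 1 3]
    by (subst Bochner_Integration.integral_sum[OF 2]) simp
  also have "\<dots> = 1" by (simp add: kappa_def mult.commute)
  finally show "(\<integral>y. D y \<partial>lborel) = 1" .
qed

lemma r_pos: "0 < r y"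
  unfolding r_def using \<epsilon> \<phi>_pos[of y] D_pos[of y] by (intro add_pos_pos mult_pos_pos) auto

lemma r_measurable [measurable]: "r \<in> borel_measurable borel"
  unfolding r_def by measurable

lemma law_R_eq: "law_R \<epsilon> \<delta> m g = density lborel (\<lambda>y. ennreal (r y))"
  by (simp add: law_R_def r_def)

lemma sets_law_R [measurable_cong]: "sets (law_R \<epsilon> \<delta> m g) = sets borel"
  by (simp add: law_R_eq)

lemma prob_space_law_R: "prob_space (law_R \<epsilon> \<delta> m g)"
proof
  have int: "integrable lborel r"
    unfolding r_def[abs_def] using D_integral by simp
  have "(\<integral>y. r y \<partial>lborel) = 1"
    unfolding r_def using D_integral by simp
  moreover have "(\<integral>\<^sup>+y. ennreal (r y) \<partial>lborel) = ennreal (\<integral>y. r y \<partial>lborel)"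
    using int r_pos by (intro nn_integral_eq_integral) (auto intro!: AE_I2 less_imp_le)
  ultimately show "emeasure (law_R \<epsilon> \<delta> m g) (space (law_R \<epsilon> \<delta> m g)) = 1"
    by (simp add: law_R_eq emeasure_density)
qed

lemma law_R_integrable:
  fixes h :: "real \<Rightarrow> real"
  assumes [measurable]: "h \<in> borel_measurable borel"
  shows "integrable (law_R \<epsilon> \<delta> m g) h \<longleftrightarrow> integrable lborel (\<lambda>y. r y * h y)"
    and "(\<integral>y. h y \<partial>law_R \<epsilon> \<delta> m g) = (\<integral>y. r y * h y \<partial>lborel)"
  unfolding law_R_eq using r_pos
  by (subst integrable_density integral_density; auto intro!: AE_I2 less_imp_le)+

lemma law_R_moments: "all_moments (law_R \<epsilon> \<delta> m g) (\<lambda>y. y)"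
  unfolding all_moments_def
proof safe
  fix k :: nat
  \<comment> \<open>The density of \<open>law_R\<close> relative to the Gaussian is a combination of
    absolute values of polynomials, so all moments are Gaussian moments.\<close>
  define \<rho> where "\<rho> y = (1 - \<epsilon>) + \<epsilon> * ((1 - \<kappa>) + (\<Sum>i=1..m. \<bar>a i y\<bar> * sup_ratio g i))" for y
  have r\<rho>: "r y = \<phi> y * \<rho> y" for y
    by (simp add: r_def \<rho>_def dens_D_def sum_distrib_left algebra_simps)
  have abs: "all_moments gauss (\<lambda>y. \<bar>q y\<bar>)" if "all_moments gauss q" for q :: "real \<Rightarrow> real"
    using that by (auto simp: all_moments_def)
  have am: "all_moments gauss (\<lambda>y. \<bar>a i y\<bar>)" for i
    unfolding a_eq by (intro abs all_moments_mult all_moments_const all_moments_gauss_poly gauss.finite_measure_axioms)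
  have y: "all_moments gauss (\<lambda>y. y)"
    using all_moments_gauss_poly[of "[:0, 1:]"] by (simp add: poly_pCons[abs_def])
  have "all_moments gauss (\<lambda>y. \<rho> y * \<bar>y\<bar> ^ k)"
    unfolding \<rho>_def
    by (intro all_moments_mult all_moments_add all_moments_sum all_moments_power all_moments_const am abs y gauss.finite_measure_axioms)
  then have "integrable gauss (\<lambda>y. \<rho> y * \<bar>y\<bar> ^ k)" by (rule all_moments_integrable)
  then have "integrable lborel (\<lambda>y. \<phi> y * (\<rho> y * \<bar>y\<bar> ^ k))"
    by (subst (asm) integrable_gauss_iff) (auto simp: \<rho>_def)
  then show "integrable (law_R \<epsilon> \<delta> m g) (\<lambda>y. \<bar>y\<bar> ^ k)"
    by (subst law_R_integrable) (auto simp: r\<rho> mult.assoc)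
qed (simp add: measurable_cong_sets[OF sets_law_R refl])

text \<open>The second sum in \<open>D\<close> is the pointwise majorant of the perturbation, which
  gives E_x \<ge> 0 and also E_x \<le> 2 D.\<close>

lemma f_le: "\<bar>f y x\<bar> \<le> \<phi> x"
proof -
  have "\<bar>\<Sum>i=1..m. a i y * g i x\<bar> \<le> (\<Sum>i=1..m. \<bar>a i y\<bar> * (sup_ratio g i * \<phi> x))"
    by (rule order.trans[OF sum_abs]) (auto simp: abs_mult intro!: sum_mono mult_left_mono g_le)
  also have "\<dots> = (\<Sum>i=1..m. \<bar>a i y\<bar> * sup_ratio g i) * \<phi> x"
    by (simp add: sum_distrib_right mult.assoc)
  finally have "\<phi> y * \<bar>\<Sum>i=1..m. a i y * g i x\<bar> \<le> \<phi> y * ((\<Sum>i=1..m. \<bar>a i y\<bar> * sup_ratio g i) * \<phi> x)"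
    using \<phi>_pos[of y] by (intro mult_left_mono) auto
  also have "\<dots> \<le> D y * \<phi> x"
  proof -
    have "\<phi> y * (\<Sum>i=1..m. \<bar>a i y\<bar> * sup_ratio g i) \<le> D y"
      using \<kappa>_less \<phi>_pos[of y] by (simp add: dens_D_def sum_distrib_left mult.assoc)
    then show ?thesis using \<phi>_pos[of x] by (simp add: mult_right_mono flip: mult.assoc)
  qed
  finally show ?thesis
    using D_pos[of y] \<phi>_pos[of y] by (simp add: pert_f_def abs_mult abs_divide pos_divide_le_eq mult_ac)
qed

lemma dens_E_eq: "dens_E \<epsilon> \<delta> m g t y = D y * (1 + f y t / \<phi> t)"
  using \<phi>_pos[of t] by (simp add: dens_E_def cond_D_def field_simps)

lemma f_ratio: "0 \<le> 1 + f y t / \<phi> t" "1 + f y t / \<phi> t \<le> 2"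
proof -
  have "\<bar>f y t / \<phi> t\<bar> \<le> 1" using f_le[of y t] \<phi>_pos[of t] by (simp add: abs_divide)
  then show "0 \<le> 1 + f y t / \<phi> t" "1 + f y t / \<phi> t \<le> 2" by linarith+
qed

lemma f_measurable: "(\<lambda>(t, y). f y t) \<in> borel_measurable (borel \<Otimes>\<^sub>M borel)"
proof -
  have "(\<lambda>z :: real \<times> real. \<phi> (snd z) / D (snd z) * (\<Sum>i=1..m. a i (snd z) * g i (fst z))) \<in> borel_measurable (borel \<Otimes>\<^sub>M borel)"
    by (intro borel_measurable_times borel_measurable_sum measurable_compose[OF measurable_fst g_measurable]) measurable
  then show ?thesis by (simp add: pert_f_def case_prod_unfold)
qed

lemma numer_measurable [measurable]: "(\<lambda>(t, y). numer t y) \<in> borel_measurable (borel \<Otimes>\<^sub>M borel)"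
proof -
  have [measurable]: "(\<lambda>z. f (snd z) (fst z)) \<in> borel_measurable (borel \<Otimes>\<^sub>M borel)"
    using f_measurable by (simp add: case_prod_unfold)
  have "(\<lambda>z :: real \<times> real. (1 - \<epsilon>) * normal_density (\<delta> * fst z) s (snd z) + \<epsilon> * (D (snd z) * (1 + f (snd z) (fst z) / \<phi> (fst z)))) \<in> borel_measurable (borel \<Otimes>\<^sub>M borel)"
    unfolding normal_density_def by measurable
  then show ?thesis by (simp add: numer_def dens_E_eq case_prod_unfold)
qed

lemma lr_measurable: "(\<lambda>(t, y). lr t y) \<in> borel_measurable (borel \<Otimes>\<^sub>M borel)"
  unfolding lr_def by measurable

lemma lr_nonneg: "0 \<le> lr t y"
proof -
  have "0 \<le> (1 - \<epsilon>) * normal_density (\<delta> * t) s y" using \<epsilon> by simp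
  moreover have "0 \<le> \<epsilon> * (D y * (1 + f y t / \<phi> t))"
    by (intro mult_nonneg_nonneg f_ratio(1) less_imp_le[OF D_pos] less_imp_le[OF \<epsilon>(1)])
  ultimately show ?thesis
    unfolding lr_def numer_def dens_E_eq using r_pos[of y] by (intro divide_nonneg_pos add_nonneg_nonneg)
qed


section \<open>Hermite moments of the likelihood ratio\<close>

text \<open>Both sides are the bivariate Gaussian density with unit variances and correlation
  \<delta>, which is symmetric in t and y.\<close>

lemma normal_density_swap: "\<phi> t * normal_density (\<delta> * t) s y = \<phi> y * normal_density (\<delta> * y) s t"
proof -
  have s2: "s\<^sup>2 = 1 - \<delta>\<^sup>2" using s_sq by linarith
  have "- (t\<^sup>2 / 2) + - (y - \<delta> * t)\<^sup>2 / (2 * s\<^sup>2) = - (s\<^sup>2 * t\<^sup>2 + (y - \<delta> * t)\<^sup>2) / (2 * s\<^sup>2)"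
    using s_pos by (simp add: field_simps)
  also have "s\<^sup>2 * t\<^sup>2 + (y - \<delta> * t)\<^sup>2 = s\<^sup>2 * y\<^sup>2 + (t - \<delta> * y)\<^sup>2"
    unfolding s2 by (simp add: power2_eq_square algebra_simps)
  also have "- (s\<^sup>2 * y\<^sup>2 + (t - \<delta> * y)\<^sup>2) / (2 * s\<^sup>2) = - (y\<^sup>2 / 2) + - (t - \<delta> * y)\<^sup>2 / (2 * s\<^sup>2)"
    using s_pos by (simp add: field_simps)
  finally have "exp (- (t\<^sup>2 / 2)) * exp (- (y - \<delta> * t)\<^sup>2 / (2 * s\<^sup>2)) = exp (- (y\<^sup>2 / 2)) * exp (- (t - \<delta> * y)\<^sup>2 / (2 * s\<^sup>2))"
    by (simp only: exp_add[symmetric])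
  then show ?thesis
    unfolding std_normal_density_def normal_density_def[of _ s] by simp
qed

lemma normal_density_poly:
  shows "integrable lborel (\<lambda>t. normal_density \<mu> s t * poly q t)"
    and "(\<integral>t. normal_density \<mu> s t * poly q t \<partial>lborel) = (\<integral>u. poly q (\<mu> + s * u) \<partial>gauss)"
proof -
  have sc: "s * normal_density \<mu> s (\<mu> + s * u) = \<phi> u" for u
  proof -
    have "(\<mu> + s * u - \<mu>)\<^sup>2 / (2 * s\<^sup>2) = u\<^sup>2 / 2"
      using s_pos by (simp add: power_mult_distrib)
    moreover have "sqrt (2 * pi * s\<^sup>2) = sqrt (2 * pi) * s"
      using s_pos by (simp add: real_sqrt_mult)
    ultimately show ?thesis
      using s_pos unfolding std_normal_density_def normal_density_def by simp
  qed
  have P: "poly q (\<mu> + s * u) = poly (pcompose q [:\<mu>, s:]) u" for u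
    by (simp add: poly_pcompose mult.commute)
  have int: "integrable lborel (\<lambda>u. \<phi> u * poly q (\<mu> + s * u))"
    using integrable_gauss_poly[of "pcompose q [:\<mu>, s:]"] unfolding P by (subst (asm) integrable_gauss_iff) auto
  have "integrable lborel (\<lambda>u. inverse s * (\<phi> u * poly q (\<mu> + s * u)))"
    by (intro integrable_mult_right int)
  then have "integrable lborel (\<lambda>u. normal_density \<mu> s (\<mu> + s * u) * poly q (\<mu> + s * u))"
    using s_pos by (simp add: sc[symmetric] mult.assoc[symmetric])
  then show "integrable lborel (\<lambda>t. normal_density \<mu> s t * poly q t)"
    using s_pos by (subst lborel_integrable_real_affine_iff[symmetric, of s _ \<mu>]) auto
  have "(\<integral>t. normal_density \<mu> s t * poly q t \<partial>lborel) = s * (\<integral>u. normal_density \<mu> s (\<mu> + s * u) * poly q (\<mu> + s * u) \<partial>lborel)"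
    using s_pos by (subst lborel_integral_real_affine[of s _ \<mu>]) auto
  also have "\<dots> = (\<integral>u. \<phi> u * poly q (\<mu> + s * u) \<partial>lborel)"
    by (simp add: sc[symmetric] mult.assoc)
  also have "\<dots> = (\<integral>u. poly q (\<mu> + s * u) \<partial>gauss)"
    by (rule integral_gauss[symmetric]) measurable
  finally show "(\<integral>t. normal_density \<mu> s t * poly q t \<partial>lborel) = \<dots>" .
qed

text \<open>
  By the Ornstein-Uhlenbeck identity the Gaussian part contributes \<open>(1 - \<epsilon>) \<phi>(y) \<delta>\<^sup>j he\<^sub>j(y)\<close>,
  which \<open>\<epsilon> \<phi>(y) a\<^sub>j(y)\<close> cancels for \<open>1 \<le> j \<le> m\<close>.
\<close>

lemma numer_hermite:
  assumes j: "j \<le> m"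
  shows "(\<integral>t. numer t y * poly (hp j) t \<partial>gauss) = (if j = 0 then r y else 0)"
proof -
  have numer_t [measurable]: "(\<lambda>t. numer t y) \<in> borel_measurable borel"
    using numer_measurable by measurable
  \<comment> \<open>\<open>F\<close> is the regression part with t and y exchanged, \<open>G\<close>
    the unperturbed contamination, \<open>K\<close> the perturbation, in which the factor
    \<open>D\<close> cancels.\<close>
  define F where "F t = (1 - \<epsilon>) * \<phi> y * (normal_density (\<delta> * y) s t * poly (hp j) t)" for t
  define G where "G t = \<epsilon> * D y * (\<phi> t * poly (hp j) t)" for t
  define K where "K t = (\<Sum>i=1..m. \<epsilon> * \<phi> y * a i y * (g i t * poly (hp j) t))" for t
  have eq: "\<phi> t * (numer t y * poly (hp j) t) = F t + (G t + K t)" for t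
  proof -
    have "D y * f y t = \<phi> y * (\<Sum>i=1..m. a i y * g i t)"
      using D_pos[of y] by (simp add: pert_f_def)
    then have E: "\<phi> t * dens_E \<epsilon> \<delta> m g t y = D y * \<phi> t + \<phi> y * (\<Sum>i=1..m. a i y * g i t)"
      using \<phi>_pos[of t] by (simp add: dens_E_eq field_simps)
    have "\<phi> t * numer t y = (1 - \<epsilon>) * (\<phi> t * normal_density (\<delta> * t) s y) + \<epsilon> * (\<phi> t * dens_E \<epsilon> \<delta> m g t y)"
      by (simp add: numer_def algebra_simps)
    also have "\<dots> = (1 - \<epsilon>) * (\<phi> y * normal_density (\<delta> * y) s t) + \<epsilon> * (D y * \<phi> t + \<phi> y * (\<Sum>i=1..m. a i y * g i t))"
      unfolding E normal_density_swap ..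
    finally have "\<phi> t * numer t y * poly (hp j) t = \<dots> * poly (hp j) t" by simp
    then show ?thesis
      by (simp add: F_def G_def K_def sum_distrib_left sum_distrib_right algebra_simps)
  qed
  have Fi: "integrable lborel F" unfolding F_def by (intro integrable_mult_right normal_density_poly)
  have Gi: "integrable lborel G"
    unfolding G_def using integrable_gauss_poly[of "hp j"]
    by (intro integrable_mult_right) (subst (asm) integrable_gauss_iff, auto)
  have Ki: "integrable lborel (\<lambda>t. \<epsilon> * \<phi> y * a i y * (g i t * poly (hp j) t))" if "i \<in> {1..m}" for i
    by (intro integrable_mult_right g_integrable that)
  have Ksum: "integrable lborel K" unfolding K_def by (intro Bochner_Integration.integrable_sum Ki)
  have "(\<integral>t. numer t y * poly (hp j) t \<partial>gauss) = (\<integral>t. F t + (G t + K t) \<partial>lborel)"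
    by (subst integral_gauss) (auto simp: eq)
  also have "\<dots> = (\<integral>t. F t \<partial>lborel) + ((\<integral>t. G t \<partial>lborel) + (\<integral>t. K t \<partial>lborel))"
    using Fi Gi Ksum by (simp add: Bochner_Integration.integral_add Bochner_Integration.integrable_add)
  also have "(\<integral>t. F t \<partial>lborel) = (1 - \<epsilon>) * \<phi> y * (\<delta> ^ j * poly (hp j) y)"
    unfolding F_def integral_mult_right_zero normal_density_poly gauss_ornstein_uhlenbeck[OF s_sq] ..
  also have "(\<integral>t. G t \<partial>lborel) = \<epsilon> * D y * (if j = 0 then 1 else 0)"
  proof -
    have "(\<integral>t. \<phi> t * poly (hp j) t \<partial>lborel) = (\<integral>t. poly (hp j) t \<partial>gauss)"
      by (rule integral_gauss[symmetric]) measurable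
    also have "\<dots> = (if j = 0 then 1 else 0)"
      using gauss_hp_orthonormal[of j 0] by (simp add: eta_contract_eq)
    finally show ?thesis unfolding G_def integral_mult_right_zero by simp
  qed
  also have "(\<integral>t. K t \<partial>lborel) = (\<Sum>i=1..m. \<epsilon> * \<phi> y * a i y * (if i = j then 1 else 0))"
  proof -
    have "(\<integral>t. K t \<partial>lborel) = (\<Sum>i=1..m. \<integral>t. \<epsilon> * \<phi> y * a i y * (g i t * poly (hp j) t) \<partial>lborel)"
      unfolding K_def by (rule Bochner_Integration.integral_sum) (rule Ki)
    then show ?thesis unfolding integral_mult_right_zero by (simp add: g_dual j)
  qed
  also have "\<dots> = (\<Sum>i=1..m. if i = j then \<epsilon> * \<phi> y * a j y else 0)"
    by (intro sum.cong) auto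
  also have "\<dots> = (if 1 \<le> j then \<epsilon> * \<phi> y * a j y else 0)"
    using j by simp
  finally show ?thesis
    using \<epsilon> by (cases "j = 0") (auto simp: r_def a_eq simp del: hp.simps(2))
qed

section \<open>Second moment of the likelihood ratio\<close>

text \<open>Under the null, with y drawn from the mixture \<open>law_R\<close>, the posterior
  probability of its Gaussian component.\<close>

definition w :: "real \<Rightarrow> real" where "w y = (1 - \<epsilon>) * \<phi> y / r y"

definition e :: "real \<Rightarrow> real" where "e t = exp (t\<^sup>2 / 3)"

lemma w_measurable [measurable]: "w \<in> borel_measurable borel"
  unfolding w_def by measurable

lemma e_measurable [measurable]: "e \<in> borel_measurable borel"
  unfolding e_def by measurable

lemma w_bounds: "0 \<le> w y" "w y \<le> 1"
proof -
  have "0 \<le> \<epsilon> * D y" using \<epsilon> D_pos[of y] by simp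
  then have "(1 - \<epsilon>) * \<phi> y \<le> r y" by (simp add: r_def)
  then show "w y \<le> 1" using r_pos[of y] by (simp add: w_def)
  show "0 \<le> w y" using \<epsilon> r_pos[of y] \<phi>_pos[of y] by (simp add: w_def)
qed

text \<open>Completing squares and 2 t y \<le> t^2 + y^2 bound the exponent by \<delta>/(1+\<delta>)
  (t^2 + y^2), and \<delta> \<le> 1/2 gives the factor 1/3, below the Gaussian threshold 1/2. The
  prefactor is 1/s^2 \<le> 4/3.\<close>

lemma gaussian_ratio_sq_le: "(normal_density (\<delta> * t) s y / \<phi> y)\<^sup>2 \<le> 4 / 3 * e t * e y"
proof -
  define E where "E = y\<^sup>2 - (y - \<delta> * t)\<^sup>2 / s\<^sup>2"
  have s2: "s\<^sup>2 = (1 - \<delta>) * (1 + \<delta>)" using s_sq by (simp add: power2_eq_square algebra_simps)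
  have "normal_density (\<delta> * t) s y / \<phi> y = 1 / s * (exp (- (y - \<delta> * t)\<^sup>2 / (2 * s\<^sup>2)) / exp (- y\<^sup>2 / 2))"
  proof -
    have "sqrt (2 * pi * s\<^sup>2) = sqrt (2 * pi) * s"
      using s_pos by (simp add: real_sqrt_mult)
    then show ?thesis
      using s_pos unfolding std_normal_density_def normal_density_def by simp
  qed
  also have "\<dots> = 1 / s * exp (E / 2)"
    by (simp add: E_def exp_diff[symmetric] diff_divide_distrib)
  finally have "(normal_density (\<delta> * t) s y / \<phi> y)\<^sup>2 = 1 / s\<^sup>2 * exp E"
    by (simp add: power_mult_distrib power_divide flip: exp_double)
  also have "\<dots> \<le> 4 / 3 * exp ((t\<^sup>2 + y\<^sup>2) / 3)"
  proof (intro mult_mono)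
    have "1 / s\<^sup>2 \<le> 1 / (3 / 4)" using s_sq_ge s_pos by (intro divide_left_mono) auto
    then show "1 / s\<^sup>2 \<le> 4 / 3" by simp
    have "s\<^sup>2 * E = s\<^sup>2 * y\<^sup>2 - (y - \<delta> * t)\<^sup>2"
      using s_pos by (simp add: E_def right_diff_distrib)
    also have "\<dots> = \<delta> * (2 * t * y) - \<delta>\<^sup>2 * (t\<^sup>2 + y\<^sup>2)"
      unfolding s2 by (simp add: power2_eq_square algebra_simps)
    also have "\<dots> \<le> \<delta> * (t\<^sup>2 + y\<^sup>2) - \<delta>\<^sup>2 * (t\<^sup>2 + y\<^sup>2)"
      using \<delta> sum_squares_bound[of t y] by (intro diff_right_mono mult_left_mono) auto
    also have "\<dots> = (1 - \<delta>) * (\<delta> * (t\<^sup>2 + y\<^sup>2))"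
      by (simp add: power2_eq_square algebra_simps)
    also have "\<dots> \<le> (1 - \<delta>) * ((1 + \<delta>) / 3 * (t\<^sup>2 + y\<^sup>2))"
      using \<epsilon> \<delta> by (intro mult_left_mono mult_right_mono) auto
    also have "\<dots> = s\<^sup>2 * ((t\<^sup>2 + y\<^sup>2) / 3)"
      unfolding s2 by simp
    finally have "E \<le> (t\<^sup>2 + y\<^sup>2) / 3"
      using s_pos by (simp only: mult_le_cancel_left_pos zero_less_power)
    then show "exp E \<le> exp ((t\<^sup>2 + y\<^sup>2) / 3)" by simp
  qed auto
  also have "\<dots> = 4 / 3 * e t * e y"
    by (simp add: e_def exp_add[symmetric] add_divide_distrib)
  finally show ?thesis .
qed

text \<open>
  The likelihood ratio is a convex combination of the Gaussian ratio and \<open>1 + f\<^sub>y / \<phi> \<le> 2\<close>.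
\<close>

lemma lr_sq_le: "(lr t y)\<^sup>2 \<le> 4 / 3 * (e t * (w y * e y)) + 4"
proof -
  define M where "M = normal_density (\<delta> * t) s y / \<phi> y"
  define b where "b = 1 + f y t / \<phi> t"
  have "1 - w y = \<epsilon> * D y / r y"
    using r_pos[of y] by (simp add: w_def r_def field_simps)
  then have lr: "lr t y = w y * M + (1 - w y) * b"
    using \<phi>_pos[of y] by (simp add: lr_def numer_def dens_E_eq w_def M_def b_def add_divide_distrib)
  \<comment> \<open>Convexity of the square in exact form: the extra term is the variance of a
    two-point variable with values M and b.\<close>
  have "(lr t y)\<^sup>2 + w y * (1 - w y) * (M - b)\<^sup>2 = w y * M\<^sup>2 + (1 - w y) * b\<^sup>2"
    unfolding lr by (simp add: power2_eq_square algebra_simps)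
  moreover have "0 \<le> w y * (1 - w y) * (M - b)\<^sup>2"
    using w_bounds[of y] by simp
  moreover have "w y * M\<^sup>2 \<le> w y * (4 / 3 * e t * e y)"
    unfolding M_def using w_bounds[of y] by (intro mult_left_mono gaussian_ratio_sq_le)
  moreover have "(1 - w y) * b\<^sup>2 \<le> 1 * 2\<^sup>2"
    using w_bounds[of y] f_ratio[of y t] unfolding b_def by (intro mult_mono power_mono) auto
  moreover have "w y * (4 / 3 * e t * e y) = 4 / 3 * (e t * (w y * e y))" "(1 :: real) * 2\<^sup>2 = 4"
    by simp_all
  ultimately show ?thesis by linarith
qed

lemma e_gauss: "integrable gauss e" "(\<integral>t. e t \<partial>gauss) = sqrt 3"
proof -
  have eq: "\<phi> t * e t = sqrt 3 * normal_density 0 (sqrt 3) t" for t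
  proof -
    have "- t\<^sup>2 / 2 + t\<^sup>2 / 3 = - t\<^sup>2 / 6" by simp
    then have "exp (- t\<^sup>2 / 2) * exp (t\<^sup>2 / 3) = exp (- t\<^sup>2 / 6)"
      by (simp only: exp_add[symmetric])
    moreover have "sqrt (2 * pi * 3) = sqrt (2 * pi) * sqrt 3" by (simp only: real_sqrt_mult)
    ultimately show ?thesis
      by (simp add: std_normal_density_def normal_density_def e_def)
  qed
  show "integrable gauss e"
    by (subst integrable_gauss_iff) (auto simp: eq)
  show "(\<integral>t. e t \<partial>gauss) = sqrt 3"
    by (subst integral_gauss) (auto simp: eq)
qed

text \<open>The weight \<open>w\<close> cancels the density \<open>r\<close>, so the exponential is
  integrated against (1-\<epsilon>) \<phi> instead of \<open>law_R\<close>.\<close>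

lemma we_law_R: "integrable (law_R \<epsilon> \<delta> m g) (\<lambda>y. w y * e y)" "(\<integral>y. w y * e y \<partial>law_R \<epsilon> \<delta> m g) = (1 - \<epsilon>) * sqrt 3"
proof -
  have eq: "r y * (w y * e y) = (1 - \<epsilon>) * (\<phi> y * e y)" for y
    using r_pos[of y] by (simp add: w_def)
  have "integrable lborel (\<lambda>y. \<phi> y * e y)"
    using e_gauss(1) by (subst (asm) integrable_gauss_iff) auto
  then show "integrable (law_R \<epsilon> \<delta> m g) (\<lambda>y. w y * e y)"
    by (subst law_R_integrable) (auto simp: eq)
  have "(\<integral>y. \<phi> y * e y \<partial>lborel) = sqrt 3"
    using e_gauss(2) by (subst (asm) integral_gauss) auto
  then show "(\<integral>y. w y * e y \<partial>law_R \<epsilon> \<delta> m g) = (1 - \<epsilon>) * sqrt 3"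
    by (subst law_R_integrable) (auto simp: eq)
qed

lemma lr_t_measurable [measurable]: "(\<lambda>t. lr t y) \<in> borel_measurable borel"
  using lr_measurable by measurable

lemma lr_square: "integrable gauss (\<lambda>t. (lr t y)\<^sup>2)"
proof (rule Bochner_Integration.integrable_bound)
  show "integrable gauss (\<lambda>t. 4 / 3 * (e t * (w y * e y)) + 4)"
    by (intro Bochner_Integration.integrable_add integrable_mult_right integrable_mult_left e_gauss) simp
  show "AE t in gauss. norm ((lr t y)\<^sup>2) \<le> norm (4 / 3 * (e t * (w y * e y)) + 4)"
    using lr_sq_le[of _ y] by (intro AE_I2) (metis abs_ge_self order.trans real_norm_def abs_of_nonneg zero_le_power2)
qed measurable

lemma lr_square_pair:
  "integrable (gauss \<Otimes>\<^sub>M law_R \<epsilon> \<delta> m g) (\<lambda>(t, y). (lr t y)\<^sup>2)"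
  "(\<integral>(t, y). (lr t y)\<^sup>2 \<partial>(gauss \<Otimes>\<^sub>M law_R \<epsilon> \<delta> m g)) \<le> 8"
proof -
  interpret R: prob_space "law_R \<epsilon> \<delta> m g" by (rule prob_space_law_R)
  interpret gR: pair_prob_space gauss "law_R \<epsilon> \<delta> m g" ..
  note P = integrable_pair_mult[OF prob_space_gauss prob_space_law_R e_gauss(1) we_law_R(1)]
  define B where "B z = 4 / 3 * (\<lambda>(t, y). e t * (w y * e y)) z + 4" for z
  have B: "integrable (gauss \<Otimes>\<^sub>M law_R \<epsilon> \<delta> m g) B"
    unfolding B_def by (intro Bochner_Integration.integrable_add integrable_mult_right P) simp
  have le: "(\<lambda>(t, y). (lr t y)\<^sup>2) z \<le> B z" for z
    using lr_sq_le by (cases z) (simp add: B_def)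
  have [measurable]: "(\<lambda>(t, y). (lr t y)\<^sup>2) \<in> borel_measurable (gauss \<Otimes>\<^sub>M law_R \<epsilon> \<delta> m g)"
    using lr_measurable by measurable
  show int: "integrable (gauss \<Otimes>\<^sub>M law_R \<epsilon> \<delta> m g) (\<lambda>(t, y). (lr t y)\<^sup>2)"
  proof (rule Bochner_Integration.integrable_bound[OF B])
    show "AE z in gauss \<Otimes>\<^sub>M law_R \<epsilon> \<delta> m g. norm ((\<lambda>(t, y). (lr t y)\<^sup>2) z) \<le> norm (B z)"
    proof (rule AE_I2)
      fix z :: "real \<times> real"
      have "0 \<le> (\<lambda>(t, y). (lr t y)\<^sup>2) z" by (cases z) simp
      then show "norm ((\<lambda>(t, y). (lr t y)\<^sup>2) z) \<le> norm (B z)" using le[of z] by simp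
    qed
  qed measurable
  have "(\<integral>z. (\<lambda>(t, y). (lr t y)\<^sup>2) z \<partial>(gauss \<Otimes>\<^sub>M law_R \<epsilon> \<delta> m g)) \<le> (\<integral>z. B z \<partial>(gauss \<Otimes>\<^sub>M law_R \<epsilon> \<delta> m g))"
    by (intro integral_mono int B le)
  \<comment> \<open>The two Gaussian integrals of exp(t^2/3) give sqrt 3 each; the total 4
    (1-\<epsilon>) + 4 is the origin of the bound 8.\<close>
  also have "\<dots> = 4 / 3 * (sqrt 3 * ((1 - \<epsilon>) * sqrt 3)) + 4"
    unfolding B_def
    by (subst Bochner_Integration.integral_add)
      (use P in \<open>auto simp: e_gauss we_law_R gR.prob_space\<close>)
  also have "sqrt 3 * ((1 - \<epsilon>) * sqrt 3) = (sqrt 3 * sqrt 3) * (1 - \<epsilon>)"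
    by (simp only: mult_ac)
  also have "4 / 3 * (sqrt 3 * sqrt 3 * (1 - \<epsilon>)) + 4 = 4 * (1 - \<epsilon>) + 4" by simp
  also have "\<dots> \<le> 8" using \<epsilon> by simp
  finally show "(\<integral>(t, y). (lr t y)\<^sup>2 \<partial>(gauss \<Otimes>\<^sub>M law_R \<epsilon> \<delta> m g)) \<le> 8" .
qed

lemma lr_hermite:
  assumes "j \<le> m"
  shows "(\<integral>t. lr t y * poly (hp j) t \<partial>gauss) = (if j = 0 then 1 else 0)"
proof -
  have "(\<integral>t. lr t y * poly (hp j) t \<partial>gauss) = (\<integral>t. (numer t y * poly (hp j) t) / r y \<partial>gauss)"
    by (simp add: lr_def)
  also have "\<dots> = (if j = 0 then r y else 0) / r y"
    unfolding integral_divide_zero numer_hermite[OF assms] ..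
  finally show ?thesis using r_pos[of y] by auto
qed

sublocale planted_direction "law_R \<epsilon> \<delta> m g" lr 8 m
proof (rule planted_direction.intro)
  show "prob_space (law_R \<epsilon> \<delta> m g)" by (rule prob_space_law_R)
  show "sets (law_R \<epsilon> \<delta> m g) = sets borel" by (rule sets_law_R)
  show "all_moments (law_R \<epsilon> \<delta> m g) (\<lambda>y. y)" by (rule law_R_moments)
  show "(\<lambda>(t, y). lr t y) \<in> borel_measurable (borel \<Otimes>\<^sub>M borel)" by (rule lr_measurable)
  show "0 \<le> lr t y" for t y by (rule lr_nonneg)
  show "integrable gauss (\<lambda>t. (lr t y)\<^sup>2)" for y by (rule lr_square)
  show "integrable (gauss \<Otimes>\<^sub>M law_R \<epsilon> \<delta> m g) (\<lambda>(t, y). (lr t y)\<^sup>2)" by (rule lr_square_pair)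
  show "(\<integral>(t, y). (lr t y)\<^sup>2 \<partial>(gauss \<Otimes>\<^sub>M law_R \<epsilon> \<delta> m g)) \<le> 8" by (rule lr_square_pair)
  show "(\<integral>t. lr t y \<partial>gauss) = 1" for y using lr_hermite[of 0 y] by simp
  show "(\<integral>t. lr t y * poly (hp j) t \<partial>gauss) = 0" if "1 \<le> j" "j \<le> m" for j y
    using lr_hermite[of j y] that by simp
qed

lemma law_null_eq: "law_null \<epsilon> \<delta> m g p = null_law p"
  by (simp add: law_null_def)

lemma law_alt_eq: "law_alt \<epsilon> \<delta> m g p v = planted_law p v"
proof -
  have R: "null_law p = density (std_gaussian p \<Otimes>\<^sub>M lborel) (\<lambda>(x, y). ennreal (r y))"
  proof -
    have "density (std_gaussian p) (\<lambda>_. 1) \<Otimes>\<^sub>M density lborel (\<lambda>y. ennreal (r y)) =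
      density (std_gaussian p \<Otimes>\<^sub>M lborel) (\<lambda>(x, y). 1 * ennreal (r y))"
      by (rule pair_measure_density)
        (use prob_space_imp_sigma_finite[OF prob_space_law_R] in \<open>auto simp: law_R_eq lborel.sigma_finite_measure_axioms\<close>)
    then show ?thesis by (simp add: law_R_eq density_1)
  qed
  have [measurable]: "(\<lambda>(x, y). ennreal (lr (\<Sum>i<p. v i * x i) y)) \<in> borel_measurable (std_gaussian p \<Otimes>\<^sub>M lborel)"
    using lr_measurable by measurable
  have "planted_law p v = density (std_gaussian p \<Otimes>\<^sub>M lborel)
    (\<lambda>z. (\<lambda>(x, y). ennreal (r y)) z * (\<lambda>(x, y). ennreal (lr (\<Sum>i<p. v i * x i) y)) z)"
    unfolding planted_law_def R by (rule density_density_eq) measurable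
  also have "(\<lambda>z. (\<lambda>(x, y). ennreal (r y)) z * (\<lambda>(x, y). ennreal (lr (\<Sum>i<p. v i * x i) y)) z) =
    (\<lambda>(x, y). ennreal (numer (\<Sum>i<p. v i * x i) y))"
  proof (rule ext)
    fix z :: "(nat \<Rightarrow> real) \<times> real"
    obtain x y where z: "z = (x, y)" by (cases z)
    have "r y * lr t y = numer t y" for t using r_pos[of y] by (simp add: lr_def)
    then show "(\<lambda>(x, y). ennreal (r y)) z * (\<lambda>(x, y). ennreal (lr (\<Sum>i<p. v i * x i) y)) z =
      (\<lambda>(x, y). ennreal (numer (\<Sum>i<p. v i * x i) y)) z"
      using r_pos[of y] by (simp add: z flip: ennreal_mult')
  qed
  finally show ?thesis by (simp add: law_alt_def numer_def Let_def s_def)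
qed

end



subsection \<open>The lower bound\<close>

text \<open>The identity map moves the uniform law from the power set of the cube to the Borel sets
  of the sphere demanded by \<open>sphere_distribution\<close>.\<close>

definition cube_distribution :: "nat \<Rightarrow> (nat \<Rightarrow> real) measure" where
  "cube_distribution p = distr (uniform_count_measure (cube p))
     (restrict_space (\<Pi>\<^sub>M i\<in>{..<p}. borel) (unit_sphere p)) (\<lambda>v. v)"

lemma cube_subset_unit_sphere: "p > 0 \<Longrightarrow> cube p \<subseteq> unit_sphere p"
  using cube_unit by (auto simp: unit_sphere_def) (auto simp: cube_def)

lemma measurable_cube:
  assumes "p > 0"
  shows "(\<lambda>v. v) \<in> uniform_count_measure (cube p) \<rightarrow>\<^sub>M restrict_space (\<Pi>\<^sub>M i\<in>{..<p}. borel) (unit_sphere p)"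
  using cube_subset_unit_sphere[OF assms]
  by (intro measurableI) (auto simp: space_restrict_space space_PiM unit_sphere_def space_uniform_count_measure sets_uniform_count_measure)

lemma sphere_distribution_cube:
  assumes "p > 0"
  shows "sphere_distribution p (cube_distribution p)"
  unfolding sphere_distribution_def cube_distribution_def
  by (auto intro!: prob_space.prob_space_distr prob_space_uniform_count_measure measurable_cube assms)

lemma mean_cube_distribution:
  assumes "p > 0" "f \<in> borel_measurable (restrict_space (\<Pi>\<^sub>M i\<in>{..<p}. borel) (unit_sphere p))"
  shows "mean (cube_distribution p) f = (\<Sum>v\<in>cube p. f v) / card (cube p)"
  unfolding mean_def cube_distribution_def
  by (subst integral_distr[OF measurable_cube[OF assms(1)] assms(2)])
    (simp add: integral_uniform_count_measure)

context contaminated_regression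
begin

lemma distinguisher_sample_size:
  assumes p36: "36 ^ 4 \<le> real p" and k: "real k < real p powr (1 / 4)"
    and \<tau>: "1 \<le> \<tau>" and h: "sample_poly n p k h"
    and dist: "distinguisher n (law_null \<epsilon> \<delta> m g p) (law_alt \<epsilon> \<delta> m g p) (cube_distribution p) \<tau> h"
  shows "1 / 32 * real p powr (1 / (16 * C) * (\<epsilon>\<^sup>2 / \<delta>\<^sup>2)) \<le> real n"
proof (rule ccontr)
  \<comment> \<open>\<open>q\<close> is both the bound on k and the inverse of the correlation scale
    \<eta>.\<close>
  define q where "q = real p powr (1 / 4)"
  have p: "p > 0" using p36 by (intro gr0I) auto
  have q4: "q ^ 4 = real p"
    using p by (simp add: q_def powr_power)
  have q36: "36 \<le> q"
  proof (rule ccontr)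
    assume "\<not> 36 \<le> q"
    then have "q ^ 4 < 36 ^ 4" by (intro power_strict_mono) (auto simp: q_def)
    then show False using p36 q4 by simp
  qed
  have kq: "real k < q" using k by (simp add: q_def)
  assume "\<not> ?thesis"
  then have n: "real n \<le> 1 / 32 * real p powr (1 / (16 * C) * (\<epsilon>\<^sup>2 / \<delta>\<^sup>2))" by simp
  let ?v = "var (samples n (null_law p)) h"
  have var: "?v > 0" and
    gap: "\<bar>mean (samples n (null_law p)) h - mean (cube_distribution p) (\<lambda>v. mean (samples n (planted_law p v)) h)\<bar> \<ge> \<tau> * sqrt ?v"
    using dist by (simp_all add: distinguisher_def law_null_eq law_alt_eq)
  have "\<bar>mean (samples n (null_law p)) h - (\<Sum>v\<in>cube p. mean (samples n (planted_law p v)) h) / card (cube p)\<bar> < sqrt ?v"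
  proof (rule low_degree_bound[where \<eta> = "1 / q"])
    show "(\<Sum>i<p. (v i)\<^sup>2) = 1" if "v \<in> cube p" for v by (rule cube_unit[OF that p])
    show "0 \<le> 1 / q" "1 / q \<le> 1 / 2" using q36 by (auto simp: field_simps)
    show "(\<Sum>v\<in>cube p. \<Sum>w\<in>cube p. \<bar>\<Sum>i<p. v i * w i\<bar> ^ d) \<le> (real (card (cube p)))\<^sup>2 * (1 / q) ^ d"
      if d: "1 \<le> d" "d \<le> k" for d
    proof -
      have dq: "real d \<le> q" using d kq by linarith
      also have "q \<le> q ^ 4" using q36 by (intro self_le_power) auto
      finally have dp: "d \<le> p" using q4 by simp
      \<comment> \<open>From d \<le> q and p = q^4 one gets d/p \<le> q^(-3). The surplus over
        q^(-2) is a factor q \<ge> 36 that absorbs 4 e^2; hence the lower bound 36^4 on p.\<close>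
      have x: "2 * exp 1 * sqrt (d / p) \<le> 1 / q"
      proof (rule power2_le_imp_le)
        have "(2 * exp 1 * sqrt (d / p))\<^sup>2 = 4 * (exp 1)\<^sup>2 * (d / p)"
          by (simp add: power_mult_distrib)
        also have "\<dots> \<le> 4 * 3\<^sup>2 * (q / q ^ 4)"
          unfolding q4[symmetric] using dq q36 exp_le
          by (intro mult_mono power_mono divide_right_mono) auto
        also have "\<dots> = 36 / q ^ 3"
          using q36 by (simp add: field_simps eval_nat_numeral)
        also have "\<dots> \<le> q / q ^ 3"
          using q36 by (intro divide_right_mono) auto
        also have "\<dots> = (1 / q)\<^sup>2"
          using q36 by (simp add: field_simps eval_nat_numeral)
        finally show "(2 * exp 1 * sqrt (d / p))\<^sup>2 \<le> (1 / q)\<^sup>2" .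
      qed (use q36 in simp)
      have "(\<Sum>v\<in>cube p. \<Sum>w\<in>cube p. \<bar>\<Sum>i<p. v i * w i\<bar> ^ d) = (\<Sum>w\<in>cube p. \<Sum>v\<in>cube p. \<bar>\<Sum>i<p. v i * w i\<bar> ^ d)"
        by (rule sum.swap)
      also have "\<dots> \<le> (\<Sum>w\<in>cube p. card (cube p) * (1 / q) ^ d)"
      proof (rule sum_mono)
        fix w assume "w \<in> cube p"
        then have "(\<Sum>v\<in>cube p. \<bar>\<Sum>i<p. v i * w i\<bar> ^ d) \<le> card (cube p) * (2 * exp 1 * sqrt (d / p)) ^ d"
          by (rule cube_correlation_moment[OF _ d(1) dp])
        also have "\<dots> \<le> card (cube p) * (1 / q) ^ d"
          by (intro mult_left_mono power_mono x) auto
        finally show "(\<Sum>v\<in>cube p. \<bar>\<Sum>i<p. v i * w i\<bar> ^ d) \<le> \<dots>" .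
      qed
      also have "\<dots> = (real (card (cube p)))\<^sup>2 * (1 / q) ^ d"
        by (simp add: power2_eq_square)
      finally show ?thesis .
    qed
    \<comment> \<open>Here 4 times 8, with 8 the second moment bound, explains the constant
      1/32.\<close>
    show "4 * real n * 8 * (1 / q) ^ Suc m \<le> 1"
    proof -
      have "real p powr (1 / (16 * C) * (\<epsilon>\<^sup>2 / \<delta>\<^sup>2)) = q powr (\<epsilon>\<^sup>2 / (4 * C * \<delta>\<^sup>2))"
        unfolding q_def powr_powr by (simp add: field_simps)
      \<comment> \<open>Rounding down loses less than 1, which is recovered because the first
        unmatched order is m + 1.\<close>
      also have "\<dots> \<le> q powr real (Suc m)"
      proof (rule powr_mono)
        have "0 \<le> \<epsilon>\<^sup>2 / (4 * C * \<delta>\<^sup>2)" using C by simp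
        then show "\<epsilon>\<^sup>2 / (4 * C * \<delta>\<^sup>2) \<le> real (Suc m)"
          unfolding m num_moments_def by (auto simp: of_nat_nat) linarith
      qed (use q36 in simp)
      also have "\<dots> = q ^ Suc m" using q36 by (intro powr_realpow) simp
      finally have "32 * real n \<le> q ^ Suc m" using n by simp
      then show ?thesis using q36 by (simp add: power_divide divide_le_eq del: power_Suc)
    qed
  qed (use h var in auto)
  moreover have "mean (cube_distribution p) (\<lambda>v. mean (samples n (planted_law p v)) h) =
    (\<Sum>v\<in>cube p. mean (samples n (planted_law p v)) h) / card (cube p)"
    by (rule mean_cube_distribution[OF p mean_planted_measurable[OF h]])
  moreover have "1 * sqrt ?v \<le> \<tau> * sqrt ?v"
    using \<tau> var by (intro mult_right_mono) auto
  ultimately show False using gap by simp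
qed

end

theorem corollary4p14:
  "(\<exists>C. dual_constant C) \<and>
   (\<forall>C. dual_constant C \<longrightarrow>
     (\<exists>C1 C2 C3 c1 c2 c3 :: real.
        C1 > 0 \<and> C2 > 0 \<and> C3 > 0 \<and> c1 > 0 \<and> c2 > 0 \<and> c3 > 0 \<and>
        (\<forall>(\<epsilon>::real) (\<delta>::real) (p::nat) (k::nat) (g :: nat \<Rightarrow> real \<Rightarrow> real) (m::nat).
           0 < \<epsilon> \<and> \<epsilon> < 1 / 2 \<and> \<delta> > 0 \<and> \<epsilon> / \<delta> \<ge> C1 \<and>
           real p \<ge> C2 * (\<epsilon>\<^sup>2 / \<delta>\<^sup>2) powr C3 \<and> real k < real p powr c1 \<and>
           m = num_moments C \<epsilon> \<delta> \<and> dual_family C m g \<longrightarrow>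
           (\<exists>H. sphere_distribution p H \<and>
              (\<forall>(n::nat) (\<tau>::real) h.
                 \<tau> \<ge> 1 \<and> sample_poly n p k h \<and>
                 distinguisher n (law_null \<epsilon> \<delta> m g p) (law_alt \<epsilon> \<delta> m g p) H \<tau> h \<longrightarrow>
                 real n \<ge> c2 * real p powr (c3 * (\<epsilon>\<^sup>2 / \<delta>\<^sup>2)))))))"
  (is "_ \<and> (\<forall>C. _ \<longrightarrow> ?Q C)")
proof (intro conjI allI impI)
  show "\<exists>C. dual_constant C" by (rule dual_constant_exists)
next
  fix C assume "dual_constant C"
  then have C: "C > 0" by (simp add: dual_constant_def)
  have main: "\<exists>H. sphere_distribution p H \<and> (\<forall>n \<tau> h.
      \<tau> \<ge> 1 \<and> sample_poly n p k h \<and>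
      distinguisher n (law_null \<epsilon> \<delta> m g p) (law_alt \<epsilon> \<delta> m g p) H \<tau> h \<longrightarrow>
      real n \<ge> 1 / 32 * real p powr (1 / (16 * C) * (\<epsilon>\<^sup>2 / \<delta>\<^sup>2)))"
    if asm: "0 < \<epsilon> \<and> \<epsilon> < 1 / 2 \<and> \<delta> > 0 \<and> \<epsilon> / \<delta> \<ge> 1 \<and>
       real p \<ge> 36 ^ 4 * (\<epsilon>\<^sup>2 / \<delta>\<^sup>2) powr 1 \<and> real k < real p powr (1 / 4) \<and>
       m = num_moments C \<epsilon> \<delta> \<and> dual_family C m g"
    for \<epsilon> \<delta> :: real and p k m g
  proof -
    from asm have \<delta>: "0 < \<delta>" "1 \<le> \<epsilon> / \<delta>" by auto
    then have "\<delta> \<le> \<epsilon>" by (simp add: pos_le_divide_eq)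
    then interpret contaminated_regression \<epsilon> \<delta> C m g
      using asm C by unfold_locales auto
    have "1 \<le> (\<epsilon> / \<delta>)\<^sup>2" using \<delta> by (simp add: one_le_power)
    then have "1 \<le> (\<epsilon>\<^sup>2 / \<delta>\<^sup>2) powr 1" by (simp add: power_divide)
    then have "(36 :: real) ^ 4 * 1 \<le> 36 ^ 4 * (\<epsilon>\<^sup>2 / \<delta>\<^sup>2) powr 1" by (intro mult_left_mono) auto
    with asm have p36: "36 ^ 4 \<le> real p" by linarith
    then have "p > 0" by (intro gr0I) auto
    moreover have "real k < real p powr (1 / 4)" using asm by blast
    ultimately show ?thesis
      using sphere_distribution_cube distinguisher_sample_size[OF p36]
      by (intro exI[of _ "cube_distribution p"]) blast
  qed
  \<comment> \<open>Only c3 depends on \<open>C\<close>: 1/(16 C) is the product of 1/4 from \<eta>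
    = p^(-1/4) and 1/(4 C) from the number of moments.\<close>
  show "?Q C"
    by (rule exI[of _ 1], rule exI[of _ "36 ^ 4"], rule exI[of _ 1], rule exI[of _ "1 / 4"],
        rule exI[of _ "1 / 32"], rule exI[of _ "1 / (16 * C)"])
      (intro conjI allI impI main, use C in simp_all)
qed

end
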